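(* Let $L$ be a $q$-constrained Willmore surface in $S^4$ and let $\alpha,L^\alpha$ be untwisted Bäcklund transformation parameters to $L$ (corresponding to the multiplier $q$). Then the untwisted Bäcklund transform $L^*$ of $L$ of parameters $\alpha,L^\alpha$ is a constrained Willmore surface in $S^4$, provided that it immerses.
   Context: Quaternionic model of $S^4$. $\mathbb{H}^2$ is identified with $\mathbb{C}^4$; left multiplication by the quaternion $j$ gives a complex anti-linear $j:\mathbb{C}^4\to\mathbb{C}^4$, $j^2=-1$. Fix $\det\in\wedge^4(\mathbb{C}^4)^*\backslash\{0\}$ with $\overline{\det\circ\wedge^4j}=\det$ and $\det(v_1,v_2,jv_1,jv_2)>0$ whenever $v_1,v_2,jv_1,jv_2$ are linearly independent. $\wedge^2\mathbb{C}^4$ has real structure $\wedge^2j$ (conjugation) and metric $(v_1\wedge v_2,v_3\wedge v_4)=\det(v_1,v_2,v_3,v_4)$, of signature $(5,1)$ on $\mathrm{Fix}(\wedge^2j)=\mathbb{R}^{5,1}$. $j$-stable $2$-planes $L$ correspond to real null lines $\wedge^2L$, i.e. to points of $S^4\cong\mathbb{P}(\mathcal{L})$, $\mathcal{L}$ the non-zero null vectors of $\mathbb{R}^{5,1}$. $sl(\mathbb{C}^4)\cong o(\wedge^2\mathbb{C}^4)$ via $\hat f(x\wedge y)=(fx)\wedge y+x\wedge(fy)$. $M$ is an oriented surface; $\underline{\mathbb{C}}^4=M\times\mathbb{C}^4$; $d$ denotes trivial flat connections. The theory is local: restriction to a suitable non-empty open subset is always understood. A surface in $S^4$ is a rank $2$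 $j$-stable subbundle $L\subset\underline{\mathbb{C}}^4$ which immerses, i.e. such that $\Lambda:=\wedge^2L:M\to\mathbb{P}(\mathcal{L})$ is an immersion (standing assumption: not contained in any proper subsphere of $S^4$). $M$ carries the conformal structure induced by $\Lambda$, with complex structure $J$, and $*\omega=-\omega\circ J$ on $1$-forms. Let $\delta:=\pi_{\underline{\mathbb{C}}^4/L}\circ d|_L$. The mean curvature sphere of $L$ is the unique $j$-commuting $S\in\Gamma(\mathrm{End}(\underline{\mathbb{C}}^4))$, $S^2=-I$, with $SL=L$, $(dS)L\subset L$, $*\delta=S\circ\delta=\delta\circ S|_L$ and $(S\,dS-*dS)L=0$. $S_\pm$ are its $\pm i$-eigenbundles, $S_-=jS_+$, and $L_\pm:=L\cap S_\pm$ (line bundles). $\mathcal{N}_S:=\frac12S\,dS$, $\mathcal{D}_S:=d-\mathcal{N}_S$. For $q$ a $1$-form with values in $\mathrm{End}_j(\underline{\mathbb{C}}^4/L,L)$ ($j$-commuting endomorphisms of $\underline{\mathbb{C}}^4$ vanishing on $L$ with image in $L$) and $Sq=*q=qS$, $L$ is $q$-constrained Willmore if $d^{\mathcal{D}_S}q=0$ and $d^{\mathcal{D}_S}*\mathcal{N}_S=2[q\wedge*\mathcal{N}_S]$, where $[\mu\wedge\eta](X,Y)=[\mu_X,\eta_Y]-[\mu_Y,\eta_X]$. $L$ is a constrained Willmore surface if it is $q$-constrained Willmore for some such $q$. Connections. $V:=S_+\wedge S_-\subset\wedge^2\underline{\mathbb{C}}^4$, $V^\perp=\wedge^2S_+\oplus\wedge^2S_-$,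 $\mathcal{D}_V:=\pi_V\circ d\circ\pi_V+\pi_{V^\perp}\circ d\circ\pi_{V^\perp}$, $\mathcal{N}_V:=d-\mathcal{D}_V$, and (with $q$ acting through $\hat q$) $d^{\lambda,q}_V:=\mathcal{D}_V+\lambda^{-1}\mathcal{N}_V^{1,0}+\lambda\mathcal{N}_V^{0,1}+(\lambda^{-2}-1)q^{1,0}+(\lambda^2-1)q^{0,1}$ on $\wedge^2\underline{\mathbb{C}}^4$. For $\lambda\in\mathbb{C}\backslash\{0\}$, $\tau(\lambda)\in\Gamma(O(\wedge^2\underline{\mathbb{C}}^4))$ is $\lambda^{-1}$ on $\wedge^2S_+$, $1$ on $S_+\wedge S_-$, $\lambda$ on $\wedge^2S_-$. Untwisted Bäcklund transformation. Let $\alpha\in\mathbb{C}\backslash S^1$ be non-zero and $L^\alpha\subset\wedge^2\underline{\mathbb{C}}^4$ a $d^{\alpha,q}_V$-parallel null line subbundle such that, locally, $\tau(\alpha)L^\alpha$ is never real. Let $W\subset\underline{\mathbb{C}}^4$ be the rank $2$ bundle with $\wedge^2W=\tau(\alpha)L^\alpha$; then $\underline{\mathbb{C}}^4=W\oplus jW$. With $$r_\alpha(\lambda)=\frac{1-\overline\alpha^{-2}}{1-\alpha^2}\cdot\frac{\lambda-\alpha^2}{\lambda-\overline\alpha^{-2}},$$ fix a square root $\sqrt{r_\alpha(0)}$ and let $r(0)\in\Gamma(\mathrm{Sl}(\underline{\mathbb{C}}^4))$ be $\sqrt{r_\alpha(0)}$ on $W$ and $\sqrt{r_\alpha(0)}^{\,-1}$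 on $jW$; let $r(\infty)$ be $\overline{\sqrt{r_\alpha(0)}}^{\,-1}$ on $W$ and $\overline{\sqrt{r_\alpha(0)}}$ on $jW$, so that $r(0)\circ j=j\circ r(\infty)$. $\alpha,L^\alpha$ are untwisted Bäcklund transformation parameters if, in addition, locally, $S^*_+:=r(0)S_+$ and $S^*_-:=jS^*_+=r(\infty)S_-$ are complementary in $\underline{\mathbb{C}}^4$. With $\pi_{S^*_\pm}$ the projections for $\underline{\mathbb{C}}^4=S^*_+\oplus S^*_-$, set $L^*_+:=\pi_{S^*_+}r(\infty)L_+$, $L^*_-:=jL^*_+=\pi_{S^*_-}r(0)L_-$. The untwisted Bäcklund transform $L^*$ is the $j$-stable rank $2$ bundle with $\wedge^2L^*=L^*_+\wedge L^*_-$, i.e. $L^*=L^*_+\oplus L^*_-$; it immerses if $\wedge^2L^*:M\to\mathbb{P}(\mathcal{L})$ is an immersion. *)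

theory Defs
  imports "HOL-Analysis.Analysis"
begin

text \<open>A surface is a topological space X with an oriented atlas A; a
  chart is a pair of its open domain and its coordinate map into the plane.  A tangent vector at p
  is given by its coordinate vector v in a chart c, so a 1-form is a function of c, p, v (linear in
  v) which is invariant under change of chart.\<close>

fun Ck_on :: "nat \<Rightarrow> (real^2) set \<Rightarrow> (real^2 \<Rightarrow> 'e::real_normed_vector) \<Rightarrow> bool" where
  "Ck_on 0 D f \<longleftrightarrow> continuous_on D f"
| "Ck_on (Suc k) D f \<longleftrightarrow> f differentiable_on D \<and>
     (\<forall>v. Ck_on k D (\<lambda>x. frechet_derivative f (at x) v))"

definition smooth_on :: "(real^2) set \<Rightarrow> (real^2 \<Rightarrow> 'e::real_normed_vector) \<Rightarrow> bool" where
  "smooth_on D f \<longleftrightarrow> (\<forall>k. Ck_on k D f)"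

type_synonym 'm chart = "'m set \<times> ('m \<Rightarrow> real^2)"

abbreviation dom_ch :: "'m chart \<Rightarrow> 'm set" where "dom_ch \<equiv> fst"
abbreviation coord :: "'m chart \<Rightarrow> 'm \<Rightarrow> real^2" where "coord \<equiv> snd"

definition in_chart :: "'m chart \<Rightarrow> ('m \<Rightarrow> 'e) \<Rightarrow> real^2 \<Rightarrow> 'e" where
  "in_chart c f = f \<circ> inv_into (dom_ch c) (coord c)"

text \<open>The trivial flat connection: \<open>dd c f p v\<close> is the derivative of f at p along the tangent
  vector with coordinates v in the chart c.  In particular \<open>dd c (coord c') p\<close> is the change of
  coordinates of tangent vectors at p from c to c'.\<close>

definition dd :: "'m chart \<Rightarrow> ('m \<Rightarrow> 'e::real_normed_vector) \<Rightarrow> 'm \<Rightarrow> real^2 \<Rightarrow> 'e" where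
  "dd c f p v = frechet_derivative (in_chart c f) (at (coord c p)) v"

definition oriented_surface :: "'m topology \<Rightarrow> 'm chart set \<Rightarrow> bool" where
  "oriented_surface X A \<longleftrightarrow>
     Hausdorff_space X \<and> second_countable X \<and> (\<Union>c\<in>A. dom_ch c) = topspace X \<and>
     (\<forall>c\<in>A. openin X (dom_ch c) \<and> open (coord c ` dom_ch c) \<and>
        homeomorphic_map (subtopology X (dom_ch c))
          (subtopology euclidean (coord c ` dom_ch c)) (coord c)) \<and>
     (\<forall>c\<in>A. \<forall>c'\<in>A. smooth_on (coord c ` (dom_ch c \<inter> dom_ch c')) (in_chart c (coord c')) \<and>
        (\<forall>p\<in>dom_ch c \<inter> dom_ch c'. det (matrix (dd c (coord c') p)) > 0))"

definition smooth_map :: "'m chart set \<Rightarrow> 'm set \<Rightarrow> ('m \<Rightarrow> 'e::real_normed_vector) \<Rightarrow> bool" where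
  "smooth_map A N f \<longleftrightarrow> (\<forall>c\<in>A. smooth_on (coord c ` (dom_ch c \<inter> N)) (in_chart c f))"

type_synonym ('m, 'e) form = "'m chart \<Rightarrow> 'm \<Rightarrow> real^2 \<Rightarrow> 'e"

definition one_form :: "'m chart set \<Rightarrow> ('m, 'e::real_normed_vector) form \<Rightarrow> bool" where
  "one_form A w \<longleftrightarrow>
     (\<forall>c\<in>A. (\<forall>p\<in>dom_ch c. linear (w c p)) \<and>
        (\<forall>v. smooth_on (coord c ` dom_ch c) (in_chart c (\<lambda>p. w c p v)))) \<and>
     (\<forall>c\<in>A. \<forall>c'\<in>A. \<forall>p\<in>dom_ch c \<inter> dom_ch c'. \<forall>v. w c p v = w c' p (dd c (coord c') p v))"

definition complex_structure :: "'m chart set \<Rightarrow> ('m, real^2) form \<Rightarrow> bool" where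
  "complex_structure A J \<longleftrightarrow>
     (\<forall>c\<in>A. (\<forall>p\<in>dom_ch c. linear (J c p) \<and>
          (\<forall>v. J c p (J c p v) = - v) \<and>
          (\<forall>v. v \<noteq> 0 \<longrightarrow> det (vector [v, J c p v] :: real^2^2) > 0)) \<and>
        (\<forall>v. smooth_on (coord c ` dom_ch c) (in_chart c (\<lambda>p. J c p v)))) \<and>
     (\<forall>c\<in>A. \<forall>c'\<in>A. \<forall>p\<in>dom_ch c \<inter> dom_ch c'. \<forall>v.
        dd c (coord c') p (J c p v) = J c' p (dd c (coord c') p v))"

text \<open>The (1,0)- and (0,1)-parts: with \<open>* w = - w \<circ> J\<close>, a form is of type (1,0) iff \<open>* w = - \<i> w\<close>.
  Here w is the form at a single point and J the complex structure of the tangent plane.\<close>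

definition part10 :: "(real^2 \<Rightarrow> real^2) \<Rightarrow> (real^2 \<Rightarrow> complex^'n) \<Rightarrow> real^2 \<Rightarrow> complex^'n" where
  "part10 J w v = (1/2) *s (w v - \<i> *s w (J v))"

definition part01 :: "(real^2 \<Rightarrow> real^2) \<Rightarrow> (real^2 \<Rightarrow> complex^'n) \<Rightarrow> real^2 \<Rightarrow> complex^'n" where
  "part01 J w v = (1/2) *s (w v + \<i> *s w (J v))"

definition smooth_subbundle ::
    "'m topology \<Rightarrow> 'm chart set \<Rightarrow> nat \<Rightarrow> ('m \<Rightarrow> (complex^'n) set) \<Rightarrow> bool" where
  "smooth_subbundle X A k E \<longleftrightarrow>
     (\<forall>p\<in>topspace X. \<exists>N s. openin X N \<and> p \<in> N \<and> (\<forall>i<k. smooth_map A N (s i)) \<and>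
        (\<forall>x\<in>N. E x = vec.span ((\<lambda>i::nat. s i x) ` {..<k}) \<and> vec.dim (E x) = k))"

definition local_sec ::
    "'m topology \<Rightarrow> 'm chart set \<Rightarrow> ('m \<Rightarrow> (complex^'n) set) \<Rightarrow> 'm set \<Rightarrow> ('m \<Rightarrow> complex^'n) \<Rightarrow> bool"
  where
  "local_sec X A E N s \<longleftrightarrow> openin X N \<and> smooth_map A N s \<and> (\<forall>x\<in>N. s x \<in> E x)"


definition sumset :: "(complex^'n) set \<Rightarrow> (complex^'n) set \<Rightarrow> (complex^'n) set" where
  "sumset E F = {x + y | x y. x \<in> E \<and> y \<in> F}"

definition complementary :: "(complex^'n) set \<Rightarrow> (complex^'n) set \<Rightarrow> bool" where
  "complementary E F \<longleftrightarrow> sumset E F = UNIV \<and> E \<inter> F = {0}"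

text \<open>Projection onto E along F; meaningful on vectors of the direct sum of E and F.\<close>

definition proj_along ::
    "(complex^'n) set \<Rightarrow> (complex^'n) set \<Rightarrow> complex^'n \<Rightarrow> complex^'n" where
  "proj_along E F x = (THE a. a \<in> E \<and> (\<exists>b\<in>F. x = a + b))"

text \<open>\<open>\<complex>\<^sup>4\<close> is \<open>\<H>\<^sup>2\<close>, the quadruple z being the pair of quaternions
  \<open>z\<^sub>1 + z\<^sub>2 j\<close> and \<open>z\<^sub>3 + z\<^sub>4 j\<close>; both \<open>\<i>\<close> and \<open>j\<close> multiply from the left.\<close>

definition jmap :: "complex^4 \<Rightarrow> complex^4" where
  "jmap z = (\<chi> i. if i = 1 then - cnj (z$2) else if i = 2 then cnj (z$1)
                  else if i = 3 then - cnj (z$4) else cnj (z$3))"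

definition j_commuting :: "complex^4^4 \<Rightarrow> bool" where
  "j_commuting f \<longleftrightarrow> (\<forall>x. f *v jmap x = jmap (f *v x))"

text \<open>Every element of the one-dimensional space \<open>\<Lambda>\<^sup>4(\<complex>\<^sup>4)*\<close> is a multiple \<open>vol \<kappa>\<close> of the standard
  determinant; \<open>admissible \<kappa>\<close> says that it may serve as the fixed determinant form.\<close>

definition vol :: "complex \<Rightarrow> complex^4 \<Rightarrow> complex^4 \<Rightarrow> complex^4 \<Rightarrow> complex^4 \<Rightarrow> complex" where
  "vol \<kappa> a b c d =
     \<kappa> * det ((\<chi> i. if i = 1 then a else if i = 2 then b else if i = 3 then c else d) :: complex^4^4)"

definition admissible :: "complex \<Rightarrow> bool" where
  "admissible \<kappa> \<longleftrightarrow> \<kappa> \<noteq> 0 \<and>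
     (\<forall>a b c d. cnj (vol \<kappa> (jmap a) (jmap b) (jmap c) (jmap d)) = vol \<kappa> a b c d) \<and>
     (\<forall>a b. vec.dim {a, b, jmap a, jmap b} = 4 \<longrightarrow>
        vol \<kappa> a b (jmap a) (jmap b) \<in> \<real> \<and> Re (vol \<kappa> a b (jmap a) (jmap b)) > 0)"

text \<open>\<open>\<Lambda>\<^sup>2\<complex>\<^sup>4\<close> is the space of skew-symmetric tensors in \<open>\<complex>\<^sup>4 \<otimes> \<complex>\<^sup>4\<close>.\<close>

type_synonym tensor2 = "complex^(4 \<times> 4)"

definition wedge :: "complex^4 \<Rightarrow> complex^4 \<Rightarrow> tensor2" where
  "wedge x y = (\<chi> ij. x $ fst ij * y $ snd ij - y $ fst ij * x $ snd ij)"

definition Wedge2 :: "tensor2 set" where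
  "Wedge2 = {T. \<forall>i j. T $ (i, j) = - (T $ (j, i))}"

definition wedge_space :: "(complex^4) set \<Rightarrow> (complex^4) set \<Rightarrow> tensor2 set" where
  "wedge_space E F = vec.span {wedge x y | x y. x \<in> E \<and> y \<in> F}"

definition metric2 :: "complex \<Rightarrow> tensor2 \<Rightarrow> tensor2 \<Rightarrow> complex" where
  "metric2 \<kappa> T U = (\<Sum>i\<in>UNIV. \<Sum>j\<in>UNIV. \<Sum>k\<in>UNIV. \<Sum>l\<in>UNIV.
     T $ (i, j) * U $ (k, l) * vol \<kappa> (axis i 1) (axis j 1) (axis k 1) (axis l 1)) / 4"

text \<open>The real structure \<open>\<Lambda>\<^sup>2j\<close>.\<close>

definition conj2 :: "tensor2 \<Rightarrow> tensor2" where
  "conj2 T = (\<chi> ij. \<Sum>k\<in>UNIV. \<Sum>l\<in>UNIV.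
     cnj (T $ (k, l)) * jmap (axis k 1) $ fst ij * jmap (axis l 1) $ snd ij)"

definition hat :: "complex^4^4 \<Rightarrow> tensor2 \<Rightarrow> tensor2" where
  "hat f T = (\<chi> ij. (\<Sum>k\<in>UNIV. f $ fst ij $ k * T $ (k, snd ij)) +
                    (\<Sum>k\<in>UNIV. f $ snd ij $ k * T $ (fst ij, k)))"

lemma jmap_add: "jmap (x + y) = jmap x + jmap y"
  by (simp add: jmap_def vec_eq_iff)

lemma jmap_scale: "jmap (c *s x) = cnj c *s jmap x"
  by (simp add: jmap_def vec_eq_iff)

lemma jmap_jmap: "jmap (jmap x) = - x"
  by (simp add: jmap_def vec_eq_iff forall_4)

lemma hat_wedge: "hat f (wedge x y) = wedge (f *v x) y + wedge x (f *v y)"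
  by (simp add: hat_def wedge_def matrix_vector_mult_def vec_eq_iff sum_4 algebra_simps)

lemma conj2_wedge: "conj2 (wedge x y) = wedge (jmap x) (jmap y)"
  by (simp add: conj2_def wedge_def jmap_def axis_def vec_eq_iff forall_4 sum_4 algebra_simps)


text \<open>Local nowhere-zero sections of the real null line
  bundle \<open>\<Lambda>\<^sup>2L \<inter> Fix(\<Lambda>\<^sup>2j)\<close>.\<close>

definition real_lift :: "'m topology \<Rightarrow> 'm chart set \<Rightarrow> ('m \<Rightarrow> (complex^4) set) \<Rightarrow>
    'm set \<Rightarrow> ('m \<Rightarrow> tensor2) \<Rightarrow> bool" where
  "real_lift X A L N \<sigma> \<longleftrightarrow> local_sec X A (\<lambda>x. wedge_space (L x) (L x)) N \<sigma> \<and>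
     (\<forall>x\<in>N. conj2 (\<sigma> x) = \<sigma> x \<and> \<sigma> x \<noteq> 0)"

text \<open>The differential of \<open>[\<sigma>]\<close> along v is the class of \<open>d\<^sub>v\<sigma>\<close> modulo the line spanned by \<open>\<sigma>\<close>.\<close>

definition immerses :: "'m topology \<Rightarrow> 'm chart set \<Rightarrow> ('m \<Rightarrow> (complex^4) set) \<Rightarrow> bool" where
  "immerses X A L \<longleftrightarrow>
     (\<forall>N \<sigma>. real_lift X A L N \<sigma> \<longrightarrow> (\<forall>p\<in>N. \<forall>c\<in>A. p \<in> dom_ch c \<longrightarrow>
        (\<forall>v. dd c \<sigma> p v \<in> wedge_space (L p) (L p) \<longrightarrow> v = 0)))"

definition surface_S4 :: "'m topology \<Rightarrow> 'm chart set \<Rightarrow> ('m \<Rightarrow> (complex^4) set) \<Rightarrow> bool" where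
  "surface_S4 X A L \<longleftrightarrow> smooth_subbundle X A 2 L \<and> (\<forall>p\<in>topspace X. jmap ` L p = L p) \<and>
     immerses X A L"

text \<open>Proper subspheres are contained in hyperspheres, and the hyperspheres are the intersections
  with \<open>v\<^sup>\<bottom>\<close> for space-like real v.\<close>

definition in_proper_subsphere ::
    "complex \<Rightarrow> 'm topology \<Rightarrow> ('m \<Rightarrow> (complex^4) set) \<Rightarrow> bool" where
  "in_proper_subsphere \<kappa> X L \<longleftrightarrow>
     (\<exists>v\<in>Wedge2. conj2 v = v \<and> Re (metric2 \<kappa> v v) > 0 \<and>
        (\<forall>p\<in>topspace X. \<forall>\<sigma>\<in>wedge_space (L p) (L p). metric2 \<kappa> v \<sigma> = 0))"

text \<open>J is the complex structure of the conformal class of the metrics \<open>(d\<sigma>, d\<sigma>)\<close>.\<close>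

definition induced_complex_structure :: "complex \<Rightarrow> 'm topology \<Rightarrow> 'm chart set \<Rightarrow>
    ('m \<Rightarrow> (complex^4) set) \<Rightarrow> ('m, real^2) form \<Rightarrow> bool" where
  "induced_complex_structure \<kappa> X A L J \<longleftrightarrow> complex_structure A J \<and>
     (\<forall>N \<sigma>. real_lift X A L N \<sigma> \<longrightarrow> (\<forall>p\<in>N. \<forall>c\<in>A. p \<in> dom_ch c \<longrightarrow>
        (\<forall>v w. metric2 \<kappa> (dd c \<sigma> p (J c p v)) (dd c \<sigma> p (J c p w)) =
               metric2 \<kappa> (dd c \<sigma> p v) (dd c \<sigma> p w))))"

text \<open>The fourth condition is \<open>*\<delta> = S \<circ> \<delta> = \<delta> \<circ> S\<close> on L, where \<open>\<delta>\<close> of a section s is the class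
  of \<open>ds\<close> modulo L and \<open>*\<delta> = - \<delta> \<circ> J\<close>; the last one is \<open>(S dS - *dS) L = 0\<close>.\<close>

definition mean_curvature_sphere :: "'m topology \<Rightarrow> 'm chart set \<Rightarrow> ('m, real^2) form \<Rightarrow>
    ('m \<Rightarrow> (complex^4) set) \<Rightarrow> ('m \<Rightarrow> complex^4^4) \<Rightarrow> bool" where
  "mean_curvature_sphere X A J L S \<longleftrightarrow>
     smooth_map A (topspace X) S \<and>
     (\<forall>p\<in>topspace X. j_commuting (S p) \<and> S p ** S p = - mat 1 \<and> (\<lambda>x. S p *v x) ` L p = L p) \<and>
     (\<forall>c\<in>A. \<forall>p\<in>dom_ch c. \<forall>v. \<forall>x\<in>L p. dd c S p v *v x \<in> L p) \<and>
     (\<forall>N s. local_sec X A L N s \<longrightarrow> (\<forall>p\<in>N. \<forall>c\<in>A. p \<in> dom_ch c \<longrightarrow>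
        (\<forall>v. - dd c s p (J c p v) - S p *v dd c s p v \<in> L p \<and>
             S p *v dd c s p v - dd c (\<lambda>x. S x *v s x) p v \<in> L p))) \<and>
     (\<forall>c\<in>A. \<forall>p\<in>dom_ch c. \<forall>v. \<forall>x\<in>L p.
        S p *v (dd c S p v *v x) + dd c S p (J c p v) *v x = 0)"

definition Splus :: "complex^4^4 \<Rightarrow> (complex^4) set" where "Splus S = {x. S *v x = \<i> *s x}"
definition Sminus :: "complex^4^4 \<Rightarrow> (complex^4) set" where "Sminus S = {x. S *v x = - \<i> *s x}"


abbreviation comm :: "complex^4^4 \<Rightarrow> complex^4^4 \<Rightarrow> complex^4^4" where
  "comm a b \<equiv> a ** b - b ** a"

definition star :: "('m, real^2) form \<Rightarrow> ('m, complex^4^4) form \<Rightarrow> ('m, complex^4^4) form" where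
  "star J w c p v = - w c p (J c p v)"

definition NS :: "('m \<Rightarrow> complex^4^4) \<Rightarrow> ('m, complex^4^4) form" where
  "NS S c p v = (1/2) *\<^sub>R (S p ** dd c S p v)"

definition bracket_wedge :: "('m, complex^4^4) form \<Rightarrow> ('m, complex^4^4) form \<Rightarrow>
    'm chart \<Rightarrow> 'm \<Rightarrow> real^2 \<Rightarrow> real^2 \<Rightarrow> complex^4^4" where
  "bracket_wedge m e c p v w = comm (m c p v) (e c p w) - comm (m c p w) (e c p v)"

text \<open>Exterior derivative of an End-valued 1-form with respect to the connection \<open>D = d - N\<close>,
  evaluated on the constant (hence commuting) coordinate fields v and w.\<close>

definition ext_deriv :: "('m, complex^4^4) form \<Rightarrow> ('m, complex^4^4) form \<Rightarrow>
    'm chart \<Rightarrow> 'm \<Rightarrow> real^2 \<Rightarrow> real^2 \<Rightarrow> complex^4^4" where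
  "ext_deriv N e c p v w =
     (dd c (\<lambda>x. e c x w) p v - comm (N c p v) (e c p w)) -
     (dd c (\<lambda>x. e c x v) p w - comm (N c p w) (e c p v))"

definition q_constrained_Willmore :: "complex \<Rightarrow> 'm topology \<Rightarrow> 'm chart set \<Rightarrow>
    ('m, real^2) form \<Rightarrow> ('m \<Rightarrow> complex^4^4) \<Rightarrow> ('m, complex^4^4) form \<Rightarrow>
    ('m \<Rightarrow> (complex^4) set) \<Rightarrow> bool" where
  "q_constrained_Willmore \<kappa> X A J S q L \<longleftrightarrow>
     surface_S4 X A L \<and> induced_complex_structure \<kappa> X A L J \<and> mean_curvature_sphere X A J L S \<and>
     one_form A q \<and>
     (\<forall>c\<in>A. \<forall>p\<in>dom_ch c. \<forall>v.
        j_commuting (q c p v) \<and> (\<forall>x\<in>L p. q c p v *v x = 0) \<and> (\<forall>x. q c p v *v x \<in> L p) \<and>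
        S p ** q c p v = star J q c p v \<and> star J q c p v = q c p v ** S p) \<and>
     (\<forall>c\<in>A. \<forall>p\<in>dom_ch c. \<forall>v w.
        ext_deriv (NS S) q c p v w = 0 \<and>
        ext_deriv (NS S) (star J (NS S)) c p v w = 2 *\<^sub>R bracket_wedge q (star J (NS S)) c p v w)"

definition constrained_Willmore ::
    "complex \<Rightarrow> 'm topology \<Rightarrow> 'm chart set \<Rightarrow> ('m \<Rightarrow> (complex^4) set) \<Rightarrow> bool" where
  "constrained_Willmore \<kappa> X A L \<longleftrightarrow> (\<exists>J S q. q_constrained_Willmore \<kappa> X A J S q L)"


text \<open>Connections on \<open>\<Lambda>\<^sup>2\<complex>\<^sup>4\<close> are given by their action on sections \<open>\<sigma>\<close>; \<open>NV\<close> is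
  tensorial in \<open>\<sigma>\<close>.\<close>

definition Vspace :: "complex^4^4 \<Rightarrow> tensor2 set" where
  "Vspace S = wedge_space (Splus S) (Sminus S)"

definition Vperp :: "complex^4^4 \<Rightarrow> tensor2 set" where
  "Vperp S = sumset (wedge_space (Splus S) (Splus S)) (wedge_space (Sminus S) (Sminus S))"

definition DV ::
    "('m \<Rightarrow> complex^4^4) \<Rightarrow> 'm chart \<Rightarrow> ('m \<Rightarrow> tensor2) \<Rightarrow> 'm \<Rightarrow> real^2 \<Rightarrow> tensor2" where
  "DV S c \<sigma> p v =
     proj_along (Vspace (S p)) (Vperp (S p))
       (dd c (\<lambda>x. proj_along (Vspace (S x)) (Vperp (S x)) (\<sigma> x)) p v) +
     proj_along (Vperp (S p)) (Vspace (S p))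
       (dd c (\<lambda>x. proj_along (Vperp (S x)) (Vspace (S x)) (\<sigma> x)) p v)"

definition NV ::
    "('m \<Rightarrow> complex^4^4) \<Rightarrow> 'm chart \<Rightarrow> ('m \<Rightarrow> tensor2) \<Rightarrow> 'm \<Rightarrow> real^2 \<Rightarrow> tensor2" where
  "NV S c \<sigma> p v = dd c \<sigma> p v - DV S c \<sigma> p v"

definition dVlq :: "('m, real^2) form \<Rightarrow> ('m \<Rightarrow> complex^4^4) \<Rightarrow> ('m, complex^4^4) form \<Rightarrow>
    complex \<Rightarrow> 'm chart \<Rightarrow> ('m \<Rightarrow> tensor2) \<Rightarrow> 'm \<Rightarrow> real^2 \<Rightarrow> tensor2" where
  "dVlq J S q l c \<sigma> p v = DV S c \<sigma> p v
     + inverse l *s part10 (J c p) (NV S c \<sigma> p) v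
     + l *s part01 (J c p) (NV S c \<sigma> p) v
     + (inverse (l^2) - 1) *s part10 (J c p) (\<lambda>u. hat (q c p u) (\<sigma> p)) v
     + (l^2 - 1) *s part01 (J c p) (\<lambda>u. hat (q c p u) (\<sigma> p)) v"

definition tau :: "complex^4^4 \<Rightarrow> complex \<Rightarrow> tensor2 \<Rightarrow> tensor2" where
  "tau S l T = (THE U. \<exists>a\<in>wedge_space (Splus S) (Splus S). \<exists>b\<in>wedge_space (Splus S) (Sminus S).
     \<exists>c\<in>wedge_space (Sminus S) (Sminus S). T = a + b + c \<and> U = inverse l *s a + b + l *s c)"


text \<open>W is the rank 2 bundle with
  \<open>\<Lambda>\<^sup>2W = \<tau>(\<alpha>)L\<^sup>\<alpha>\<close> and s the chosen square root of \<open>r_fun \<alpha> 0\<close>.\<close>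

definition r_fun :: "complex \<Rightarrow> complex \<Rightarrow> complex" where
  "r_fun \<alpha> l = (1 - inverse ((cnj \<alpha>)^2)) / (1 - \<alpha>^2) * ((l - \<alpha>^2) / (l - inverse ((cnj \<alpha>)^2)))"

definition two_scale :: "(complex^4) set \<Rightarrow> (complex^4) set \<Rightarrow> complex \<Rightarrow> complex \<Rightarrow>
    complex^4 \<Rightarrow> complex^4" where
  "two_scale E F s t x = s *s proj_along E F x + t *s proj_along F E x"

definition r_zero :: "complex \<Rightarrow> (complex^4) set \<Rightarrow> complex^4 \<Rightarrow> complex^4" where
  "r_zero s W = two_scale W (jmap ` W) s (inverse s)"

definition r_infty :: "complex \<Rightarrow> (complex^4) set \<Rightarrow> complex^4 \<Rightarrow> complex^4" where
  "r_infty s W = two_scale W (jmap ` W) (inverse (cnj s)) (cnj s)"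

definition BT_Splus :: "complex \<Rightarrow> (complex^4) set \<Rightarrow> complex^4^4 \<Rightarrow> (complex^4) set" where
  "BT_Splus s W S = r_zero s W ` Splus S"

definition BT_Sminus :: "complex \<Rightarrow> (complex^4) set \<Rightarrow> complex^4^4 \<Rightarrow> (complex^4) set" where
  "BT_Sminus s W S = jmap ` BT_Splus s W S"

definition untwisted_BT_parameters :: "complex \<Rightarrow> 'm topology \<Rightarrow> 'm chart set \<Rightarrow>
    ('m, real^2) form \<Rightarrow> ('m \<Rightarrow> complex^4^4) \<Rightarrow> ('m, complex^4^4) form \<Rightarrow>
    complex \<Rightarrow> ('m \<Rightarrow> tensor2 set) \<Rightarrow> ('m \<Rightarrow> (complex^4) set) \<Rightarrow> complex \<Rightarrow> bool" where
  "untwisted_BT_parameters \<kappa> X A J S q \<alpha> L\<alpha> W s \<longleftrightarrow>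
     \<alpha> \<noteq> 0 \<and> cmod \<alpha> \<noteq> 1 \<and>
     smooth_subbundle X A 1 L\<alpha> \<and>
     (\<forall>p\<in>topspace X. L\<alpha> p \<subseteq> Wedge2 \<and> (\<forall>\<sigma>\<in>L\<alpha> p. metric2 \<kappa> \<sigma> \<sigma> = 0)) \<and>
     (\<forall>N \<sigma>. local_sec X A L\<alpha> N \<sigma> \<longrightarrow> (\<forall>p\<in>N. \<forall>c\<in>A. p \<in> dom_ch c \<longrightarrow>
        (\<forall>v. dVlq J S q \<alpha> c \<sigma> p v \<in> L\<alpha> p))) \<and>
     (\<forall>p\<in>topspace X. conj2 ` (tau (S p) \<alpha> ` L\<alpha> p) \<noteq> tau (S p) \<alpha> ` L\<alpha> p) \<and>
     smooth_subbundle X A 2 W \<and>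
     (\<forall>p\<in>topspace X. wedge_space (W p) (W p) = tau (S p) \<alpha> ` L\<alpha> p) \<and>
     s^2 = r_fun \<alpha> 0 \<and>
     (\<forall>p\<in>topspace X. complementary (BT_Splus s (W p) (S p)) (BT_Sminus s (W p) (S p)))"

definition BT_Lplus ::
    "complex \<Rightarrow> (complex^4) set \<Rightarrow> complex^4^4 \<Rightarrow> (complex^4) set \<Rightarrow> (complex^4) set" where
  "BT_Lplus s W S L =
     (\<lambda>x. proj_along (BT_Splus s W S) (BT_Sminus s W S) (r_infty s W x)) ` (L \<inter> Splus S)"

definition untwisted_BT :: "complex \<Rightarrow> ('m \<Rightarrow> (complex^4) set) \<Rightarrow> ('m \<Rightarrow> complex^4^4) \<Rightarrow>
    ('m \<Rightarrow> (complex^4) set) \<Rightarrow> 'm \<Rightarrow> (complex^4) set" where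
  "untwisted_BT s W S L p =
     sumset (BT_Lplus s (W p) (S p) (L p)) (jmap ` BT_Lplus s (W p) (S p) (L p))"

end

theory Submission
  imports Defs
begin

text \<open>Put \<open>N = (S dS) / 2\<close>, \<open>Q = (N + S * N) / 2\<close> and \<open>\<Phi> = Q + q\<close>, with (1,0)- and (0,1)-parts
  \<open>\<Phi>'\<close> and \<open>\<Phi>''\<close>. The constrained Willmore equations say that \<open>d - 2 \<Phi>\<close> is flat. Up to a gauge, the
  connections on two-vectors come from \<open>d + (\<mu>\<^sup>-\<^sup>1 - 1) \<Phi>' + (\<mu> - 1) \<Phi>''\<close> on \<open>\<complex>\<^sup>4\<close> with \<open>\<mu> = \<lambda>\<^sup>2\<close>, and W is
  parallel for \<open>\<mu> = \<alpha>\<^sup>2\<close>. This determines the derivative of the projection onto W along jW, and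
  the matrix that is the value \<open>r\<^sub>\<alpha>(-1)\<close> on W and 1 on jW gauges \<open>d - 2 \<Phi>\<close> to \<open>d - 2 \<Phi>*\<close>, where \<open>\<Phi>*\<close> has the parts
  \<open>r(0) \<Phi>' r(0)\<^sup>-\<^sup>1\<close> and \<open>r(\<infinity>) \<Phi>'' r(\<infinity>)\<^sup>-\<^sup>1\<close>; hence \<open>d - 2 \<Phi>*\<close> is flat. Finally \<open>\<Phi>* = Q* + q*\<close> with \<open>Q*\<close>
  built from \<open>S*\<close> and \<open>q*\<close> a multiplier for \<open>L*\<close>, and \<open>S*\<close> is the mean curvature sphere of \<open>L*\<close> because
  the other Hopf field \<open>A = (S dS + *dS) / 4\<close> takes its values in L and dressing preserves this.\<close>

section \<open>Smooth maps of the plane\<close>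

text \<open>The member \<mu> = -1 is singled out because there both coefficients, 1/\<mu> - 1 and
  \<mu> - 1, equal -2; hence the value of r_\<alpha> at -1. One flat connection suffices: up to
  constant factors its curvature is the sum of the two constrained Willmore equations, one composed
  with S and anticommuting with S, the other commuting with it, so it vanishes only if both hold.
  Dressing conjugates the residues of the family at \<mu> = 0 and \<mu> = \<infinity>, which is
  where r(0) and r(\<infinity>) come from; the constant factor in r_\<alpha> makes r_\<alpha>(1) =
  1, so that the member d at \<mu> = 1 stays d. The zero \<alpha>^2 of r_\<alpha> belongs to W.
  Conjugation by j exchanges \<Phi>' and \<Phi>'', which makes jW parallel at the pole, the inverse
  of the conjugate of \<alpha>^2. The obstacle sits at \<mu> = 0: the (1,0)-coefficient has a pole
  there, so r(0) does not intertwine (1,0)-derivatives. Its derivative is under control only on S_+,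
  where \<Phi>' vanishes, and this is just enough to carry the image of A over to the
  transform.\<close>

lemma Ck_on_subset: "Ck_on k D f \<Longrightarrow> D' \<subseteq> D \<Longrightarrow> Ck_on k D' f"
proof (induction k arbitrary: f)
  case 0 then show ?case by (auto intro: continuous_on_subset)
next
  case (Suc k) then show ?case by (auto intro: differentiable_on_subset)
qed

lemma Ck_on_lower: "Ck_on (Suc k) D f \<Longrightarrow> Ck_on k D f"
proof (induction k arbitrary: f)
  case 0 then show ?case by (auto intro: differentiable_imp_continuous_on)
qed auto

lemma frechet_derivative_cong_open:
  assumes "open D" "x \<in> D" "\<And>y. y \<in> D \<Longrightarrow> f y = g y"
  shows "frechet_derivative f (at x) = frechet_derivative g (at x)"
proof -
  have "(f has_derivative d) (at x) \<longleftrightarrow> (g has_derivative d) (at x)" for d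
    using assms has_derivative_transform_within_open[of f d x UNIV D g]
      has_derivative_transform_within_open[of g d x UNIV D f] by auto
  then show ?thesis unfolding frechet_derivative_def by simp
qed

lemma differentiable_cong_open:
  assumes "open D" "x \<in> D" "\<And>y. y \<in> D \<Longrightarrow> f y = g y"
  shows "f differentiable (at x) \<longleftrightarrow> g differentiable (at x)"
  using assms has_derivative_transform_within_open[of f _ x UNIV D g]
      has_derivative_transform_within_open[of g _ x UNIV D f] unfolding differentiable_def by metis

lemma Ck_on_cong_imp:
  assumes "open D" "\<And>x. x \<in> D \<Longrightarrow> f x = g x" "Ck_on k D f"
  shows "Ck_on k D g"
  using assms
proof (induction k arbitrary: f g)
  case 0 then show ?case by (auto cong: continuous_on_cong)
next
  case (Suc k)
  have "g differentiable_on D"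
    using Suc.prems differentiable_cong_open[of D _ f g] by (auto simp: differentiable_on_eq_differentiable_at)
  moreover have "Ck_on k D (\<lambda>x. frechet_derivative g (at x) v)" for v
    by (rule Suc.IH[of "\<lambda>x. frechet_derivative f (at x) v"])
      (use Suc.prems frechet_derivative_cong_open[of D _ f g] in auto)
  ultimately show ?case by simp
qed

lemma Ck_on_local:
  assumes "\<And>x. x \<in> D \<Longrightarrow> \<exists>U. open U \<and> x \<in> U \<and> Ck_on k U f"
  shows "Ck_on k D f"
  using assms
proof (induction k arbitrary: f)
  case 0
  have "continuous (at x within D) f" if "x \<in> D" for x
    using 0[OF that] by (metis Ck_on.simps(1) continuous_on_eq_continuous_at continuous_at_imp_continuous_within)
  then show ?case by (simp add: continuous_on_eq_continuous_within)
next
  case (Suc k)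
  have "f differentiable (at x within D)" if x: "x \<in> D" for x
    using Suc.prems[OF x] by (metis Ck_on.simps(2) differentiable_on_eq_differentiable_at
        differentiable_at_imp_differentiable_on
        differentiable_at_withinI)
  then have "f differentiable_on D" by (simp add: differentiable_on_def)
  moreover have "Ck_on k D (\<lambda>x. frechet_derivative f (at x) v)" for v
    by (rule Suc.IH) (use Suc.prems in fastforce)
  ultimately show ?case by simp
qed

lemma Ck_on_const: "Ck_on k D (\<lambda>x. c)"
  by (induction k arbitrary: c) auto

lemma Ck_on_linear:
  assumes T: "bounded_linear T" and D: "open D" and "Ck_on k D f"
  shows "Ck_on k D (\<lambda>x. T (f x))"
  using assms(3)
proof (induction k arbitrary: f)
  case 0 then show ?case using bounded_linear.continuous_on[OF T] by auto
next
  case (Suc k)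
  have h: "((\<lambda>x. T (f x)) has_derivative (\<lambda>v. T (frechet_derivative f (at x) v))) (at x)" if
      "x \<in> D" for x
    using Suc.prems that D
    by (auto simp: differentiable_on_eq_differentiable_at frechet_derivative_works intro!:
        bounded_linear.has_derivative[OF T])
  have "Ck_on k D (\<lambda>x. frechet_derivative (\<lambda>x. T (f x)) (at x) v)" for v
    by (rule Ck_on_cong_imp[OF D _ Suc.IH[of "\<lambda>x. frechet_derivative f (at x) v"]])
      (use Suc.prems frechet_derivative_at[OF h] in \<open>auto simp: fun_eq_iff\<close>)
  moreover have "(\<lambda>x. T (f x)) differentiable_on D"
    using h D by (auto simp: differentiable_on_eq_differentiable_at differentiable_def)
  ultimately show ?case by simp
qed

lemma Ck_on_add:
  assumes D: "open D" and "Ck_on k D f" "Ck_on k D g"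
  shows "Ck_on k D (\<lambda>x. f x + g x)"
  using assms(2,3)
proof (induction k arbitrary: f g)
  case 0 then show ?case by (auto intro: continuous_on_add)
next
  case (Suc k)
  have h: "((\<lambda>x. f x + g x) has_derivative (\<lambda>v. frechet_derivative f (at x) v + frechet_derivative
      g (at x) v)) (at x)" if "x \<in> D" for x
    using Suc.prems that D
    by (auto simp: differentiable_on_eq_differentiable_at frechet_derivative_works intro!: has_derivative_add)
  have "Ck_on k D (\<lambda>x. frechet_derivative (\<lambda>x. f x + g x) (at x) v)" for v
    by (rule Ck_on_cong_imp[OF D _ Suc.IH[of "\<lambda>x. frechet_derivative f (at x) v"
        "\<lambda>x. frechet_derivative g (at x) v"]])
      (use Suc.prems frechet_derivative_at[OF h] in \<open>auto simp: fun_eq_iff\<close>)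
  moreover have "(\<lambda>x. f x + g x) differentiable_on D"
    using h D by (auto simp: differentiable_on_eq_differentiable_at differentiable_def)
  ultimately show ?case by simp
qed

lemma Ck_on_bilinear:
  assumes B: "bounded_bilinear B" and D: "open D" and "Ck_on k D f" "Ck_on k D g"
  shows "Ck_on k D (\<lambda>x. B (f x) (g x))"
  using assms(3,4)
proof (induction k arbitrary: f g)
  case 0 then show ?case by (auto intro: bounded_bilinear.continuous_on[OF B])
next
  case (Suc k)
  have h: "((\<lambda>x. B (f x) (g x)) has_derivative (\<lambda>v. B (f x) (frechet_derivative g (at x) v) + B
      (frechet_derivative f (at x) v) (g x))) (at x)" if "x \<in> D" for x
    using Suc.prems that D
    by (auto simp: differentiable_on_eq_differentiable_at frechet_derivative_works intro!:
        bounded_bilinear.FDERIV[OF B])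
  have "Ck_on k D (\<lambda>x. frechet_derivative (\<lambda>x. B (f x) (g x)) (at x) v)" for v
    by (rule Ck_on_cong_imp[OF D _ Ck_on_add[OF D
           Suc.IH[of f "\<lambda>x. frechet_derivative g (at x) v"]
               Suc.IH[of "\<lambda>x. frechet_derivative f (at x) v" g]]])
      (use Suc.prems frechet_derivative_at[OF h] in \<open>auto simp: fun_eq_iff intro: Ck_on_lower\<close>)
  moreover have "(\<lambda>x. B (f x) (g x)) differentiable_on D"
    using h D by (auto simp: differentiable_on_eq_differentiable_at differentiable_def)
  ultimately show ?case by simp
qed

text \<open>The derivative of 1/f is again built from 1/f and the derivative of f, so f stays fixed
  in the induction and order k for 1/f yields order k + 1.\<close>

lemma Ck_on_inverse:
  fixes f :: "real^2 \<Rightarrow> 'a::real_normed_field"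
  assumes D: "open D" and nz: "\<And>x. x \<in> D \<Longrightarrow> f x \<noteq> 0" and "Ck_on k D f"
  shows "Ck_on k D (\<lambda>x. inverse (f x))"
  using assms(3)
proof (induction k)
  case 0 then show ?case using nz by (auto intro: continuous_on_inverse)
next
  case (Suc k)
  have h: "((\<lambda>x. inverse (f x)) has_derivative
      (\<lambda>v. - (inverse (f x) * frechet_derivative f (at x) v * inverse (f x)))) (at x)" if "x \<in> D" for x
    using Suc.prems that D nz
    by (auto simp: differentiable_on_eq_differentiable_at frechet_derivative_works intro!: has_derivative_inverse)
  note bm = bounded_bilinear_mult
  have i: "Ck_on k D (\<lambda>x. inverse (f x))" using Suc by (blast intro: Ck_on_lower)
  have "Ck_on k D (\<lambda>x. - (inverse (f x) * frechet_derivative f (at x) v * inverse (f x)))" for v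
    by (rule Ck_on_linear[OF bounded_linear_minus[OF bounded_linear_ident] D],
        rule Ck_on_bilinear[OF bm D Ck_on_bilinear[OF bm D i] i]) (use Suc.prems in auto)
  then have "Ck_on k D (\<lambda>x. frechet_derivative (\<lambda>x. inverse (f x)) (at x) v)" for v
    by (rule Ck_on_cong_imp[OF D, rotated]) (use frechet_derivative_at[OF h] in
        \<open>auto simp: fun_eq_iff\<close>)
  moreover have "(\<lambda>x. inverse (f x)) differentiable_on D"
    using h D by (auto simp: differentiable_on_eq_differentiable_at differentiable_def)
  ultimately show ?case by simp
qed

lemma smooth_on_differentiable: "smooth_on D f \<Longrightarrow> open D \<Longrightarrow> x \<in> D
    \<Longrightarrow> f differentiable (at x)"
  unfolding smooth_on_def by (metis Ck_on.simps(2) differentiable_on_eq_differentiable_at)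

lemma smooth_on_frechet: "smooth_on D f \<Longrightarrow> smooth_on D (\<lambda>x. frechet_derivative f (at x) v)"
  unfolding smooth_on_def by (metis Ck_on.simps(2))

section \<open>Symmetry of second derivatives\<close>

text \<open>The mean value theorem for u \<mapsto> f(x + tv + uw) - f(x + uw) reduces the second
  difference to values near x of the derivative along w; differentiability of that derivative at x
  then bounds the error.\<close>

lemma second_difference_quotient:
  fixes f :: "'a::real_normed_vector \<Rightarrow> real"
  assumes D: "open D" "x \<in> D" and f: "\<And>y. y \<in> D \<Longrightarrow> (f has_derivative f' y) (at y)"
    and f'': "((\<lambda>y. f' y w) has_derivative g) (at x)" and e: "e > 0"
  shows "\<exists>d>0. \<forall>t. 0 < t \<and> t < d \<longrightarrow>
     \<bar>f (x + t *\<^sub>R v + t *\<^sub>R w) - f (x + t *\<^sub>R v) - f (x + t *\<^sub>R w) + f x - t^2 * g v\<bar> \<le> e * t^2"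
proof -
  \<comment> \<open>Two errors of size (e / K) t (|v| + |w|) have to add up to at most e t; the
    summand 1 keeps K positive when v = w = 0.\<close>
  define K where "K = 2 * (norm v + norm w) + 1"
  have K: "K > 0" by (simp add: K_def add_nonneg_pos)
  from D obtain r where r: "r > 0" "ball x r \<subseteq> D" by (meson openE)
  from f'' e K obtain d1 where d1: "d1 > 0"
    "\<And>y. norm (y - x) < d1 \<Longrightarrow> \<bar>f' y w - f' x w - g (y - x)\<bar> \<le> e / K * norm
        (y - x)"
    unfolding has_derivative_at_alt by (metis divide_pos_pos real_norm_def)
  have lin: "linear g" using f'' by (simp add: has_derivative_linear)
  define d where "d = min r d1 / K"
  have "d > 0" using r d1 K by (simp add: d_def)
  moreover have "\<bar>f (x + t *\<^sub>R v + t *\<^sub>R w) - f (x + t *\<^sub>R v) - f (x + t *\<^sub>R w) + f x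
      - t^2 * g v\<bar> \<le> e * t^2"
    if t: "0 < t" "t < d" for t
  proof -
    have tK: "t * K < min r d1" using t K by (simp add: d_def pos_less_divide_eq)
    have nn: "norm (a *\<^sub>R v + b *\<^sub>R w) \<le> t * (norm v + norm w)" if "0 \<le> a" "a \<le> t"
        "0 \<le> b" "b \<le> t" for a b
    proof -
      have "norm (a *\<^sub>R v + b *\<^sub>R w) \<le> a * norm v + b * norm w"
        using norm_triangle_ineq[of "a *\<^sub>R v" "b *\<^sub>R w"] that by simp
      also have "\<dots> \<le> t * norm v + t * norm w" using that by (intro add_mono mult_right_mono) auto
      finally show ?thesis by (simp add: algebra_simps)
    qed
    have lt: "t * (norm v + norm w) < min r d1"
      using tK t by (smt (verit, best) K_def mult_le_cancel_left_pos norm_ge_zero)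
    define h where "h u = f (x + t *\<^sub>R v + u *\<^sub>R w) - f (x + u *\<^sub>R w)" for u
    have inD: "x + a *\<^sub>R v + b *\<^sub>R w \<in> D" if "0 \<le> a" "a \<le> t" "0 \<le> b" "b \<le> t" for a
        b
    proof -
      have "dist x (x + a *\<^sub>R v + b *\<^sub>R w) = norm (a *\<^sub>R v + b *\<^sub>R w)"
        by (metis add.assoc add_diff_cancel_left' dist_norm norm_minus_commute)
      then have "dist x (x + a *\<^sub>R v + b *\<^sub>R w) < r"
        using nn[OF that] lt by simp
      then show ?thesis using r by auto
    qed
    have dh: "(h has_derivative (\<lambda>k. k * (f' (x + t *\<^sub>R v + u *\<^sub>R w) w - f' (x + u *\<^sub>R w)
        w))) (at u)"
      if u: "0 \<le> u" "u \<le> t" for u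
    proof -
      have 1: "(f has_derivative f' (x + t *\<^sub>R v + u *\<^sub>R w)) (at (x + t *\<^sub>R v + u *\<^sub>R w))"
        using inD[of t u] u t f by auto
      have 2: "(f has_derivative f' (x + u *\<^sub>R w)) (at (x + u *\<^sub>R w))"
        using inD[of 0 u] u t f by auto
      have l1: "linear (f' (x + t *\<^sub>R v + u *\<^sub>R w))" "linear (f' (x + u *\<^sub>R w))"
        using 1 2 by (auto intro: has_derivative_linear)
      have 3: "((\<lambda>u. f (x + t *\<^sub>R v + u *\<^sub>R w)) has_derivative
          (\<lambda>k. f' (x + t *\<^sub>R v + u *\<^sub>R w) (k *\<^sub>R w))) (at u)"
        by (rule has_derivative_compose[where f="\<lambda>u. x + t *\<^sub>R v + u *\<^sub>R w", OF _ 1])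
          (auto intro!: derivative_eq_intros)
      have 4: "((\<lambda>u. f (x + u *\<^sub>R w)) has_derivative (\<lambda>k. f' (x + u *\<^sub>R w)
          (k *\<^sub>R w))) (at u)"
        by (rule has_derivative_compose[where f="\<lambda>u. x + u *\<^sub>R w", OF _ 2])
          (auto intro!: derivative_eq_intros)
      show ?thesis unfolding h_def
        using has_derivative_diff[OF 3 4] l1 by (simp add: linear_cmul right_diff_distrib)
    qed
    have "\<exists>u\<in>{0<..<t}. h t - h 0 = (t - 0) * (f' (x + t *\<^sub>R v + u *\<^sub>R w) w - f'
        (x + u *\<^sub>R w) w)"
      by (rule mvt_simple[of 0 t h]) (use t dh in \<open>auto intro: has_derivative_at_withinI\<close>)
    then obtain u where u: "0 < u" "u < t"
      "h t - h 0 = t * (f' (x + t *\<^sub>R v + u *\<^sub>R w) w - f' (x + u *\<^sub>R w) w)" by auto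
    have e1: "\<bar>f' (x + t *\<^sub>R v + u *\<^sub>R w) w - f' x w - g (t *\<^sub>R v + u *\<^sub>R w)\<bar>
        \<le> e / K * (t * (norm v + norm w))"
    proof -
      have "norm (t *\<^sub>R v + u *\<^sub>R w) < d1" using nn[of t u] u t lt by auto
      then have "\<bar>f' (x + t *\<^sub>R v + u *\<^sub>R w) w - f' x w - g (t *\<^sub>R v + u *\<^sub>R w)\<bar>
          \<le> e / K * norm (t *\<^sub>R v + u *\<^sub>R w)"
        using d1(2)[of "x + t *\<^sub>R v + u *\<^sub>R w"] by (simp add: add.assoc)
      also have "\<dots> \<le> e / K * (t * (norm v + norm w))"
        using nn[of t u] u t e K by (intro mult_left_mono) auto
      finally show ?thesis .
    qed
    have e2: "\<bar>f' (x + u *\<^sub>R w) w - f' x w - g (u *\<^sub>R w)\<bar> \<le> e / K *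
        (t * (norm v + norm w))"
    proof -
      have "norm (u *\<^sub>R w) < d1" using nn[of 0 u] u t lt by auto
      then have "\<bar>f' (x + u *\<^sub>R w) w - f' x w - g (u *\<^sub>R w)\<bar> \<le> e / K * norm
          (u *\<^sub>R w)"
        using d1(2)[of "x + u *\<^sub>R w"] by (simp add: add.assoc)
      also have "\<dots> \<le> e / K * (t * (norm v + norm w))"
        using nn[of 0 u] u t e K by (intro mult_left_mono) auto
      finally show ?thesis .
    qed
    have gl: "g (t *\<^sub>R v + u *\<^sub>R w) = t * g v + g (u *\<^sub>R w)" using lin by
        (simp add: linear_add linear_cmul)
    have "\<bar>(f' (x + t *\<^sub>R v + u *\<^sub>R w) w - f' (x + u *\<^sub>R w) w) - t * g v\<bar> \<le> 2 *
        (e / K * (t * (norm v + norm w)))"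
      using e1 e2 unfolding gl by linarith
    also have "\<dots> \<le> e * t"
    proof -
      have "2 * (norm v + norm w) / K \<le> 1" using K by (simp add: K_def)
      then have "e * t * (2 * (norm v + norm w) / K) \<le> e * t * 1" using e t by (intro mult_left_mono) auto
      moreover have "2 * (e / K * (t * (norm v + norm w))) = e * t * (2 * (norm v + norm w) / K)" by simp
      ultimately show ?thesis by linarith
    qed
    finally have b: "\<bar>(f' (x + t *\<^sub>R v + u *\<^sub>R w) w - f' (x + u *\<^sub>R w) w) - t * g v\<bar>
        \<le> e * t" .
    have "f (x + t *\<^sub>R v + t *\<^sub>R w) - f (x + t *\<^sub>R v) - f (x + t *\<^sub>R w) + f x - t^2 * g v
        = t * ((f' (x + t *\<^sub>R v + u *\<^sub>R w) w - f' (x + u *\<^sub>R w) w) - t * g v)"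
      using u(3) by (simp add: h_def algebra_simps power2_eq_square)
    then have "\<bar>f (x + t *\<^sub>R v + t *\<^sub>R w) - f (x + t *\<^sub>R v) - f (x + t *\<^sub>R w) + f x - t^2 * g v\<bar>
        = t * \<bar>(f' (x + t *\<^sub>R v + u *\<^sub>R w) w - f' (x + u *\<^sub>R w) w) - t * g v\<bar>"
      using t by (simp only: abs_mult)
    also have "\<dots> \<le> t * (e * t)" using b t by (intro mult_left_mono) auto
    finally show ?thesis by (simp add: power2_eq_square mult.commute mult.left_commute)
  qed
  ultimately show ?thesis by blast
qed

text \<open>The second difference is symmetric in v and w, and it approximates both t^2 g(v) and t^2
  h(w) up to e t^2, for every e > 0.\<close>

lemma second_derivative_symmetric_real:
  fixes f :: "'a::real_normed_vector \<Rightarrow> real"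
  assumes D: "open D" "x \<in> D" and f: "\<And>y. y \<in> D \<Longrightarrow> (f has_derivative f' y) (at y)"
    and w: "((\<lambda>y. f' y w) has_derivative g) (at x)" and v: "((\<lambda>y. f' y v) has_derivative h) (at x)"
  shows "g v = h w"
proof -
  have "\<bar>g v - h w\<bar> \<le> 2 * e" if e: "e > 0" for e
  proof -
    obtain d1 where d1: "d1 > 0" "\<And>t. 0 < t \<and> t < d1 \<Longrightarrow>
     \<bar>f (x + t *\<^sub>R v + t *\<^sub>R w) - f (x + t *\<^sub>R v) - f (x + t *\<^sub>R w) + f x - t^2 * g v\<bar> \<le> e * t^2"
      using second_difference_quotient[OF D f w e] by blast
    obtain d2 where d2: "d2 > 0" "\<And>t. 0 < t \<and> t < d2 \<Longrightarrow>
     \<bar>f (x + t *\<^sub>R w + t *\<^sub>R v) - f (x + t *\<^sub>R w) - f (x + t *\<^sub>R v) + f x - t^2 * h w\<bar> \<le> e * t^2"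
      using second_difference_quotient[OF D f v e] by blast
    define t where "t = min d1 d2 / 2"
    have t: "0 < t" "t < d1" "t < d2" using d1 d2 by (auto simp: t_def)
    have "\<bar>t^2 * g v - t^2 * h w\<bar> \<le> 2 * (e * t^2)"
      using d1(2)[of t] d2(2)[of t] t by (simp add: algebra_simps)
    moreover have "\<bar>t^2 * g v - t^2 * h w\<bar> = t^2 * \<bar>g v - h w\<bar>"
      by (simp add: right_diff_distrib[symmetric] abs_mult)
    ultimately have "t^2 * \<bar>g v - h w\<bar> \<le> t^2 * (2 * e)" by (simp add: mult.commute mult.left_commute)
    then show ?thesis using t by (simp only: mult_le_cancel_left_pos zero_less_power)
  qed
  then have "\<bar>g v - h w\<bar> \<le> 0" by (metis dense_ge field_sum_of_halves half_gt_zero mult_2)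
  then show ?thesis by simp
qed

lemma smooth_on_symmetric:
  fixes f :: "real^2 \<Rightarrow> 'e::euclidean_space"
  assumes s: "smooth_on D f" and D: "open D" "x \<in> D"
  shows "frechet_derivative (\<lambda>y. frechet_derivative f (at y) w) (at x) v =
         frechet_derivative (\<lambda>y. frechet_derivative f (at y) v) (at x) w"
proof (rule euclidean_eqI)
  fix b :: 'e
  have d: "((\<lambda>y. f y \<bullet> b) has_derivative (\<lambda>v. frechet_derivative f (at y) v \<bullet> b))
      (at y)" if "y \<in> D" for y
    using smooth_on_differentiable[OF s D(1) that]
    by (auto simp: frechet_derivative_works intro: bounded_linear.has_derivative[OF bounded_linear_inner_left])
  have d2: "((\<lambda>y. frechet_derivative f (at y) u \<bullet> b) has_derivative
     (\<lambda>v. frechet_derivative (\<lambda>y. frechet_derivative f (at y) u) (at x) v \<bullet> b)) (at x)" for u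
    using smooth_on_differentiable[OF smooth_on_frechet[OF s] D]
    by (auto simp: frechet_derivative_works intro: bounded_linear.has_derivative[OF bounded_linear_inner_left])
  show "frechet_derivative (\<lambda>y. frechet_derivative f (at y) w) (at x) v \<bullet> b =
        frechet_derivative (\<lambda>y. frechet_derivative f (at y) v) (at x) w \<bullet> b"
    by (rule second_derivative_symmetric_real[OF D d d2 d2])
qed

section \<open>Differential calculus in charts\<close>

lemma matrix_inv_cancel:
  fixes M :: "'a::semiring_1^'n^'n"
  assumes "invertible M" shows "M ** matrix_inv M = mat 1" "matrix_inv M ** M = mat 1"
  using someI_ex[OF assms[unfolded invertible_def]] by (simp_all add: matrix_inv_def)

locale surface =
  fixes X :: "'m topology" and A :: "'m chart set"
  assumes surf: "oriented_surface X A"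
begin

lemma chart_facts:
  assumes "c \<in> A"
  shows "openin X (dom_ch c)" "open (coord c ` dom_ch c)" "inj_on (coord c) (dom_ch c)"
    "homeomorphic_map (subtopology X (dom_ch c)) (subtopology euclidean (coord c ` dom_ch c)) (coord c)"
proof -
  show 1: "openin X (dom_ch c)" "open (coord c ` dom_ch c)"
    and 2: "homeomorphic_map (subtopology X (dom_ch c)) (subtopology euclidean (coord c ` dom_ch c)) (coord c)"
    using surf assms unfolding oriented_surface_def by auto
  show "inj_on (coord c) (dom_ch c)"
    using homeomorphic_imp_injective_map[OF 2] openin_subset[OF 1(1)] by (simp add: Int_absorb1)
qed

lemma inv_coord: "c \<in> A \<Longrightarrow> p \<in> dom_ch c \<Longrightarrow> inv_into (dom_ch c) (coord c)
    (coord c p) = p"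
  by (simp add: chart_facts(3))

lemma in_chart_coord: "c \<in> A \<Longrightarrow> p \<in> dom_ch c \<Longrightarrow> in_chart c f (coord c p) = f
    p"
  by (simp add: in_chart_def inv_coord)

lemma open_image_chart:
  assumes "c \<in> A" "openin X N"
  shows "open (coord c ` (dom_ch c \<inter> N))"
proof -
  have "openin (subtopology X (dom_ch c)) (dom_ch c \<inter> N)"
    using assms(2) by (metis inf_commute openin_subtopology)
  then have "openin (subtopology euclidean (coord c ` dom_ch c)) (coord c ` (dom_ch c \<inter> N))"
    using homeomorphic_imp_open_map[OF chart_facts(4)[OF assms(1)]] unfolding open_map_def by blast
  then show ?thesis using chart_facts(2)[OF assms(1)] openin_open_trans by blast
qed

lemma chart_subset: "c \<in> A \<Longrightarrow> dom_ch c \<subseteq> topspace X"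
  using chart_facts(1) openin_subset by blast

lemma chart_at: "p \<in> topspace X \<Longrightarrow> \<exists>c\<in>A. p \<in> dom_ch c"
  using surf unfolding oriented_surface_def by auto

text \<open>\<open>B\<close> lists the charts in which smoothness is tested: all of \<open>A\<close>
  for functions and sections on the surface, a singleton \<open>{c}\<close> for coefficients of
  forms and for derivatives \<open>dd c f p v\<close>, which refer to the one chart
  \<open>c\<close>.\<close>

definition sm :: "'m chart set \<Rightarrow> 'm set \<Rightarrow> ('m \<Rightarrow> 'e::real_normed_vector)
    \<Rightarrow> bool" where
  "sm B N f \<longleftrightarrow> B \<subseteq> A \<and> openin X N \<and> smooth_map B N f"

lemma smD:
  assumes "sm B N f" "c \<in> B"
  shows "c \<in> A" "openin X N" "open (coord c ` (dom_ch c \<inter> N))"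
    "Ck_on k (coord c ` (dom_ch c \<inter> N)) (in_chart c f)"
proof -
  show c: "c \<in> A" and N: "openin X N" using assms unfolding sm_def by blast+
  show "open (coord c ` (dom_ch c \<inter> N))" by (rule open_image_chart[OF c N])
  show "Ck_on k (coord c ` (dom_ch c \<inter> N)) (in_chart c f)"
    using assms unfolding sm_def smooth_map_def smooth_on_def by blast
qed

lemma smI:
  assumes "B \<subseteq> A" "openin X N"
    "\<And>c k. c \<in> B \<Longrightarrow> c \<in> A \<Longrightarrow> open (coord c ` (dom_ch c \<inter> N))
        \<Longrightarrow> Ck_on k (coord c ` (dom_ch c \<inter> N)) (in_chart c f)"
  shows "sm B N f"
  using assms open_image_chart[of _ N] unfolding sm_def smooth_map_def smooth_on_def by blast

lemma sm_open: "sm B N f \<Longrightarrow> openin X N" "sm B N f \<Longrightarrow> B \<subseteq> A"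
  by (simp_all add: sm_def)

lemma sm_subset: "sm B N f \<Longrightarrow> openin X N' \<Longrightarrow> N' \<subseteq> N \<Longrightarrow> B'
    \<subseteq> B \<Longrightarrow> sm B' N' f"
  unfolding sm_def smooth_map_def smooth_on_def
  by (meson Ck_on_subset Int_mono image_mono order_refl subset_iff)

lemma sm_cong:
  assumes "\<And>x. x \<in> N \<Longrightarrow> f x = g x" "sm B N f"
  shows "sm B N g"
proof (rule smI)
  fix c k assume c: "c \<in> B" "c \<in> A" and o: "open (coord c ` (dom_ch c \<inter> N))"
  show "Ck_on k (coord c ` (dom_ch c \<inter> N)) (in_chart c g)"
  proof (rule Ck_on_cong_imp[OF o _ smD(4)[OF assms(2) c(1)]])
    fix y assume "y \<in> coord c ` (dom_ch c \<inter> N)"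
    then obtain x where "y = coord c x" "x \<in> dom_ch c" "x \<in> N" by blast
    then show "in_chart c f y = in_chart c g y" using c assms(1) by (simp add: in_chart_coord)
  qed
qed (use assms(2) in \<open>auto simp: sm_def\<close>)

lemma sm_local:
  assumes "\<And>p. p \<in> N \<Longrightarrow> \<exists>U. p \<in> U \<and> sm B U f" "openin X N"
      "B \<subseteq> A"
  shows "sm B N f"
proof (rule smI[OF assms(3,2)])
  fix c k assume c: "c \<in> B"
  show "Ck_on k (coord c ` (dom_ch c \<inter> N)) (in_chart c f)"
  proof (rule Ck_on_local)
    fix y assume "y \<in> coord c ` (dom_ch c \<inter> N)"
    then obtain p where p: "y = coord c p" "p \<in> dom_ch c" "p \<in> N" by auto
    then obtain U where U: "p \<in> U" "sm B U f" using assms by blast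
    then show "\<exists>U. open U \<and> y \<in> U \<and> Ck_on k U (in_chart c f)" using p smD(3,4)[OF U(2) c] by
        blast
  qed
qed

lemma sm_const: "openin X N \<Longrightarrow> B \<subseteq> A \<Longrightarrow> sm B N (\<lambda>x. k)"
  by (rule smI) (auto simp: in_chart_def comp_def Ck_on_const)

lemma sm_linear: "bounded_linear T \<Longrightarrow> sm B N f \<Longrightarrow> sm B N (\<lambda>x. T (f x))"
  by (rule smI) (use Ck_on_linear[of T _ _ "in_chart _ f"] smD(4)[of B N f] in
      \<open>auto simp: in_chart_def comp_def sm_open\<close>)

lemma sm_add: "sm B N f \<Longrightarrow> sm B N g \<Longrightarrow> sm B N (\<lambda>x. f x + g x)"
  by (rule smI) (use Ck_on_add[of _ _ "in_chart _ f" "in_chart _ g"] smD(4)[of B N f] smD(4)[of B N g] in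
      \<open>auto simp: in_chart_def comp_def sm_open\<close>)

lemma sm_bilinear: "bounded_bilinear b \<Longrightarrow> sm B N f \<Longrightarrow> sm B N g \<Longrightarrow> sm B
    N (\<lambda>x. b (f x) (g x))"
  by (rule smI) (use Ck_on_bilinear[of b _ _ "in_chart _ f" "in_chart _ g"] smD(4)[of B N f] smD(4)[of B N g] in
      \<open>auto simp: in_chart_def comp_def sm_open\<close>)

lemma sm_inverse:
  fixes f :: "'m \<Rightarrow> 'a::real_normed_field"
  assumes f: "sm B N f" and nz: "\<And>x. x \<in> N \<Longrightarrow> f x \<noteq> 0"
  shows "sm B N (\<lambda>x. inverse (f x))"
proof (rule smI)
  fix c k assume c: "c \<in> B" "c \<in> A" and o: "open (coord c ` (dom_ch c \<inter> N))"
  have "in_chart c f y \<noteq> 0" if "y \<in> coord c ` (dom_ch c \<inter> N)" for y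
    using nz that by (clarsimp simp: in_chart_coord[OF c(2)] simp del: split_paired_All)
  then have "Ck_on k (coord c ` (dom_ch c \<inter> N)) (\<lambda>x. inverse (in_chart c f x))"
    by (rule Ck_on_inverse[OF o _ smD(4)[OF f c(1)]])
  then show "Ck_on k (coord c ` (dom_ch c \<inter> N)) (in_chart c (\<lambda>x. inverse (f x)))"
    by (simp add: in_chart_def comp_def)
qed (use f in \<open>auto simp: sm_def\<close>)

lemma sm_minus: "sm B N f \<Longrightarrow> sm B N (\<lambda>x. - f x)"
  by (rule sm_linear) (simp add: bounded_linear_minus)

lemma sm_diff: "sm B N f \<Longrightarrow> sm B N g \<Longrightarrow> sm B N (\<lambda>x. f x - g x)"
  using sm_add[of B N f "\<lambda>x. - g x"] sm_minus by auto

lemma sm_scaleR: "sm B N f \<Longrightarrow> sm B N g \<Longrightarrow> sm B N (\<lambda>x. f x *\<^sub>R g x)"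
  by (rule sm_bilinear[OF bounded_bilinear_scaleR])

lemma sm_mult: "sm B N f \<Longrightarrow> sm B N g \<Longrightarrow> sm B N
    (\<lambda>x. f x * g x :: 'a::real_normed_algebra)"
  by (rule sm_bilinear[OF bounded_bilinear_mult])

lemma sm_sum:
  assumes "\<And>i. i \<in> I \<Longrightarrow> sm B N (f i)" "openin X N" "B \<subseteq> A"
  shows "sm B N (\<lambda>x. \<Sum>i\<in>I. f i x)"
  using assms(1) by (induction I rule: infinite_finite_induct) (auto intro: sm_add sm_const[OF assms(2,3)])

lemma sm_prod:
  fixes f :: "'i \<Rightarrow> 'm \<Rightarrow> 'a::{real_normed_algebra,comm_ring_1}"
  assumes "\<And>i. i \<in> I \<Longrightarrow> sm B N (f i)" "openin X N" "B \<subseteq> A"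
  shows "sm B N (\<lambda>x. \<Prod>i\<in>I. f i x)"
  using assms(1) by (induction I rule: infinite_finite_induct) (auto intro: sm_mult sm_const[OF assms(2,3)])

lemma sm_nth: "sm B N f \<Longrightarrow> sm B N (\<lambda>x. f x $ i)"
  by (rule sm_linear[OF bounded_linear_vec_nth])

lemma sm_vec:
  fixes f :: "'m \<Rightarrow> 'n::finite \<Rightarrow> 'e::euclidean_space"
  assumes "\<And>i. sm B N (\<lambda>x. f x i)"
  shows "sm B N (\<lambda>x. \<chi> i. f x i)"
proof -
  have "linear (axis i :: 'e \<Rightarrow> 'e^'n)" for i
    by (rule linearI) (auto simp: vec_eq_iff axis_def)
  then have "sm B N (\<lambda>x. axis i (f x i) :: 'e^'n)" for i
    using assms sm_linear linear_conv_bounded_linear by blast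
  moreover have "openin X N" "B \<subseteq> A" using assms[of undefined] by (auto simp: sm_def)
  moreover have "(\<chi> i. f x i) = (\<Sum>i\<in>UNIV. axis i (f x i))" for x
    by (simp add: vec_eq_iff axis_def if_distrib cong: if_cong)
  ultimately show ?thesis using sm_sum[of UNIV B N "\<lambda>i x. axis i (f x i)"] by simp
qed

lemma sm_det:
  fixes f :: "'m \<Rightarrow> complex^'n^'n"
  assumes "sm B N f" shows "sm B N (\<lambda>x. det (f x))"
  unfolding det_def
  by (rule sm_sum sm_mult sm_const sm_prod sm_nth assms | use assms in \<open>simp add: sm_def\<close>)+

text \<open>Cramer's rule writes each entry of the inverse as a determinant divided by
  \<open>det (f x)\<close>, hence as a polynomial in the entries times the inverse of a nonvanishing
  function.\<close>

lemma sm_matrix_inv: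
  fixes f :: "'m \<Rightarrow> complex^'n^'n"
  assumes f: "sm B N f" and inv: "\<And>x. x \<in> N \<Longrightarrow> invertible (f x)"
  shows "sm B N (\<lambda>x. matrix_inv (f x))"
proof -
  have o: "openin X N" "B \<subseteq> A" using f by (auto simp: sm_def)
  have eq: "(\<chi> i l. det ((\<chi> a b. if b = i then axis l 1 $ a else f x $ a $ b) :: complex^'n^'n) * inverse
      (det (f x))) = matrix_inv (f x)"
    if "x \<in> N" for x
  proof -
    have d: "det (f x) \<noteq> 0" using inv[OF that] invertible_det_nz by blast
    have nth: "(M *v axis l 1) $ i = M $ i $ l" for M :: "complex^'n^'n" and l i
      by (simp add: matrix_vector_mult_def axis_def if_distrib cong: if_cong)
    have e: "matrix_inv (f x) $ i $ l = det ((\<chi> a b. if b = i then axis l 1 $ a else f x $ a $ b) ::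
        complex^'n^'n) / det (f x)" for i l
    proof -
      have "f x *v (matrix_inv (f x) *v axis l 1) = axis l 1"
        using inv[OF that] by (simp add: matrix_vector_mul_assoc matrix_inv_cancel)
      then have "matrix_inv (f x) *v axis l 1 =
         (\<chi> k. det ((\<chi> i j. if j = k then axis l 1 $ i else f x $ i $ j) :: complex^'n^'n) / det (f x))"
        by (rule iffD1[OF cramer[OF d]])
      from arg_cong[OF this, of "\<lambda>y. y $ i"] show ?thesis by (simp only: nth vec_lambda_beta)
    qed
    show ?thesis by (simp only: vec_eq_iff vec_lambda_beta e divide_inverse simp_thms)
  qed
  have "sm B N (\<lambda>x. if b = i then axis l 1 $ a else f x $ a $ b :: complex)" for a b i l
    using sm_nth[OF sm_nth[OF f], of a b] sm_const[OF o, of "axis l 1 $ a"] by (cases "b = i") simp_all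
  then have "sm B N (\<lambda>x. (\<chi> i l. det ((\<chi> a b. if b = i then axis l 1 $ a else f x $ a $ b) ::
      complex^'n^'n) * inverse (det (f x))))"
    using inv by (intro sm_vec sm_mult sm_det sm_inverse f) (auto simp: invertible_det_nz)
  then show ?thesis by (rule sm_cong[rotated]) (simp add: eq)
qed

lemma sm_differentiable:
  "sm B N f \<Longrightarrow> c \<in> B \<Longrightarrow> p \<in> N \<Longrightarrow> p \<in> dom_ch c
      \<Longrightarrow> in_chart c f differentiable (at (coord c p))"
  by (rule smooth_on_differentiable[of "coord c ` (dom_ch c \<inter> N)"])
    (auto simp: sm_def smooth_map_def intro!: open_image_chart)

lemma dd_cong:
  assumes "c \<in> A" "openin X N" "p \<in> N" "p \<in> dom_ch c"
      "\<And>x. x \<in> N \<Longrightarrow> x \<in> dom_ch c \<Longrightarrow> f x = g x"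
  shows "dd c f p v = dd c g p v"
proof -
  have "in_chart c f y = in_chart c g y" if "y \<in> coord c ` (dom_ch c \<inter> N)" for y
    using that assms(5) by (clarsimp simp: in_chart_coord[OF assms(1)] simp del: split_paired_All)
  then show ?thesis unfolding dd_def
    using frechet_derivative_cong_open[OF open_image_chart[OF assms(1,2)], of "coord c p" "in_chart c f"
        "in_chart c g"]
      assms(3,4) by simp
qed

lemma dd_const: "dd c (\<lambda>x. k) p v = 0"
  by (simp add: dd_def in_chart_def comp_def)

lemma dd_has_derivative:
  assumes "sm B N f" "c \<in> B" "p \<in> N" "p \<in> dom_ch c"
  shows "(in_chart c f has_derivative dd c f p) (at (coord c p))"
  using sm_differentiable[OF assms] unfolding dd_def by (simp add: frechet_derivative_works[symmetric])

lemma dd_eqI: "(in_chart c f has_derivative f') (at (coord c p)) \<Longrightarrow> dd c f p v = f' v"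
  unfolding dd_def by (metis frechet_derivative_at)

lemma dd_lin:
  assumes "sm B N f" "c \<in> B" "p \<in> N" "p \<in> dom_ch c"
  shows "linear (dd c f p)"
  using dd_has_derivative[OF assms] has_derivative_linear by blast

lemma dd_linear:
  assumes "bounded_linear T" "sm B N f" "c \<in> B" "p \<in> N" "p \<in> dom_ch c"
  shows "dd c (\<lambda>x. T (f x)) p v = T (dd c f p v)"
  by (rule dd_eqI) (use bounded_linear.has_derivative[OF assms(1) dd_has_derivative[OF assms(2-)]]
    in \<open>simp add: in_chart_def comp_def\<close>)

lemma dd_add:
  assumes "sm B N f" "sm B N g" "c \<in> B" "p \<in> N" "p \<in> dom_ch c"
  shows "dd c (\<lambda>x. f x + g x) p v = dd c f p v + dd c g p v"
  by (rule dd_eqI) (use has_derivative_add[OF dd_has_derivative[OF assms(1,3-)] dd_has_derivative[OF assms(2,3-)]]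
    in \<open>simp add: in_chart_def comp_def\<close>)

lemma dd_minus:
  assumes "sm B N f" "c \<in> B" "p \<in> N" "p \<in> dom_ch c"
  shows "dd c (\<lambda>x. - f x) p v = - dd c f p v"
  by (rule dd_linear[OF _ assms]) (simp add: bounded_linear_minus)

lemma dd_diff:
  assumes "sm B N f" "sm B N g" "c \<in> B" "p \<in> N" "p \<in> dom_ch c"
  shows "dd c (\<lambda>x. f x - g x) p v = dd c f p v - dd c g p v"
  by (rule dd_eqI) (use has_derivative_diff[OF dd_has_derivative[OF assms(1,3-)] dd_has_derivative[OF assms(2,3-)]]
    in \<open>simp add: in_chart_def comp_def\<close>)

lemma dd_bilinear:
  assumes "bounded_bilinear b" "sm B N f" "sm B N g" "c \<in> B" "p \<in> N" "p \<in> dom_ch c"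
  shows "dd c (\<lambda>x. b (f x) (g x)) p v = b (f p) (dd c g p v) + b (dd c f p v) (g p)"
proof (rule dd_eqI)
  have "c \<in> A" using assms by (auto simp: sm_def)
  then show "(in_chart c (\<lambda>x. b (f x) (g x)) has_derivative
      (\<lambda>v. b (f p) (dd c g p v) + b (dd c f p v) (g p))) (at (coord c p))"
    using bounded_bilinear.FDERIV[OF assms(1) dd_has_derivative[OF assms(2,4-)] dd_has_derivative[OF assms(3,4-)]]
        assms(6)
    by (simp add: in_chart_coord) (simp add: in_chart_def comp_def)
qed

lemma sm_dd:
  assumes "sm {c} N f" shows "sm {c} N (\<lambda>p. dd c f p v)"
proof -
  have c: "c \<in> A" "openin X N" using assms by (auto simp: sm_def)
  have "Ck_on k (coord c ` (dom_ch c \<inter> N)) (in_chart c (\<lambda>p. dd c f p v))" for k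
  proof (rule Ck_on_cong_imp)
    show "Ck_on k (coord c ` (dom_ch c \<inter> N)) (\<lambda>y. frechet_derivative (in_chart c f) (at y) v)"
      using smooth_on_frechet assms by (auto simp: sm_def smooth_map_def smooth_on_def)
  qed (use c open_image_chart in \<open>auto simp: in_chart_coord dd_def\<close>)
  then show ?thesis using c by (simp add: sm_def smooth_map_def smooth_on_def)
qed

lemma dd_symmetric:
  fixes f :: "'m \<Rightarrow> 'e::euclidean_space"
  assumes "sm {c} N f" "p \<in> N" "p \<in> dom_ch c"
  shows "dd c (\<lambda>x. dd c f x w) p v = dd c (\<lambda>x. dd c f x v) p w"
proof -
  have c: "c \<in> A" "openin X N" using assms by (auto simp: sm_def)
  have e: "dd c (\<lambda>x. dd c f x w) p v = frechet_derivative (\<lambda>y. frechet_derivative (in_chart c f)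
      (at y) w) (at (coord c p)) v" for v w
    unfolding dd_def[of c "\<lambda>x. dd c f x w"]
    by (subst frechet_derivative_cong_open[of "coord c ` (dom_ch c \<inter> N)"])
      (use c assms open_image_chart in \<open>auto simp: in_chart_coord dd_def\<close>)
  show ?thesis unfolding e
    by (rule smooth_on_symmetric[of "coord c ` (dom_ch c \<inter> N)"])
      (use assms c open_image_chart in \<open>auto simp: sm_def smooth_map_def\<close>)
qed

lemma sm_coord:
  assumes "c \<in> A" "c' \<in> A"
  shows "sm {c} (dom_ch c \<inter> dom_ch c') (coord c')"
proof -
  have "smooth_on (coord c ` (dom_ch c \<inter> dom_ch c')) (in_chart c (coord c'))"
    using surf assms unfolding oriented_surface_def by blast
  then show ?thesis
    using assms chart_facts(1)[OF assms(1)] chart_facts(1)[OF assms(2)]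
    by (simp add: sm_def smooth_map_def openin_Int Int_absorb1)
qed

lemma dd_chain:
  assumes f: "sm A N f" and c: "c \<in> A" "c' \<in> A" and p: "p \<in> N" "p \<in> dom_ch c" "p \<in> dom_ch c'"
  shows "dd c f p v = dd c' f p (dd c (coord c') p v)"
proof -
  have N: "openin X N" using f by (simp add: sm_def)
  have 1: "(in_chart c (coord c') has_derivative dd c (coord c') p) (at (coord c p))"
    using dd_has_derivative[OF sm_coord[OF c]] p by auto
  have 2: "(in_chart c' f has_derivative dd c' f p) (at (in_chart c (coord c') (coord c p)))"
    using dd_has_derivative[OF f c(2) p(1,3)] by (simp add: in_chart_coord c p)
  have 3: "((\<lambda>y. in_chart c' f (in_chart c (coord c') y)) has_derivative
      (\<lambda>v. dd c' f p (dd c (coord c') p v))) (at (coord c p))"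
    by (rule has_derivative_compose[OF 1 2])
  have "(in_chart c f has_derivative (\<lambda>v. dd c' f p (dd c (coord c') p v))) (at (coord c p))"
    by (rule has_derivative_transform_within_open[OF 3
        open_image_chart[OF c(1) openin_Int[OF N chart_facts(1)[OF c(2)]]]])
      (use p c in \<open>auto simp: in_chart_coord\<close>)
  then show ?thesis by (rule dd_eqI)
qed

end

section \<open>Complex matrices and the quaternionic structure\<close>

definition mscale :: "complex \<Rightarrow> complex^'n^'m \<Rightarrow> complex^'n^'m" (infixr "*k" 75) where
  "z *k M = (\<chi> i j. z * M $ i $ j)"

lemma mscale_nth [simp]: "(z *k M) $ i $ j = z * M $ i $ j"
  by (simp add: mscale_def)

lemma mscale_simps:
  "(z *k M) ** N = z *k (M ** N)" "M' ** (z *k N) = z *k (M' ** N)" "z *k w *k M = (z * w) *k M"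
  "z *k (M + M1) = z *k M + z *k M1" "z *k (M - M1) = z *k M - z *k M1" "z *k (- M) = - (z *k M)"
  "0 *k M = 0" "z *k (0 :: complex^'n^'m) = 0" "1 *k M = M" "(z *k M) *v x = z *s (M *v x)"
  by (simp_all add: vec_eq_iff matrix_matrix_mult_def matrix_vector_mult_def sum_distrib_left algebra_simps)

lemma scaleR_vscale: "r *\<^sub>R (x :: complex^'n) = complex_of_real r *s x"
  by (simp add: vec_eq_iff, simp add: scaleR_conv_of_real)

lemma scaleR_mscale: "r *\<^sub>R M = complex_of_real r *k M"
  by (simp add: vec_eq_iff, simp add: scaleR_conv_of_real)

lemma matrix_ring_simps:
  fixes M N K :: "'a::ring_1^'n^'n"
  shows "(M - N) ** K = M ** K - N ** K" "M ** (N - K) = M ** N - M ** K"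
    "(M + N) ** K = M ** K + N ** K" "M ** (N + K) = M ** N + M ** K"
    "(- M) ** N = - (M ** N)" "M ** (- N) = - (M ** N)" "(0 :: 'a^'n^'n) ** N = 0" "M ** (0 :: 'a^'n^'n) = 0"
    "(M ** N) ** K = M ** (N ** K)"
  by (simp_all only: matrix_mul_assoc)
    (simp_all add: vec_eq_iff matrix_matrix_mult_def sum.distrib sum_subtractf sum_negf algebra_simps)

lemma matrix_vector_simps:
  fixes M N :: "complex^'n^'m"
  shows "(M + N) *v x = M *v x + N *v x" "(M - N) *v x = M *v x - N *v x" "(- M) *v x = - (M *v x)"
    "M *v (x + y) = M *v x + M *v y" "M *v (x - y) = M *v x - M *v y" "M *v (- x) = - (M *v x)"
    "M *v (z *s x) = z *s (M *v x)"
  by (simp_all add: vec_eq_iff matrix_vector_mult_def sum.distrib sum_subtractf sum_negf sum_distrib_left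
      algebra_simps)

lemmas mat_alg = mscale_simps matrix_ring_simps

lemma
  shows bb_mm: "bounded_bilinear ((**) :: complex^'n^'n \<Rightarrow> complex^'n^'n \<Rightarrow> complex^'n^'n)"
    and bb_mv: "bounded_bilinear ((*v) :: complex^'n^'n \<Rightarrow> complex^'n \<Rightarrow> complex^'n)"
    and bb_ks: "bounded_bilinear ((*k) :: complex \<Rightarrow> complex^'n^'n \<Rightarrow> complex^'n^'n)"
    and bb_vs: "bounded_bilinear ((*s) :: complex \<Rightarrow> complex^'n \<Rightarrow> complex^'n)"
    and bb_wedge: "bounded_bilinear wedge"
proof -
  show "bounded_bilinear ((**) :: complex^'n^'n \<Rightarrow> complex^'n^'n \<Rightarrow> complex^'n^'n)"
    unfolding bilinear_conv_bounded_bilinear[symmetric] bilinear_def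
    by (auto intro!: linearI simp: matrix_ring_simps mscale_simps scaleR_mscale)
  show "bounded_bilinear ((*v) :: complex^'n^'n \<Rightarrow> complex^'n \<Rightarrow> complex^'n)"
    unfolding bilinear_conv_bounded_bilinear[symmetric] bilinear_def
    by (auto intro!: linearI simp: matrix_vector_simps mscale_simps scaleR_mscale scaleR_vscale)
  show "bounded_bilinear ((*k) :: complex \<Rightarrow> complex^'n^'n \<Rightarrow> complex^'n^'n)"
    unfolding bilinear_conv_bounded_bilinear[symmetric] bilinear_def
    by (auto intro!: linearI simp: mscale_simps scaleR_mscale)
      (auto simp: vec_eq_iff algebra_simps scaleR_conv_of_real)
  show "bounded_bilinear ((*s) :: complex \<Rightarrow> complex^'n \<Rightarrow> complex^'n)"
    unfolding bilinear_conv_bounded_bilinear[symmetric] bilinear_def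
    by (auto intro!: linearI simp: scaleR_vscale)
      (auto simp: vec_eq_iff algebra_simps scaleR_conv_of_real)
  show "bounded_bilinear wedge"
    unfolding bilinear_conv_bounded_bilinear[symmetric] bilinear_def
    by (auto intro!: linearI simp: scaleR_vscale)
      (auto simp: vec_eq_iff wedge_def algebra_simps)
qed

section \<open>Conjugation by j and the eigenspace projections of S\<close>

lemma bl_jmap: "bounded_linear jmap"
  unfolding linear_conv_bounded_linear[symmetric]
  by (rule linearI) (auto simp: jmap_def vec_eq_iff)

lemma jmap_simps: "jmap (x + y) = jmap x + jmap y" "jmap (x - y) = jmap x - jmap y" "jmap (- x) = - jmap x"
  "jmap (c *s x) = cnj c *s jmap x" "jmap (jmap x) = - x" "jmap 0 = 0"
  by (simp_all add: jmap_def vec_eq_iff forall_4)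

lemma jmap_eq_0: "jmap x = 0 \<longleftrightarrow> x = 0"
  by (metis jmap_simps(5,6) minus_equation_iff neg_0_equal_iff_equal)

text \<open>The conjugate j M j^-1, where j^-1 = -j. A composite with two antilinear factors is
  complex linear, hence a matrix; the j-commuting matrices are the fixed points.\<close>

definition jc :: "complex^4^4 \<Rightarrow> complex^4^4" where
  "jc M = matrix (\<lambda>x. - jmap (M *v jmap x))"

lemma jmap_mv: "jmap (M *v x) = jc M *v jmap x"
proof -
  have "Vector_Spaces.linear (*s) (*s) (\<lambda>x. - jmap (M *v jmap x))"
    by (intro Vector_Spaces.linear.intro vec.vector_space_axioms module_hom.intro vec.module_axioms
        module_hom_axioms.intro)
      (simp_all add: jmap_simps matrix_vector_simps)
  then have "jc M *v jmap x = - jmap (M *v jmap (jmap x))" unfolding jc_def by (rule matrix_works)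
  then show ?thesis by (simp add: jmap_simps matrix_vector_simps)
qed

lemma jc_eqI: assumes "\<And>x. jmap (M *v x) = M' *v jmap x" shows "jc M = M'"
proof -
  have "jc M *v y = M' *v y" for y
    using assms[of "- jmap y"] jmap_mv[of M "- jmap y"] by (simp add: jmap_simps)
  then show ?thesis by (simp add: matrix_eq)
qed

lemma jc_simps: "jc (M ** N) = jc M ** jc N" "jc (M + N) = jc M + jc N" "jc (M - N) = jc M - jc N"
   "jc (- M) = - jc M" "jc (z *k M) = cnj z *k jc M" "jc (mat 1) = mat 1" "jc 0 = 0" "jc (jc M) = M"
  by (rule jc_eqI; simp add: matrix_vector_simps mscale_simps matrix_vector_mul_assoc[symmetric] jmap_mv[symmetric]
      jmap_simps)+
    (rule jc_eqI, metis jmap_mv jmap_simps(3,5) matrix_vector_simps(6) minus_minus)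

lemma j_commuting_iff: "j_commuting M \<longleftrightarrow> jc M = M"
  unfolding j_commuting_def using jc_eqI jmap_mv by metis

lemma bl_jc: "bounded_linear jc"
  unfolding linear_conv_bounded_linear[symmetric]
  by (rule linearI) (auto simp: jc_simps scaleR_mscale)

lemma jc_matrix_inv: assumes "invertible M" shows "jc (matrix_inv M) = matrix_inv (jc M)"
proof -
  have 1: "jc (matrix_inv M) ** jc M = mat 1" "jc M ** jc (matrix_inv M) = mat 1"
    using matrix_inv_cancel[OF assms] jc_simps(1,6) by metis+
  then have "invertible (jc M)" unfolding invertible_def by blast
  from matrix_inv_cancel[OF this] 1 show ?thesis
    by (metis matrix_mul_assoc matrix_mul_lid matrix_mul_rid)
qed

text \<open>For S^2 = -1 these are the projections onto the eigenspaces of \<i> and -\<i> along each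
  other. Being affine in S they can be multiplied and differentiated as matrices; conjugation by j
  exchanges them when S commutes with j.\<close>

definition PiP :: "complex^4^4 \<Rightarrow> complex^4^4" where "PiP S = (1/2) *k (mat 1 - \<i> *k S)"
definition PiM :: "complex^4^4 \<Rightarrow> complex^4^4" where "PiM S = (1/2) *k (mat 1 + \<i> *k S)"

lemma Pi_simps:
  assumes "S ** S = - mat 1"
  shows "S ** PiP S = \<i> *k PiP S" "S ** PiM S = - (\<i> *k PiM S)" "PiP S ** S = \<i> *k PiP S"
      "PiM S ** S = - (\<i> *k PiM S)"
    "PiP S ** PiP S = PiP S" "PiM S ** PiM S = PiM S" "PiP S ** PiM S = 0" "PiM S ** PiP S = 0"
  by (simp_all add: PiP_def PiM_def mat_alg assms) (simp_all add: vec_eq_iff algebra_simps)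

lemma Pi_sum: "PiP S + PiM S = mat 1"
  by (simp add: PiP_def PiM_def vec_eq_iff algebra_simps)

lemma Pi_decomp: "PiP S *v x + PiM S *v x = x"
  by (metis Pi_sum matrix_vector_mul_lid matrix_vector_simps(1))

lemma Pi_reconstruct: "S = \<i> *k (PiP S - PiM S)"
  by (simp add: PiP_def PiM_def vec_eq_iff algebra_simps)

lemma jc_Pi: "jc S = S \<Longrightarrow> jc (PiP S) = PiM S" "jc S = S \<Longrightarrow> jc (PiM S) = PiP S"
  by (simp_all add: PiP_def PiM_def jc_simps mscale_simps) (simp_all add: vec_eq_iff)

lemma Splus_iff: assumes "S ** S = - mat 1"
  shows "x \<in> Splus S \<longleftrightarrow> PiP S *v x = x"
      "x \<in> Splus S \<longleftrightarrow> PiM S *v x = 0"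
    "x \<in> Sminus S \<longleftrightarrow> PiM S *v x = x" "x \<in> Sminus S \<longleftrightarrow> PiP S *v x = 0"
proof -
  have *: "a + \<i> * b = 0 \<longleftrightarrow> b = \<i> * a"
      "a - \<i> * b = 0 \<longleftrightarrow> b = - (\<i> * a)" for a b
    by (auto simp: complex_eq_iff)
  have M: "PiM S *v x = (1/2) *s (x + \<i> *s (S *v x))" and P: "PiP S *v x = (1/2) *s (x - \<i> *s (S *v x))"
    by (simp_all add: PiM_def PiP_def mscale_simps matrix_vector_simps)
  have "PiM S *v x = 0 \<longleftrightarrow> x + \<i> *s (S *v x) = 0"
      "PiP S *v x = 0 \<longleftrightarrow> x - \<i> *s (S *v x) = 0"
    unfolding M P vec.scale_eq_0_iff by simp_all
  then show p: "x \<in> Splus S \<longleftrightarrow> PiM S *v x = 0" and m: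
      "x \<in> Sminus S \<longleftrightarrow> PiP S *v x = 0"
    unfolding Splus_def Sminus_def mem_Collect_eq
    by (simp_all only: vec_eq_iff vector_add_component vector_minus_component vector_smult_component
        vector_uminus_component zero_index mult_minus_left *)
  show "x \<in> Splus S \<longleftrightarrow> PiP S *v x = x"
      "x \<in> Sminus S \<longleftrightarrow> PiM S *v x = x"
    unfolding p m using Pi_decomp[of S x] by (metis add.right_neutral add_cancel_right_right)
      (metis Pi_decomp add.left_neutral add_cancel_left_left)
qed

lemma Pi_mem: assumes "S ** S = - mat 1"
  shows "PiP S *v x \<in> Splus S" "PiM S *v x \<in> Sminus S"
  by (simp_all add: Splus_iff[OF assms] matrix_vector_mul_assoc Pi_simps[OF assms])

lemma jmap_Splus: assumes "jc S = S" shows "jmap ` Splus S = Sminus S"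
proof -
  have s: "S *v jmap x = jmap (S *v x)" for x using assms jmap_mv by metis
  have 1: "x \<in> Splus S \<Longrightarrow> jmap x \<in> Sminus S" for x
    by (simp add: Splus_def Sminus_def s jmap_simps)
  have 2: "x \<in> Sminus S \<Longrightarrow> - jmap x \<in> Splus S" for x
    by (simp add: Splus_def Sminus_def s jmap_simps matrix_vector_simps)
  show ?thesis
  proof (intro set_eqI iffI)
    fix x assume "x \<in> Sminus S"
    then have "- jmap x \<in> Splus S" "x = jmap (- jmap x)" using 2 by (auto simp: jmap_simps)
    then show "x \<in> jmap ` Splus S" by blast
  qed (use 1 in auto)
qed

lemma proj_along_eq:
  assumes "a \<in> E" "b \<in> F" "\<And>a b a' b'. a \<in> E \<Longrightarrow> b \<in> F \<Longrightarrow> a'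
      \<in> E \<Longrightarrow> b' \<in> F \<Longrightarrow> a + b = a' + b' \<Longrightarrow> a = a'"
  shows "proj_along E F (a + b) = a"
  unfolding proj_along_def by (rule the_equality) (use assms in blast)+

section \<open>Two-vectors\<close>

text \<open>The map M \<otimes> M: \<open>tens\<close> is to \<open>hat\<close> what a group action
  is to its derivative. It lets matrices on \<open>complex^4\<close> act as gauge transformations of
  bivectors.\<close>

definition tens :: "complex^4^4 \<Rightarrow> tensor2 \<Rightarrow> tensor2" where
  "tens M T = (\<chi> ij. \<Sum>k\<in>UNIV. \<Sum>l\<in>UNIV. M $ fst ij $ k * M $ snd ij $ l * T $ (k, l))"

lemma tens_wedge: "tens M (wedge x y) = wedge (M *v x) (M *v y)"
  by (simp add: vec_eq_iff tens_def wedge_def matrix_vector_mult_def sum_product sum_subtractf algebra_simps)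
    (intro allI sum.swap)

lemma tens_simps: "tens M (T + U) = tens M T + tens M U" "tens M (T - U) = tens M T - tens M U"
    "tens M (z *s T) = z *s tens M T" "tens M 0 = 0" "tens M (- T) = - tens M T"
  by (simp_all add: vec_eq_iff tens_def sum.distrib sum_subtractf sum_distrib_left sum_negf algebra_simps)

lemma conj2_simps: "conj2 (T + U) = conj2 T + conj2 U" "conj2 (z *s T) = cnj z *s conj2 T" "conj2 0 = 0"
  by (simp_all add: vec_eq_iff conj2_def sum.distrib sum_distrib_left algebra_simps)

lemma bl_conj2: "bounded_linear conj2"
  unfolding linear_conv_bounded_linear[symmetric]
  by (rule linearI) (simp_all add: conj2_simps scaleR_vscale)

lemma wedge_simps: "wedge (x + y) z = wedge x z + wedge y z" "wedge z (x + y) = wedge z x + wedge z y"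
  "wedge (x - y) z = wedge x z - wedge y z" "wedge z (x - y) = wedge z x - wedge z y"
  "wedge (- x) z = - wedge x z" "wedge x (- z) = - wedge x z"
  "wedge (c *s x) z = c *s wedge x z" "wedge x (c *s z) = c *s wedge x z" "wedge x x = 0"
  "wedge 0 x = 0" "wedge x 0 = 0"
  by (simp_all add: wedge_def vec_eq_iff algebra_simps)

lemma wedge_swap: "wedge x y = - wedge y x"
  by (simp add: wedge_def vec_eq_iff)

lemma wedge_Wedge2: "wedge x y \<in> Wedge2"
  by (simp add: wedge_def Wedge2_def)

lemma Wedge2_iff: "T \<in> Wedge2 \<longleftrightarrow> (\<forall>i j. T $ (i, j) + T $ (j, i) = 0)"
  by (simp only: Wedge2_def mem_Collect_eq eq_neg_iff_add_eq_0)

lemma subspace_Wedge2: "vec.subspace Wedge2"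
proof -
  have "x + y \<in> Wedge2" if "x \<in> Wedge2" "y \<in> Wedge2" for x y
  proof -
    have "(x + y) $ (i, j) + (x + y) $ (j, i) = (x $ (i, j) + x $ (j, i)) + (y $ (i, j) + y $ (j, i))" for i j
      by simp
    then show ?thesis using that unfolding Wedge2_iff by (metis add.right_neutral)
  qed
  moreover have "c *s x \<in> Wedge2" if "x \<in> Wedge2" for c x
    using that unfolding Wedge2_iff by (simp add: distrib_left[symmetric])
  ultimately show ?thesis by (simp add: vec.subspace_def Wedge2_iff)
qed

text \<open>The sum runs over all ordered pairs (i, j), so every basis bivector occurs twice; hence
  the factor 1/2.\<close>

lemma Wedge2_expansion: assumes "T \<in> Wedge2"
  shows "T = (\<Sum>i\<in>UNIV. \<Sum>j\<in>UNIV. (T $ (i, j) / 2) *s wedge (axis i 1) (axis j 1))"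
proof -
  have w: "wedge (axis i 1) (axis j 1) $ (a, b) = of_bool (i = a) * of_bool (j = b) - of_bool (i = b) * of_bool
      (j = a)" for i j a b :: 4
    by (cases "i = a"; cases "j = b"; cases "i = b"; cases "j = a") (simp_all add: wedge_def axis_def)
  have delta: "(\<Sum>i\<in>UNIV. \<Sum>j\<in>UNIV. f i j * of_bool (i = a) * of_bool (j = b)) = f a b" for f ::
      "4 \<Rightarrow> 4 \<Rightarrow> complex" and a b
  proof -
    have "(\<Sum>j\<in>UNIV. f i j * of_bool (i = a) * of_bool (j = b)) = (if i = a then f i b else 0)" for i
      by (cases "i = a") (simp_all add: of_bool_def if_distrib cong: if_cong)
    then show ?thesis by simp
  qed
  have "(\<Sum>i\<in>UNIV. \<Sum>j\<in>UNIV. (T $ (i, j) / 2) *s wedge (axis i 1) (axis j 1)) $ (a, b) = T $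
      (a, b)" for a b
  proof -
    have "(\<Sum>i\<in>UNIV. \<Sum>j\<in>UNIV. (T $ (i, j) / 2) *s wedge (axis i 1) (axis j 1)) $ (a, b)
      = (\<Sum>i\<in>UNIV. \<Sum>j\<in>UNIV. T $ (i, j) / 2 * of_bool (i = a) * of_bool (j = b))
        - (\<Sum>i\<in>UNIV. \<Sum>j\<in>UNIV. T $ (i, j) / 2 * of_bool (i = b) * of_bool (j = a))"
      unfolding sum_subtractf[symmetric] sum_component vector_smult_component
      by (intro sum.cong refl) (simp only: w right_diff_distrib mult.assoc)
    also have "\<dots> = T $ (a, b) / 2 - T $ (b, a) / 2"
      by (simp only: delta)
    also have "\<dots> = (T $ (a, b) + T $ (a, b)) / 2 - (T $ (a, b) + T $ (b, a)) / 2" by (simp add: field_simps)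
    also have "\<dots> = T $ (a, b)" using assms unfolding Wedge2_iff by simp
    finally show ?thesis .
  qed
  then show ?thesis by (auto simp: vec_eq_iff)
qed

lemma Wedge2_induct [consumes 1, case_names wedge add scale]:
  assumes "T \<in> Wedge2" and w: "\<And>x y. P (wedge x y)" and a:
      "\<And>T U. P T \<Longrightarrow> P U \<Longrightarrow> P (T + U)"
    and s: "\<And>z T. P T \<Longrightarrow> P (z *s T)"
  shows "P T"
proof -
  have P0: "P 0" using w[of 0 0] by (simp add: wedge_simps)
  have sum: "(\<And>i. P (f i)) \<Longrightarrow> P (\<Sum>i\<in>I. f i)" for f :: "4 \<Rightarrow> tensor2" and I
      :: "4 set"
    by (induction I rule: infinite_finite_induct) (auto intro: P0 a)
  show ?thesis by (subst Wedge2_expansion[OF assms(1)]) (intro sum s w)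
qed

lemma subspace_wedge_space: "vec.subspace (wedge_space E F)"
  unfolding wedge_space_def by (rule vec.subspace_span)

lemma wedge_in_space: "x \<in> E \<Longrightarrow> y \<in> F \<Longrightarrow> wedge x y \<in> wedge_space E F"
  unfolding wedge_space_def by (rule vec.span_base) blast

lemma wedge_space_induct [consumes 1, case_names wedge zero add scale]:
  assumes T: "T \<in> wedge_space E F" and w: "\<And>x y. x \<in> E \<Longrightarrow> y \<in> F \<Longrightarrow> P
      (wedge x y)"
    and 0: "P 0" and a: "\<And>T U. P T \<Longrightarrow> P U \<Longrightarrow> P (T + U)" and s:
        "\<And>z T. P T \<Longrightarrow> P (z *s T)"
  shows "P T"
  using T unfolding wedge_space_def
  by (induction rule: vec.span_induct_alt) (use w 0 a s in auto)

section \<open>The determinant form and the metric on bivectors\<close>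

definition rows4 :: "complex^4 \<Rightarrow> complex^4 \<Rightarrow> complex^4 \<Rightarrow> complex^4
    \<Rightarrow> complex^4^4" where
  "rows4 a b c d = (\<chi> i. if i = 1 then a else if i = 2 then b else if i = 3 then c else d)"

lemma rows4_nth [simp]: "rows4 a b c d $ 1 = a" "rows4 a b c d $ 2 = b" "rows4 a b c d $ 3 = c"
    "rows4 a b c d $ 4 = d"
  by (simp_all add: rows4_def)

lemma vol_rows4: "vol \<kappa> a b c d = \<kappa> * det (rows4 a b c d)"
  by (simp add: vol_def rows4_def)

lemma rows4_upd:
  "(\<chi> i. if i = 1 then x else rows4 a b c d $ i) = rows4 x b c d"
  "(\<chi> i. if i = 2 then x else rows4 a b c d $ i) = rows4 a x c d"
  "(\<chi> i. if i = 3 then x else rows4 a b c d $ i) = rows4 a b x d"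
  "(\<chi> i. if i = 4 then x else rows4 a b c d $ i) = rows4 a b c x"
  by (simp_all add: vec_eq_iff forall_4)

lemma vol_add:
  "vol \<kappa> (x + y) b c d = vol \<kappa> x b c d + vol \<kappa> y b c d"
      "vol \<kappa> a (x + y) c d = vol \<kappa> a x c d + vol \<kappa> a y c d"
  "vol \<kappa> a b (x + y) d = vol \<kappa> a b x d + vol \<kappa> a b y d"
      "vol \<kappa> a b c (x + y) = vol \<kappa> a b c x + vol \<kappa> a b c y"
  using det_row_add[of 1 "\<lambda>_. x" "\<lambda>_. y" "\<lambda>i. rows4 0 b c d $ i"]
      det_row_add[of 2 "\<lambda>_. x" "\<lambda>_. y" "\<lambda>i. rows4 a 0 c d $ i"]
    det_row_add[of 3 "\<lambda>_. x" "\<lambda>_. y" "\<lambda>i. rows4 a b 0 d $ i"]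
        det_row_add[of 4 "\<lambda>_. x" "\<lambda>_. y" "\<lambda>i. rows4 a b c 0 $ i"]
  by (simp_all only: vol_rows4 rows4_upd distrib_left)

lemma vol_scale:
  "vol \<kappa> (z *s x) b c d = z * vol \<kappa> x b c d" "vol \<kappa> a (z *s x) c d = z * vol \<kappa> a x c d"
  "vol \<kappa> a b (z *s x) d = z * vol \<kappa> a b x d" "vol \<kappa> a b c (z *s x) = z * vol \<kappa> a b c x"
  using det_row_mul[of 1 z "\<lambda>_. x" "\<lambda>i. rows4 0 b c d $ i"] det_row_mul[of 2 z "\<lambda>_. x"
      "\<lambda>i. rows4 a 0 c d $ i"]
    det_row_mul[of 3 z "\<lambda>_. x" "\<lambda>i. rows4 a b 0 d $ i"] det_row_mul[of 4 z "\<lambda>_. x"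
        "\<lambda>i. rows4 a b c 0 $ i"]
  by (simp_all only: vol_rows4 rows4_upd mult.left_commute)

lemma vol_alternating: "vol \<kappa> x x c d = 0" "vol \<kappa> x b x d = 0" "vol \<kappa> x b c x = 0"
  "vol \<kappa> a x x d = 0" "vol \<kappa> a x c x = 0" "vol \<kappa> a b x x = 0"
  unfolding vol_rows4
  by (simp_all add: det_identical_rows[of 1 2] det_identical_rows[of 1 3] det_identical_rows[of 1 4]
      det_identical_rows[of 2 3] det_identical_rows[of 2 4] det_identical_rows[of 3 4] row_def vec_eq_iff)

lemma vol_swap: "vol \<kappa> b a c d = - vol \<kappa> a b c d" "vol \<kappa> a b d c = - vol \<kappa> a b c d"
  "vol \<kappa> a c b d = - vol \<kappa> a b c d"
proof -
  have n: "x + y = 0 \<Longrightarrow> y = - x" for x y :: complex by (simp add: eq_neg_iff_add_eq_0 add.commute)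
  show "vol \<kappa> b a c d = - vol \<kappa> a b c d"
    using vol_alternating(1)[of \<kappa> "a + b" c d] unfolding vol_add by (intro n)
        (simp add: vol_alternating add.commute)
  show "vol \<kappa> a b d c = - vol \<kappa> a b c d"
    using vol_alternating(6)[of \<kappa> a b "c + d"] unfolding vol_add by (intro n)
        (simp add: vol_alternating add.commute)
  show "vol \<kappa> a c b d = - vol \<kappa> a b c d"
    using vol_alternating(4)[of \<kappa> a "b + c" d] unfolding vol_add by (intro n)
        (simp add: vol_alternating add.commute)
qed

lemma linear_functional_expansion:
  fixes f :: "complex^'n \<Rightarrow> complex"
  assumes "\<And>x y. f (x + y) = f x + f y" "\<And>z x. f (z *s x) = z * f x"
  shows "f x = (\<Sum>i\<in>UNIV. x $ i * f (axis i 1))"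
proof -
  have 0: "f 0 = 0" using assms(2)[of 0 0] by simp
  have s: "f (\<Sum>i\<in>I. g i) = (\<Sum>i\<in>I. f (g i))" for g :: "'n \<Rightarrow> complex^'n" and I
    by (induction I rule: infinite_finite_induct) (auto simp: 0 assms(1))
  show ?thesis using s[of "\<lambda>i. x $ i *s axis i 1" UNIV] by (simp add: basis_expansion assms(2))
qed

lemma vol_expansion:
  "(\<Sum>i\<in>UNIV. \<Sum>j\<in>UNIV. \<Sum>k\<in>UNIV. \<Sum>l\<in>UNIV.
     (a $ i * b $ j) * (c $ k * d $ l) * vol \<kappa> (axis i 1) (axis j 1) (axis k 1) (axis l 1)) = vol \<kappa> a b c d"
proof -
  have "vol \<kappa> a b c d = (\<Sum>i\<in>UNIV. a $ i * (\<Sum>j\<in>UNIV. b $ j * (\<Sum>k\<in>UNIV. c $ k * (\<Sum>l\<in>UNIV. d $ l *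
       vol \<kappa> (axis i 1) (axis j 1) (axis k 1) (axis l 1)))))"
    by (subst linear_functional_expansion[of "\<lambda>x. vol \<kappa> x _ _ _"], simp add: vol_add, simp add:
        vol_scale,
        subst linear_functional_expansion[of "\<lambda>x. vol \<kappa> _ x _ _"], simp add: vol_add, simp add:
            vol_scale,
        subst linear_functional_expansion[of "\<lambda>x. vol \<kappa> _ _ x _"], simp add: vol_add, simp add:
            vol_scale,
        subst linear_functional_expansion[of "\<lambda>x. vol \<kappa> _ _ _ x"], simp add: vol_add, simp add:
            vol_scale, rule refl)
  then show ?thesis by (simp add: sum_distrib_left mult.assoc mult.left_commute)
qed

text \<open>Expanding both wedge products yields four determinants that agree after reordering, and
  their sum cancels the denominator 4 in \<open>metric2\<close>.\<close>

lemma metric2_wedge: "metric2 \<kappa> (wedge a b) (wedge c d) = vol \<kappa> a b c d"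
proof -
  have "(a $ i * b $ j - b $ i * a $ j) * (c $ k * d $ l - d $ k * c $ l) * v =
      (a $ i * b $ j) * (c $ k * d $ l) * v - (b $ i * a $ j) * (c $ k * d $ l) * v
      - (a $ i * b $ j) * (d $ k * c $ l) * v + (b $ i * a $ j) * (d $ k * c $ l) * v" for i j k l v
    by (simp add: algebra_simps)
  then have "metric2 \<kappa> (wedge a b) (wedge c d) = (vol \<kappa> a b c d - vol \<kappa> b a c d - vol \<kappa>
      a b d c + vol \<kappa> b a d c) / 4"
    by (simp only: metric2_def wedge_def vec_lambda_beta fst_conv snd_conv sum.distrib sum_subtractf vol_expansion)
  then show ?thesis by (simp add: vol_swap(1)[of \<kappa> b a] vol_swap(2)[of \<kappa> _ _ d c])
qed

lemma metric2_simps: "metric2 \<kappa> (T + T') U = metric2 \<kappa> T U + metric2 \<kappa> T' U"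
    "metric2 \<kappa> T (U + U') = metric2 \<kappa> T U + metric2 \<kappa> T U'"
  "metric2 \<kappa> (z *s T) U = z * metric2 \<kappa> T U" "metric2 \<kappa> T (z *s U) = z * metric2 \<kappa> T U"
  by (simp_all add: metric2_def sum.distrib add_divide_distrib algebra_simps sum_distrib_left)

section \<open>The gauge \<open>\<tau>\<close> and the connections on two-vectors\<close>

lemma tens_on_wedge_space:
  assumes T: "T \<in> wedge_space E F" and "\<And>x. x \<in> E \<Longrightarrow> M *v x = \<mu> *s x"
      "\<And>x. x \<in> F \<Longrightarrow> M *v x = \<nu> *s x"
  shows "tens M T = (\<mu> * \<nu>) *s T"
  using T by (induction rule: wedge_space_induct)
    (simp_all add: tens_wedge tens_simps assms(2,3) wedge_simps vec.scale_right_distrib mult.commute)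

lemma Wedge2_decomp:
  assumes S: "S ** S = - mat 1" and T: "T \<in> Wedge2"
  shows "tens (PiP S) T \<in> wedge_space (Splus S) (Splus S)"
      "tens (PiM S) T \<in> wedge_space (Sminus S) (Sminus S)"
    "T - tens (PiP S) T - tens (PiM S) T \<in> wedge_space (Splus S) (Sminus S)"
proof -
  note mem = Pi_mem[OF S]
  show "tens (PiP S) T \<in> wedge_space (Splus S) (Splus S)"
    using T by (induction rule: Wedge2_induct)
      (auto simp: tens_wedge tens_simps intro: wedge_in_space mem vec.subspace_add[OF subspace_wedge_space]
          vec.subspace_scale[OF subspace_wedge_space])
  show "tens (PiM S) T \<in> wedge_space (Sminus S) (Sminus S)"
    using T by (induction rule: Wedge2_induct)
      (auto simp: tens_wedge tens_simps intro: wedge_in_space mem vec.subspace_add[OF subspace_wedge_space]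
          vec.subspace_scale[OF subspace_wedge_space])
  show "T - tens (PiP S) T - tens (PiM S) T \<in> wedge_space (Splus S) (Sminus S)"
    using T
  proof (induction rule: Wedge2_induct)
    case (wedge x y)
    define a b c d where "a = PiP S *v x" "b = PiM S *v x" "c = PiP S *v y" "d = PiM S *v y"
    have "wedge x y = wedge (a + b) (c + d)" by (simp add: a_b_c_d_def Pi_decomp)
    moreover have "tens (PiP S) (wedge x y) = wedge a c" "tens (PiM S) (wedge x y) = wedge b d"
      by (simp_all add: tens_wedge a_b_c_d_def)
    ultimately have "wedge x y - tens (PiP S) (wedge x y) - tens (PiM S) (wedge x y) = wedge a d + wedge b c"
      by (simp only: wedge_simps) (simp add: algebra_simps)
    also have "\<dots> = wedge a d + (- 1) *s wedge c b" using wedge_swap[of b c] by simp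
    finally show ?case
      using mem unfolding a_b_c_d_def
      by (metis wedge_in_space vec.subspace_add[OF subspace_wedge_space]
          vec.subspace_scale[OF subspace_wedge_space])
  next
    case (add T U)
    have "T + U - tens (PiP S) (T + U) - tens (PiM S) (T + U) =
       (T - tens (PiP S) T - tens (PiM S) T) + (U - tens (PiP S) U - tens (PiM S) U)" by (simp add: tens_simps)
    then show ?case using add vec.subspace_add[OF subspace_wedge_space] by metis
  next
    case (scale z T)
    have "z *s T - tens (PiP S) (z *s T) - tens (PiM S) (z *s T) = z *s (T - tens (PiP S) T - tens (PiM S) T)"
      by (simp add: tens_simps vec.scale_right_diff_distrib)
    then show ?case using scale vec.subspace_scale[OF subspace_wedge_space] by metis
  qed
qed

lemma tens_types:
  assumes S: "S ** S = - mat 1"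
  shows "a \<in> wedge_space (Splus S) (Splus S) \<Longrightarrow> tens (x *k PiP S + y *k PiM S) a = x^2 *s a"
    "b \<in> wedge_space (Splus S) (Sminus S) \<Longrightarrow> tens (x *k PiP S + y *k PiM S) b = (x * y) *s b"
    "c \<in> wedge_space (Sminus S) (Sminus S) \<Longrightarrow> tens (x *k PiP S + y *k PiM S) c = y^2 *s c"
proof -
  have e: "u \<in> Splus S \<Longrightarrow> (x *k PiP S + y *k PiM S) *v u = x *s u"
    "u \<in> Sminus S \<Longrightarrow> (x *k PiP S + y *k PiM S) *v u = y *s u" for u
    by (metis Splus_iff[OF S] matrix_vector_simps(1) mscale_simps(10) vec.scale_zero_right add.right_neutral)
      (metis Splus_iff[OF S] matrix_vector_simps(1) mscale_simps(10) vec.scale_zero_right add.left_neutral)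
  show "a \<in> wedge_space (Splus S) (Splus S) \<Longrightarrow> tens (x *k PiP S + y *k PiM S) a = x^2 *s a"
    "b \<in> wedge_space (Splus S) (Sminus S) \<Longrightarrow> tens (x *k PiP S + y *k PiM S) b = (x * y) *s b"
    "c \<in> wedge_space (Sminus S) (Sminus S) \<Longrightarrow> tens (x *k PiP S + y *k PiM S) c = y^2 *s c"
    using tens_on_wedge_space[OF _ e(1) e(1)] tens_on_wedge_space[OF _ e(1) e(2)] tens_on_wedge_space[OF _ e(2)
        e(2)]
    by (simp_all add: power2_eq_square)
qed

text \<open>On the three summands the matrix acts with the weights \<epsilon>^-2, 1 and
  \<epsilon>^2. A square root \<epsilon> of the parameter thus lifts \<tau> from bivectors to
  \<open>complex^4\<close>, where the computations take place.\<close>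

lemma tau_tens:
  assumes S: "S ** S = - mat 1" and T: "T \<in> Wedge2" and e: "\<epsilon> \<noteq> 0"
  shows "tau S (\<epsilon>^2) T = tens (inverse \<epsilon> *k PiP S + \<epsilon> *k PiM S) T"
  unfolding tau_def
proof (rule the_equality)
  let ?M = "inverse \<epsilon> *k PiP S + \<epsilon> *k PiM S"
  have M: "inverse (\<epsilon>\<^sup>2) *s a + b + \<epsilon>\<^sup>2 *s c = tens ?M (a + b + c)"
    if "a \<in> wedge_space (Splus S) (Splus S)" "b \<in> wedge_space (Splus S) (Sminus S)"
        "c \<in> wedge_space (Sminus S) (Sminus S)" for a b c
    using tens_types[OF S, of _ "inverse \<epsilon>" \<epsilon>] that e by (simp add: tens_simps power_inverse)
  show "\<exists>a\<in>wedge_space (Splus S) (Splus S). \<exists>b\<in>wedge_space (Splus S) (Sminus S). \<exists>c\<in>wedge_space (Sminus S) (Sminus S).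
       T = a + b + c \<and> tens ?M T = inverse (\<epsilon>\<^sup>2) *s a + b + \<epsilon>\<^sup>2 *s c"
    using Wedge2_decomp[OF S T] by (intro bexI[of _ "tens (PiP S) T"]
        bexI[of _ "T - tens (PiP S) T - tens (PiM S) T"] bexI[of _ "tens (PiM S) T"])
      (auto simp: M)
  show "U = tens ?M T" if "\<exists>a\<in>wedge_space (Splus S) (Splus S). \<exists>b\<in>wedge_space (Splus S) (Sminus S). \<exists>c\<in>wedge_space (Sminus S) (Sminus S).
       T = a + b + c \<and> U = inverse (\<epsilon>\<^sup>2) *s a + b + \<epsilon>\<^sup>2 *s c" for U
    using that M by auto
qed

text \<open>\<open>tens S\<close> has the eigenvalue \<i> (-\<i>) = 1 on V and the eigenvalue \<i>^2
  = (-\<i>)^2 = -1 on its complement, so both projections are affine in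
  \<open>tens S\<close>.\<close>

lemma proj_V:
  assumes S: "S ** S = - mat 1" and T: "T \<in> Wedge2"
  shows "proj_along (Vspace S) (Vperp S) T = (1/2) *s (T + tens S T)"
    "proj_along (Vperp S) (Vspace S) T = (1/2) *s (T - tens S T)"
proof -
  have Sx: "S = \<i> *k PiP S + (- \<i>) *k PiM S"
    by (simp add: PiP_def PiM_def vec_eq_iff algebra_simps)
  have V: "tens S b = b" if "b \<in> Vspace S" for b
    using tens_types(2)[OF S, of b \<i> "- \<i>"] that unfolding Vspace_def Sx[symmetric] by simp
  have W: "tens S b = - b" if b: "b \<in> Vperp S" for b
  proof -
    obtain x y where "b = x + y" "x \<in> wedge_space (Splus S) (Splus S)"
        "y \<in> wedge_space (Sminus S) (Sminus S)"
      using b unfolding Vperp_def sumset_def by blast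
    then show ?thesis using tens_types(1)[OF S, of x \<i> "- \<i>"] tens_types(3)[OF S, of y \<i> "- \<i>"]
        unfolding Sx[symmetric]
      by (simp add: tens_simps)
  qed
  define b where "b = T - tens (PiP S) T - tens (PiM S) T"
  define a where "a = tens (PiP S) T + tens (PiM S) T"
  have Tab: "T = b + a" by (simp add: a_def b_def)
  have b: "b \<in> Vspace S" and a: "a \<in> Vperp S"
    using Wedge2_decomp[OF S T] unfolding a_def b_def Vspace_def Vperp_def sumset_def by auto
  have half: "(1/2) *s (x + y + (x - y)) = x" "(1/2) *s (x + y - (x - y)) = y" for x y :: tensor2
    by (simp_all add: vec_eq_iff)
  have u: "x = (1/2) *s (x + y + tens S (x + y))" "y = (1/2) *s (x + y - tens S (x + y))" if "x \<in> Vspace S"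
      "y \<in> Vperp S" for x y
    using V[OF that(1)] W[OF that(2)] half[of x y] by (simp_all add: tens_simps)
  have "proj_along (Vspace S) (Vperp S) (b + a) = b" by (rule proj_along_eq[OF b a]) (use u in metis)
  then show "proj_along (Vspace S) (Vperp S) T = (1/2) *s (T + tens S T)" using u(1)[OF b a] Tab by simp
  have "proj_along (Vperp S) (Vspace S) (a + b) = a" by (rule proj_along_eq[OF a b]) (use u add.commute in metis)
  then show "proj_along (Vperp S) (Vspace S) T = (1/2) *s (T - tens S T)" using u(2)[OF b a] Tab by
      (simp add: add.commute)
qed

text \<open>The connection \<open>dVlq\<close> at parameter l, seen on \<open>complex^4\<close> as d
  plus a matrix. Here n and m are the values of \<open>NS S\<close> at v and J v, and a and b those
  of q, so that (n - \<i> m)/2 and (n + \<i> m)/2 are the (1,0)- and (0,1)-parts; the term -n turns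
  d into D_S.\<close>

definition conn_matrix :: "complex \<Rightarrow> complex^4^4 \<Rightarrow> complex^4^4 \<Rightarrow> complex^4^4
    \<Rightarrow> complex^4^4 \<Rightarrow> complex^4^4" where
  "conn_matrix l n m a b = - n + (inverse l / 2) *k (n - \<i> *k m) + (l / 2) *k (n + \<i> *k m)
     + ((inverse (l^2) - 1) / 2) *k (a - \<i> *k b) + ((l^2 - 1) / 2) *k (a + \<i> *k b)"

lemma hat_lin: "hat (M + N) T = hat M T + hat N T" "hat (M - N) T = hat M T - hat N T"
    "hat (z *k M) T = z *s hat M T" "hat (- M) T = - hat M T"
  by (simp_all add: hat_def vec_eq_iff sum.distrib sum_subtractf sum_negf sum_distrib_left algebra_simps)

context surface begin

text \<open>With T = \<open>tens S\<close>, the formulas of \<open>proj_V\<close> give D_V \<sigma>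
  = (d\<sigma> + T d(T\<sigma>))/2, and S^2 = -1 makes T d(T\<sigma>) differ from d\<sigma> by the
  action of S dS. Hence D_V is induced by D_S, and \<open>NV\<close> is the action of
  \<open>NS S\<close>.\<close>

lemma DV_wedge:
  assumes S: "sm B N S" and SS: "\<And>x. x \<in> N \<Longrightarrow> S x ** S x = - mat 1"
    and u: "sm B N u1" "sm B N u2" and p: "c \<in> B" "p \<in> N" "p \<in> dom_ch c"
  shows "DV S c (\<lambda>x. wedge (u1 x) (u2 x)) p v = dd c (\<lambda>x. wedge (u1 x) (u2 x)) p v - hat
      (NS S c p v) (wedge (u1 p) (u2 p))"
    "dd c (\<lambda>x. wedge (u1 x) (u2 x)) p v = wedge (u1 p) (dd c u2 p v) + wedge (dd c u1 p v) (u2 p)"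
proof -
  note o = sm_open[OF S]
  have cA: "c \<in> A" using o p by auto
  have SS': "S x *v (S x *v y) = - y" if "x \<in> N" for x y
    using SS[OF that] by (simp add: matrix_vector_mul_assoc matrix_vector_simps)
  show dw: "dd c (\<lambda>x. wedge (u1 x) (u2 x)) p v = wedge (u1 p) (dd c u2 p v) + wedge (dd c u1 p v) (u2 p)"
    by (rule dd_bilinear[OF bb_wedge u p])
  note Su = sm_bilinear[OF bb_mv S u(1)] sm_bilinear[OF bb_mv S u(2)]
  have dS: "dd c (\<lambda>x. S x *v u1 x) p v = S p *v dd c u1 p v + dd c S p v *v u1 p"
    "dd c (\<lambda>x. S x *v u2 x) p v = S p *v dd c u2 p v + dd c S p v *v u2 p"
    by (rule dd_bilinear[OF bb_mv S u(1) p], rule dd_bilinear[OF bb_mv S u(2) p])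
  have dSw: "dd c (\<lambda>x. wedge (S x *v u1 x) (S x *v u2 x)) p v =
     wedge (S p *v u1 p) (S p *v dd c u2 p v + dd c S p v *v u2 p) + wedge (S p *v dd c u1 p v + dd c S p v *v u1 p) (S p *v u2 p)"
    unfolding dd_bilinear[OF bb_wedge Su p] dS ..
  note w = sm_bilinear[OF bb_wedge u] sm_bilinear[OF bb_wedge Su]
  have bl: "bounded_linear (\<lambda>x::tensor2. (1/2) *s x)"
    unfolding linear_conv_bounded_linear[symmetric] by (rule linearI) (auto simp: vec_eq_iff algebra_simps)
  have d1: "dd c (\<lambda>x. proj_along (Vspace (S x)) (Vperp (S x)) (wedge (u1 x) (u2 x))) p v =
     (1/2) *s (dd c (\<lambda>x. wedge (u1 x) (u2 x)) p v + dd c (\<lambda>x. wedge (S x *v u1 x) (S x *v u2 x)) p v)"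
    using dd_linear[OF bl sm_add[OF w] p] dd_add[OF w p]
    by (subst dd_cong[OF cA o(1) p(2,3)]) (auto simp: proj_V[OF SS] wedge_Wedge2 tens_wedge)
  have d2: "dd c (\<lambda>x. proj_along (Vperp (S x)) (Vspace (S x)) (wedge (u1 x) (u2 x))) p v =
     (1/2) *s (dd c (\<lambda>x. wedge (u1 x) (u2 x)) p v - dd c (\<lambda>x. wedge (S x *v u1 x) (S x *v u2 x)) p v)"
    using dd_linear[OF bl sm_diff[OF w] p] dd_diff[OF w p]
    by (subst dd_cong[OF cA o(1) p(2,3)]) (auto simp: proj_V[OF SS] wedge_Wedge2 tens_wedge)
  have mem: "dd c (\<lambda>x. wedge (u1 x) (u2 x)) p v \<in> Wedge2"
      "dd c (\<lambda>x. wedge (S x *v u1 x) (S x *v u2 x)) p v \<in> Wedge2"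
    unfolding dw dSw by (auto intro!: vec.subspace_add[OF subspace_Wedge2] wedge_Wedge2)
  define w1 w2 where "w1 = dd c (\<lambda>x. wedge (u1 x) (u2 x)) p v"
      "w2 = dd c (\<lambda>x. wedge (S x *v u1 x) (S x *v u2 x)) p v"
  have m2: "(1/2) *s (w1 + w2) \<in> Wedge2" "(1/2) *s (w1 - w2) \<in> Wedge2"
    using mem unfolding w1_w2_def by (auto intro!: vec.subspace_scale[OF subspace_Wedge2]
        vec.subspace_add[OF subspace_Wedge2] vec.subspace_diff[OF subspace_Wedge2])
  have "DV S c (\<lambda>x. wedge (u1 x) (u2 x)) p v = (1/2) *s w1 + (1/2) *s tens (S p) w2"
    unfolding DV_def d1 d2 w1_w2_def[symmetric] proj_V[OF SS[OF p(2)] m2(1)] proj_V[OF SS[OF p(2)] m2(2)]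
    by (simp add: tens_simps) (simp add: vec_eq_iff algebra_simps)
  also have "tens (S p) w2 = w1 - hat (S p ** dd c S p v) (wedge (u1 p) (u2 p))"
    unfolding w1_w2_def dw dSw
    by (simp add: tens_simps tens_wedge hat_wedge SS'[OF p(2)] matrix_vector_simps wedge_simps
        matrix_vector_mul_assoc[symmetric])
  finally show "DV S c (\<lambda>x. wedge (u1 x) (u2 x)) p v = dd c (\<lambda>x. wedge (u1 x) (u2 x)) p v - hat
      (NS S c p v) (wedge (u1 p) (u2 p))"
    unfolding w1_w2_def NS_def scaleR_mscale hat_lin by (simp add: vec_eq_iff algebra_simps)
qed

lemma dVlq_wedge:
  assumes S: "sm B N S" and SS: "\<And>x. x \<in> N \<Longrightarrow> S x ** S x = - mat 1"
    and u: "sm B N u1" "sm B N u2" and p: "c \<in> B" "p \<in> N" "p \<in> dom_ch c"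
    and M: "M = conn_matrix l (NS S c p v) (NS S c p (J c p v)) (q c p v) (q c p (J c p v))"
  shows "dVlq J S q l c (\<lambda>x. wedge (u1 x) (u2 x)) p v =
    wedge (dd c u1 p v + M *v u1 p) (u2 p) + wedge (u1 p) (dd c u2 p v + M *v u2 p)"
proof -
  note D = DV_wedge[OF S SS u p]
  have NV: "NV S c (\<lambda>x. wedge (u1 x) (u2 x)) p v = hat (NS S c p v) (wedge (u1 p) (u2 p))" for v
    by (simp add: NV_def D(1))
  have DVv: "DV S c (\<lambda>x. wedge (u1 x) (u2 x)) p v =
      dd c (\<lambda>x. wedge (u1 x) (u2 x)) p v - hat (NS S c p v) (wedge (u1 p) (u2 p))" by (rule D(1))
  define \<omega> where "\<omega> = wedge (u1 p) (u2 p)"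
  have "dVlq J S q l c (\<lambda>x. wedge (u1 x) (u2 x)) p v =
      DV S c (\<lambda>x. wedge (u1 x) (u2 x)) p v + (hat (NS S c p v) \<omega> + hat M \<omega>)"
    unfolding dVlq_def NV part10_def part01_def M conn_matrix_def hat_lin \<omega>_def[symmetric]
    by (simp add: vec_eq_iff)
  then have "dVlq J S q l c (\<lambda>x. wedge (u1 x) (u2 x)) p v = dd c (\<lambda>x. wedge (u1 x) (u2 x)) p v +
      hat M (wedge (u1 p) (u2 p))"
    unfolding DVv \<omega>_def by simp
  then show ?thesis by (simp add: D(2) hat_wedge wedge_simps)
qed

end

section \<open>Algebra of the dressing transformation\<close>

lemma assoc_rule: "(M :: complex^'n^'n) ** N = K \<Longrightarrow> M ** (N ** x) = K ** x"
  by (simp add: matrix_mul_assoc)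

text \<open>With \<open>\<Phi> = (N + S * N) / 2 + q\<close>, where \<open>*\<close> is the Hodge star, both equations for a constrained
  Willmore surface are the components of one equation, the flatness of \<open>d - 2 \<Phi>\<close>.\<close>

lemma curvature_identity:
  fixes S n m a b Sv SJ dsN dq :: "complex^4^4"
  assumes S: "S ** S = - mat 1" and n: "n ** S = - (S ** n)" and m: "m ** S = - (S ** m)"
    and Sv: "Sv = -(2 *k (S ** n))" and SJ: "SJ = -(2 *k (S ** m))" and a: "a ** S = S ** a" and b:
        "b = - (S ** a)"
  shows "(1/2) *k ((1/2) *k (Sv ** SJ - SJ ** Sv) + (Sv ** n + SJ ** m) + S ** dsN) + dq
      - 2 *k comm ((1/2) *k (n - S ** m) + a) ((1/2) *k (m + S ** n) + b)
    = (1/2) *k (S ** (dsN - (comm n n - comm m (- m)) - 2 *k (comm a n - comm b (- m)))) + (dq - (comm n b - comm m a))"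
proof -
  note r = S n m a assoc_rule[OF S] assoc_rule[OF n] assoc_rule[OF m] assoc_rule[OF a]
  show ?thesis unfolding Sv SJ b
    by (simp add: mat_alg r) (simp add: vec_eq_iff field_simps)
qed

text \<open>The commutator with S annihilates Y and sends (1/2) S X to X. One equation thus contains
  two, which is what lets a single flat connection encode a constrained Willmore surface.\<close>

lemma split_type:
  assumes S: "S ** S = - mat 1" and X: "X ** S = - (S ** X)" and Y: "Y ** S = S ** Y"
    and 0: "(1/2) *k (S ** X) + Y = 0"
  shows "X = 0" "Y = 0"
proof -
  have "X = ((1/2) *k (S ** X) + Y) ** S - S ** ((1/2) *k (S ** X) + Y)"
    by (simp add: mat_alg X Y S assoc_rule[OF S]) (simp add: vec_eq_iff)
  then show "X = 0" using 0 by (simp add: mat_alg)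
  then show "Y = 0" using 0 by (simp add: mat_alg)
qed

definition dress :: "complex \<Rightarrow> complex \<Rightarrow> complex^4^4 \<Rightarrow> complex^4^4" where
  "dress k l P = k *k P + l *k (mat 1 - P)"

lemma dress_inverse:
  assumes "P ** P = P" "k \<noteq> 0" "l \<noteq> 0"
  shows "dress k l P ** dress (inverse k) (inverse l) P = mat 1"
    "dress (inverse k) (inverse l) P ** dress k l P = mat 1"
  using assms by (simp_all add: dress_def mat_alg)

text \<open>D stands for a (1,0)- or (0,1)-derivative of P and M for the matching part of \<Phi>. In
  blocks with respect to P the diagonal part of the right-hand side cancels, and the off-diagonal
  blocks carry the scalars l s^2 - k and k s^-2 - l; so the gauge equation amounts to the two scalar
  equations \<open>xy\<close>.\<close>

lemma dress_gauge:
  assumes P: "P ** P = P" and k: "k \<noteq> 0" and l: "l \<noteq> 0"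
    and D: "D = x *k (P ** M ** (mat 1 - P)) + y *k ((mat 1 - P) ** M ** P)"
    and xy: "(k - l) * x = \<theta> * (l * (s * s) - k)"
        "(k - l) * y = \<theta> * (k * (inverse s * inverse s) - l)"
    and s: "s \<noteq> 0"
  shows "(k - l) *k D = \<theta> *k ((dress s (inverse s) P ** M ** dress (inverse s) s P) ** dress k l P - dress k
      l P ** M)"
proof -
  define Z where "Z = mat 1 - P"
  have Z: "Z ** Z = Z" "P ** Z = 0" "Z ** P = 0" using P by (simp_all add: Z_def mat_alg)
  have M: "M = P ** (M ** P) + P ** (M ** Z) + Z ** (M ** P) + Z ** (M ** Z)"
    by (simp add: Z_def mat_alg)
  note r = P Z assoc_rule[OF P] assoc_rule[OF Z(1)] assoc_rule[OF Z(2)] assoc_rule[OF Z(3)]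
  have 1: "dress k l P ** M = k *k (P ** (M ** P)) + k *k (P ** (M ** Z)) + l *k (Z ** (M ** P)) + l *k
      (Z ** (M ** Z))"
    unfolding dress_def Z_def[symmetric] by (subst M) (simp add: mat_alg r)
  have 2: "(dress s (inverse s) P ** M ** dress (inverse s) s P) ** dress k l P =
     k *k (P ** (M ** P)) + l *k (Z ** (M ** Z)) + (l * (s * s)) *k (P ** (M ** Z)) + (k * (inverse s * inverse s)) *k (Z ** (M ** P))"
    using s unfolding dress_def Z_def[symmetric]
    by (simp add: mat_alg r)
  have "(k - l) *k D = ((k - l) * x) *k (P ** (M ** Z)) + ((k - l) * y) *k (Z ** (M ** P))"
    unfolding D Z_def[symmetric] by (simp add: mat_alg)
  also have "\<dots> = \<theta> *k ((dress s (inverse s) P ** M ** dress (inverse s) s P) ** dress k l P - dress k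
      l P ** M)"
    unfolding xy 1 2 by (simp add: vec_eq_iff algebra_simps)
  finally show ?thesis .
qed

text \<open>M T = 0 gives M (1 - P) T = - M P T, so both blocks of D T are expressed through M P T,
  and the ratio of y to x makes them recombine into the dressed M. This replaces
  \<open>dress_gauge\<close> at \<mu> = 0, where the gauge equation has a pole.\<close>

lemma dress_kernel:
  fixes T :: "complex^4^4"
  assumes P: "P ** P = P" and D: "D = x *k (P ** M ** (mat 1 - P)) + y *k ((mat 1 - P) ** M ** P)"
    and xy: "y = - x * (inverse s * inverse s)" and s: "s \<noteq> 0" and M: "M ** T = 0"
  shows "D ** T = (- x) *k ((dress s (inverse s) P ** M ** dress (inverse s) s P) ** (P ** T))"
proof -
  define Z where "Z = mat 1 - P"
  have Z: "Z ** Z = Z" "P ** Z = 0" "Z ** P = 0" using P by (simp_all add: Z_def mat_alg)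
  have MZ: "M ** (Z ** T) = - (M ** (P ** T))" using M by (simp add: Z_def mat_alg)
  note r = P Z MZ assoc_rule[OF P] assoc_rule[OF Z(1)] assoc_rule[OF Z(2)] assoc_rule[OF Z(3)]
  have M': "M ** (P ** T) = P ** (M ** (P ** T)) + Z ** (M ** (P ** T))" by (simp add: Z_def mat_alg)
  have "D ** T = (- x) *k (P ** (M ** (P ** T))) + (- x * (inverse s * inverse s)) *k (Z ** (M ** (P ** T)))"
    unfolding D xy Z_def[symmetric] by (simp add: mat_alg r) (simp add: vec_eq_iff)
  also have "\<dots> = (- x) *k ((dress s (inverse s) P ** M ** dress (inverse s) s P) ** (P ** T))"
    using s unfolding dress_def Z_def[symmetric] by (simp add: mat_alg r)
  finally show ?thesis .
qed

text \<open>Values of the multiplier \<open>r\<^sub>\<alpha>\<close> with \<open>a = \<alpha>\<^sup>2\<close> and \<open>b\<close> its pole: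
  \<open>s\<^sup>2 = r\<^sub>\<alpha>(0)\<close>, \<open>t\<^sup>-\<^sup>2 = r\<^sub>\<alpha>(\<infinity>)\<close> and \<open>k = r\<^sub>\<alpha>(-1)\<close>.\<close>

lemma multiplier_identities:
  fixes a b s t k :: complex
  assumes nz: "a \<noteq> 0" "b \<noteq> 0" "a \<noteq> 1" "b \<noteq> 1" "b \<noteq> -1" "s \<noteq> 0"
      "t \<noteq> 0"
    and s: "s * s = (1 - b) * a / ((1 - a) * b)" and t: "t * t = (1 - a) / (1 - b)"
    and k: "k = (1 - b) * (1 + a) / ((1 - a) * (1 + b))"
  shows "(k - 1) * (inverse b - 1) = 2 * (1 * (s * s) - k)"
    "(k - 1) * (1 - inverse a) = 2 * (k * (inverse s * inverse s) - 1)"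
    "(k - 1) * (b - 1) = 2 * (1 * (inverse t * inverse t) - k)"
    "(k - 1) * (1 - a) = 2 * (k * (t * t) - 1)"
    "(inverse t - t) * (inverse b - 1) = 1 * (t * (s * s) - inverse t)"
    "(inverse t - t) * (1 - inverse a) = 1 * (inverse t * (inverse s * inverse s) - t)"
    "1 - inverse a = - (inverse b - 1) * (inverse s * inverse s)"
proof -
  define C D E where CDE: "C = 1 - b" "D = 1 - a" "E = 1 + b"
  have d: "C \<noteq> 0" "D \<noteq> 0" "E \<noteq> 0" using nz by (auto simp: CDE add_eq_0_iff)
  note s0 = s[folded CDE] and t0 = t[folded CDE] and k0 = k[folded CDE]
  have s': "inverse s * inverse s = (D * b) / (C * a)"
    using s0 by (metis inverse_divide inverse_mult_distrib)
  have t': "inverse t * inverse t = C / D" using t0 by (metis inverse_divide inverse_mult_distrib)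
  have k1: "k - 1 = 2 * (a - b) / (D * E)"
    unfolding k0 using d by (simp add: divide_simps) (simp add: CDE algebra_simps)
  have b1: "inverse b - 1 = C / b" and a1: "1 - inverse a = - D / a" "1 - a = D" "b - 1 = - C"
    using nz by (simp_all add: CDE field_simps)
  have sk: "s * s - k = C * (a - b) / (D * E * b)"
    unfolding s0 k0 using d nz by (simp add: divide_simps) (simp add: CDE algebra_simps)
  have ks: "k * (inverse s * inverse s) - 1 = (b - a) / (E * a)"
    unfolding s' k0 using d nz by (simp add: divide_simps) (simp add: CDE algebra_simps)
  have tk: "inverse t * inverse t - k = C * (b - a) / (D * E)"
    unfolding t' k0 using d nz by (simp add: divide_simps) (simp add: CDE algebra_simps)
  have kt: "k * (t * t) - 1 = (a - b) / E"
    unfolding t0 k0 using d nz by (simp add: divide_simps) (simp add: CDE algebra_simps)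
  \<comment> \<open>\<open>inverse b - 1\<close> and \<open>1 - inverse a\<close> are the
    coefficients of the off-diagonal blocks in the (1,0)-derivative of the projection onto W;
    \<open>b - 1\<close> and \<open>1 - a\<close> are those in its (0,1)-derivative.\<close>
  show "(k - 1) * (inverse b - 1) = 2 * (1 * (s * s) - k)"
    unfolding k1 b1 mult_1 sk using nz d by simp
  show "(k - 1) * (1 - inverse a) = 2 * (k * (inverse s * inverse s) - 1)"
    unfolding ks k1 a1 using nz d by (simp add: divide_simps)
  show "(k - 1) * (b - 1) = 2 * (1 * (inverse t * inverse t) - k)"
    unfolding mult_1 tk k1 a1 using nz d by (simp add: divide_simps) (simp add: algebra_simps)
  show "(k - 1) * (1 - a) = 2 * (k * (t * t) - 1)"
    unfolding kt k1 a1 using nz d by simp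
  define w where "w = inverse t"
  have w: "inverse t = w" "t * w = 1" "w * t = 1" "t * (w * z) = z" "w * (t * z) = z" for z
    using nz by (simp_all add: w_def)
  have "(inverse t * inverse t - 1) * (inverse b - 1) = s * s - inverse t * inverse t"
    unfolding t' s0 b1 using nz d by (simp add: divide_simps) (simp add: CDE algebra_simps)
  then have "t * ((inverse t * inverse t - 1) * (inverse b - 1)) = t * (s * s - inverse t * inverse t)" by simp
  then show "(inverse t - t) * (inverse b - 1) = 1 * (t * (s * s) - inverse t)" by (simp add: w algebra_simps)
  have "(inverse t * inverse t - 1) * (1 - inverse a) = (inverse t * inverse t) * (inverse s * inverse s) - 1"
    unfolding t' s' a1 using nz d by (simp add: divide_simps) (simp add: CDE algebra_simps)
  then have "t * ((inverse t * inverse t - 1) * (1 - inverse a)) = t *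
      ((inverse t * inverse t) * (inverse s * inverse s) - 1)" by simp
  then show "(inverse t - t) * (1 - inverse a) = 1 * (inverse t * (inverse s * inverse s) - t)" by
      (simp add: w algebra_simps)
  show "1 - inverse a = - (inverse b - 1) * (inverse s * inverse s)"
    unfolding s' a1 b1 using nz d by simp
qed

text \<open>The gauge \<open>x \<Pi>\<^sub>+ + x\<^sup>-\<^sup>1 \<Pi>\<^sub>-\<close> with \<open>x\<^sup>2 = \<alpha>\<close> removes the twist from the family of
  connections: \<open>\<nabla>\<close> becomes \<open>d + (\<alpha>\<^sup>-\<^sup>2 - 1) \<Phi>' + (\<alpha>\<^sup>2 - 1) \<Phi>''\<close>.\<close>

lemma untwist:
  fixes S n m a b Sv :: "complex^4^4"
  assumes S: "S ** S = - mat 1" and n: "n ** S = - (S ** n)" and m: "m ** S = - (S ** m)"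
    and Sv: "Sv = -(2 *k (S ** n))" and a: "a ** S = S ** a" and b: "b = - (S ** a)" and x: "x \<noteq> 0"
  defines "T \<equiv> inverse x *k PiP S + x *k PiM S" and "U \<equiv> x *k PiP S + inverse x *k PiM S"
    and "\<Phi> \<equiv> (1/2) *k (n - S ** m) + a"
    and "C \<equiv> conn_matrix (x^2) n m a b"
  shows "T ** (((x - inverse x) * (- \<i> / 2)) *k Sv + C ** U)
    = (inverse ((x^2)^2) - 1) *k (\<Phi> ** PiM S) + ((x^2)^2 - 1) *k (\<Phi> ** PiP S)"
proof -
  note r = S n m a assoc_rule[OF S] assoc_rule[OF n] assoc_rule[OF m] assoc_rule[OF a]
  have x1: "x ^ 2 = x * x" "(x * x)^2 = x * x * x * x" by (simp_all add: power2_eq_square)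
  define y where "y = inverse x"
  have y: "inverse x = y" "inverse (x * x) = y * y" "inverse (x * x * x * x) = y * y * y * y" "x * y = 1"
      "y * x = 1"
    "x * (y * z) = z" "y * (x * z) = z" for z
    using x by (simp_all add: y_def)
  show ?thesis unfolding T_def U_def \<Phi>_def C_def conn_matrix_def Sv b PiP_def PiM_def x1 y
    by (simp add: mat_alg r) (simp add: vec_eq_iff algebra_simps y add_divide_distrib diff_divide_distrib)

qed

section \<open>The transformed bundles at a point\<close>

lemma subspace_alt: assumes "vec.subspace (V :: (complex^'n) set)"
  shows "0 \<in> V" "x \<in> V \<Longrightarrow> y \<in> V \<Longrightarrow> x + y \<in> V"
      "x \<in> V \<Longrightarrow> y \<in> V \<Longrightarrow> x - y \<in> V"
      "x \<in> V \<Longrightarrow> z *s x \<in> V" "x \<in> V \<Longrightarrow> - x \<in> V"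
  by (simp_all add: vec.subspace_0[OF assms] vec.subspace_add[OF assms] vec.subspace_diff[OF assms]
      vec.subspace_scale[OF assms] vec.subspace_neg[OF assms])

text \<open>l lies in S_+ and jl in S_-, and these eigenspaces meet only in 0.\<close>

lemma quaternionic_pair:
  assumes S: "S ** S = - mat 1" "jc S = S" and l: "PiP S *v l = l" "l \<noteq> 0"
  shows "PiP S *v jmap l = 0" "z *s l + w *s jmap l = 0 \<Longrightarrow> z = 0 \<and> w = 0" "l \<noteq> jmap l"
      "vec.independent {l, jmap l}"
proof -
  show jl: "PiP S *v jmap l = 0"
    using l(1) jmap_mv[of "PiP S" l] jc_Pi(1)[OF S(2)] Splus_iff[OF S(1)] by metis
  have ind: "z = 0 \<and> w = 0" if "z *s l + w *s jmap l = 0" for z w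
  proof -
    have "PiP S *v (z *s l + w *s jmap l) = z *s l" by (simp add: matrix_vector_simps l jl)
    then have "z = 0" using that l(2) by (simp add: vec.scale_eq_0_iff)
    then show ?thesis using that l(2) by (simp add: jmap_eq_0)
  qed
  show "z *s l + w *s jmap l = 0 \<Longrightarrow> z = 0 \<and> w = 0" by (rule ind)
  show ne: "l \<noteq> jmap l" using ind[of 1 "- 1"] by auto
  have "l \<notin> vec.span {jmap l}"
  proof
    assume "l \<in> vec.span {jmap l}"
    then obtain k where "l = k *s jmap l" by (auto simp: vec.span_singleton)
    then have "1 *s l + (- k) *s jmap l = 0" by simp
    then show False using ind[of 1 "- k"] by simp
  qed
  moreover have "vec.independent {jmap l}" using l(2) by (simp add: vec.dependent_single jmap_eq_0)
  ultimately show "vec.independent {l, jmap l}" using ne by (simp add: vec.independent_insert)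
qed

locale dressing_algebra =
  fixes S P :: "complex^4^4" and s :: complex
  assumes SS: "S ** S = - mat 1" and jS: "jc S = S" and PP: "P ** P = P" and jP: "jc P = mat 1 - P" and s:
      "s \<noteq> 0"
begin

text \<open>\<open>Rz\<close> and \<open>Ri\<close> are r(0) and r(\<infinity>), \<open>Rzi\<close>
  and \<open>Rii\<close> their inverses. \<open>R\<close> is r(0) on S_+ and r(\<infinity>) on S_-,
  hence conjugates S into the sphere \<open>Ss\<close> of the transform. \<open>Ps1\<close> and
  \<open>Ps2\<close> dress the (1,0)-part \<open>M ** PiM S\<close> by r(0) and the (0,1)-part
  \<open>M ** PiP S\<close> by r(\<infinity>).\<close>

definition Rz where "Rz = dress s (inverse s) P"
definition Rzi where "Rzi = dress (inverse s) s P"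
definition Ri where "Ri = dress (inverse (cnj s)) (cnj s) P"
definition Rii where "Rii = dress (cnj s) (inverse (cnj s)) P"
definition R where "R = Rz ** PiP S + Ri ** PiM S"
definition Ss where "Ss = R ** S ** matrix_inv R"
definition Ps1 where "Ps1 M = Rz ** (M ** PiM S) ** Rzi"
definition Ps2 where "Ps2 M = Ri ** (M ** PiP S) ** Rii"

lemma R_inv: "Rz ** Rzi = mat 1" "Rzi ** Rz = mat 1" "Ri ** Rii = mat 1" "Rii ** Ri = mat 1"
  using dress_inverse[OF PP s, of "inverse s"] dress_inverse[OF PP, of "cnj s" "inverse (cnj s)"] s
  by (simp_all add: Rz_def Rzi_def Ri_def Rii_def)

lemma jc_R: "jc Rz = Ri" "jc Ri = Rz" "jc Rzi = Rii" "jc Rii = Rzi" "jc R = R"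
proof -
  show "jc Rz = Ri" "jc Ri = Rz" "jc Rzi = Rii" "jc Rii = Rzi"
    by (simp_all add: Rz_def Rzi_def Ri_def Rii_def dress_def jc_simps jP complex_cnj_inverse add.commute)
  then show "jc R = R" by (simp add: R_def jc_simps jc_Pi[OF jS] add.commute)
qed

lemma jc_Ps: "jc (Ps1 M) = Ps2 (jc M)" "jc (Ps2 M) = Ps1 (jc M)"
  by (simp_all add: Ps1_def Ps2_def jc_simps jc_R jc_Pi[OF jS])

context
  assumes inv: "invertible R"
begin

lemma R_Pi: "R ** PiP S = Rz ** PiP S" "R ** PiM S = Ri ** PiM S"
  by (simp_all add: R_def mat_alg Pi_simps[OF SS])

lemma Ss_props: "Ss ** Ss = - mat 1" "jc Ss = Ss"
proof -
  note r = matrix_inv_cancel[OF inv] assoc_rule[OF matrix_inv_cancel(1)[OF inv]]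
      assoc_rule[OF matrix_inv_cancel(2)[OF inv]]
  show "Ss ** Ss = - mat 1" by (simp add: Ss_def mat_alg r SS assoc_rule[OF SS])
  show "jc Ss = Ss" by (simp add: Ss_def jc_simps jc_R jS jc_matrix_inv[OF inv])
qed

lemma Pi_Ss: "PiP Ss = R ** PiP S ** matrix_inv R" "PiM Ss = R ** PiM S ** matrix_inv R"
  by (simp_all add: PiP_def PiM_def Ss_def mat_alg matrix_inv_cancel[OF inv])

lemma Pi_Ss_R:
  "PiP Ss ** (Rz ** PiP S) = Rz ** PiP S" "PiM Ss ** (Rz ** PiP S) = 0"
  "PiP Ss ** (Ri ** PiM S) = 0" "PiM Ss ** (Ri ** PiM S) = Ri ** PiM S"
  "PiP Ss = Rz ** (PiP S ** matrix_inv R)" "PiM Ss = Ri ** (PiM S ** matrix_inv R)"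
proof -
  note r = matrix_inv_cancel[OF inv] assoc_rule[OF matrix_inv_cancel(1)[OF inv]]
      assoc_rule[OF matrix_inv_cancel(2)[OF inv]]
  show "PiP Ss ** (Rz ** PiP S) = Rz ** PiP S" "PiM Ss ** (Rz ** PiP S) = 0"
    by (simp_all add: R_Pi(1)[symmetric] Pi_Ss matrix_ring_simps r Pi_simps[OF SS]
        assoc_rule[OF Pi_simps(5)[OF SS]] assoc_rule[OF Pi_simps(8)[OF SS]])
  show "PiP Ss ** (Ri ** PiM S) = 0" "PiM Ss ** (Ri ** PiM S) = Ri ** PiM S"
    by (simp_all add: R_Pi(2)[symmetric] Pi_Ss matrix_ring_simps r Pi_simps[OF SS]
        assoc_rule[OF Pi_simps(6)[OF SS]] assoc_rule[OF Pi_simps(7)[OF SS]])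
  show "PiP Ss = Rz ** (PiP S ** matrix_inv R)" "PiM Ss = Ri ** (PiM S ** matrix_inv R)"
    unfolding Pi_Ss R_Pi by (simp_all add: matrix_ring_simps)
qed

text \<open>The eigenspace of \<open>Ss\<close> for -\<i> is r(\<infinity>) S_-, so the inverse of
  r(\<infinity>) returns it to S_-, which \<open>PiP S\<close> annihilates.\<close>

lemma Rii_PiM: "PiP S ** (Rii ** PiM Ss) = 0"
  unfolding Pi_Ss_R(6) by (simp add: assoc_rule[OF R_inv(4)] matrix_ring_simps(9)[symmetric] Pi_simps[OF SS])
    (simp add: matrix_ring_simps Pi_simps[OF SS] assoc_rule[OF R_inv(4)] assoc_rule[OF Pi_simps(7)[OF SS]])

lemma Rzi_PiP: "PiM S ** (Rzi ** PiP Ss) = 0"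
  unfolding Pi_Ss_R(5) by (simp add: matrix_ring_simps assoc_rule[OF R_inv(2)] assoc_rule[OF Pi_simps(8)[OF SS]])

text \<open>The inverse of r(0) carries the \<i>-eigenspace of \<open>Ss\<close> back to S_+, on
  which \<open>M ** PiM S\<close> vanishes; likewise for r(\<infinity>) and S_-.\<close>

lemma Ps_kernel: "Ps1 M ** PiP Ss = 0" "Ps2 M ** PiM Ss = 0" "Ps1 M ** PiM Ss = Ps1 M" "Ps2 M ** PiP Ss = Ps2 M"
proof -
  show 1: "Ps1 M ** PiP Ss = 0" "Ps2 M ** PiM Ss = 0"
    by (simp_all add: Ps1_def Ps2_def matrix_ring_simps Rzi_PiP Rii_PiM)
  have "Ps1 M = Ps1 M ** (PiP Ss + PiM Ss)" "Ps2 M = Ps2 M ** (PiP Ss + PiM Ss)" by (simp_all add: Pi_sum)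
  then show "Ps1 M ** PiM Ss = Ps1 M" "Ps2 M ** PiP Ss = Ps2 M"
    by (simp_all add: matrix_ring_simps 1)
qed

definition Lp :: "(complex^4) set \<Rightarrow> (complex^4) set" where
  "Lp L = {PiP Ss *v (Ri *v x) | x. x \<in> L \<and> PiP S *v x = x}"

definition Ls :: "(complex^4) set \<Rightarrow> (complex^4) set" where
  "Ls L = sumset (Lp L) (jmap ` Lp L)"

context
  fixes L :: "(complex^4) set"
  assumes L: "vec.subspace L" and jL: "jmap ` L = L" and SL: "\<And>x. x \<in> L \<Longrightarrow> S *v x \<in> L"
begin

lemma Pi_L: "x \<in> L \<Longrightarrow> PiP S *v x \<in> L" "x \<in> L \<Longrightarrow> PiM S *v x \<in> L"
  using SL by (auto simp: PiP_def PiM_def mscale_simps matrix_vector_simps intro!: subspace_alt[OF L])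

lemma jmap_L: "x \<in> L \<longleftrightarrow> jmap x \<in> L"
  using jL by (metis image_eqI image_iff jmap_simps(3,5) minus_minus subspace_alt(5)[OF L])

lemma mv_mm: "M *v (N *v x) = (M ** N) *v x"
  by (rule matrix_vector_mul_assoc)

lemma Lp_fix: "x \<in> Lp L \<Longrightarrow> PiP Ss *v x = x"
  by (auto simp: Lp_def mv_mm matrix_ring_simps Pi_simps[OF Ss_props(1)]
      assoc_rule[OF Pi_simps(5)[OF Ss_props(1)]])

lemma jPi_Ss: "jmap (PiP Ss *v x) = PiM Ss *v jmap x" "jmap (PiM Ss *v x) = PiP Ss *v jmap x"
  by (simp_all add: jmap_mv jc_Pi[OF Ss_props(2)])

lemma jPi_S: "jmap (PiP S *v x) = PiM S *v jmap x" "jmap (PiM S *v x) = PiP S *v jmap x"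
  by (simp_all add: jmap_mv jc_Pi[OF jS])

lemma subspace_Lp: "vec.subspace (Lp L)"
proof -
  have "0 \<in> Lp L" unfolding Lp_def using subspace_alt(1)[OF L] by (auto intro!: exI[of _ 0])
  moreover have "x + y \<in> Lp L" if xy: "x \<in> Lp L" "y \<in> Lp L" for x y
  proof -
    obtain a where "x = PiP Ss *v (Ri *v a)" "a \<in> L" "PiP S *v a = a" using xy(1) unfolding Lp_def by blast
    moreover obtain b where "y = PiP Ss *v (Ri *v b)" "b \<in> L" "PiP S *v b = b" using xy(2) unfolding Lp_def by
        blast
    ultimately show ?thesis unfolding Lp_def using subspace_alt(2)[OF L]
      by (auto simp: matrix_vector_simps intro!: exI[of _ "a + b"])
  qed
  moreover have "z *s x \<in> Lp L" if xz: "x \<in> Lp L" for x z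
  proof -
    obtain a where "x = PiP Ss *v (Ri *v a)" "a \<in> L" "PiP S *v a = a" using xz unfolding Lp_def by blast
    then show ?thesis unfolding Lp_def using subspace_alt(4)[OF L]
      by (auto simp: matrix_vector_simps intro!: exI[of _ "z *s a"])
  qed
  ultimately show ?thesis by (auto intro!: vec.subspaceI)
qed

lemma Ls_iff: "x \<in> Ls L \<longleftrightarrow> PiP Ss *v x \<in> Lp L \<and> jmap (PiM Ss *v x) \<in> Lp L"
proof
  assume "x \<in> Ls L"
  then obtain a b where ab: "a \<in> Lp L" "b \<in> Lp L" "x = a + jmap b" unfolding Ls_def sumset_def by blast
  have a: "PiP Ss *v a = a" "PiM Ss *v a = 0" and b: "PiP Ss *v b = b" "PiM Ss *v b = 0"
    using Lp_fix[OF ab(1)] Lp_fix[OF ab(2)] Pi_decomp[of Ss a] Pi_decomp[of Ss b] by auto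
  have "PiP Ss *v jmap b = 0" "PiM Ss *v jmap b = jmap b" using b jPi_Ss[of b] by (simp_all add: jmap_simps)
  then show "PiP Ss *v x \<in> Lp L \<and> jmap (PiM Ss *v x) \<in> Lp L"
    using ab a by (simp add: matrix_vector_simps jmap_simps subspace_alt(5)[OF subspace_Lp])
next
  assume h: "PiP Ss *v x \<in> Lp L \<and> jmap (PiM Ss *v x) \<in> Lp L"
  have "PiM Ss *v x = jmap (- jmap (PiM Ss *v x))" by (simp add: jmap_simps)
  moreover have "- jmap (PiM Ss *v x) \<in> Lp L" using h subspace_alt(5)[OF subspace_Lp] by simp
  ultimately show "x \<in> Ls L" using h Pi_decomp[of Ss x] unfolding Ls_def sumset_def by
      (metis (mono_tags, lifting) image_eqI mem_Collect_eq)
qed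

lemma subspace_Ls: "vec.subspace (Ls L)"
  by (rule vec.subspaceI) (auto simp: Ls_iff matrix_vector_simps jmap_simps subspace_alt[OF subspace_Lp])

lemma Lp_in_Ls: "x \<in> Lp L \<Longrightarrow> x \<in> Ls L"
  using Lp_fix[of x] Pi_decomp[of Ss x] by (simp add: Ls_iff jmap_simps subspace_alt(1)[OF subspace_Lp])

lemma jmap_Ls: "x \<in> Ls L \<Longrightarrow> jmap x \<in> Ls L"
  by (simp add: Ls_iff jPi_Ss[symmetric] jmap_simps subspace_alt(5)[OF subspace_Lp])

lemma jmap_Ls_eq: "jmap ` Ls L = Ls L"
proof (intro set_eqI iffI)
  fix x assume "x \<in> Ls L"
  then have "x = jmap (- jmap x)" "- jmap x \<in> Ls L"
    using jmap_Ls subspace_alt(5)[OF subspace_Ls] by (auto simp: jmap_simps)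
  then show "x \<in> jmap ` Ls L" by blast
qed (use jmap_Ls in auto)

lemma Pi_Ls: "x \<in> Ls L \<Longrightarrow> PiP Ss *v x \<in> Ls L"
    "x \<in> Ls L \<Longrightarrow> PiM Ss *v x \<in> Ls L"
proof -
  assume x: "x \<in> Ls L"
  show 1: "PiP Ss *v x \<in> Ls L" using x Lp_in_Ls by (simp add: Ls_iff)
  show "PiM Ss *v x \<in> Ls L" using subspace_alt(3)[OF subspace_Ls x 1] Pi_decomp[of Ss x] by
      (metis add_diff_cancel_left')
qed

lemma Ss_Ls: "x \<in> Ls L \<Longrightarrow> Ss *v x \<in> Ls L"
  by (subst Pi_reconstruct[of Ss]) (auto simp: mscale_simps matrix_vector_simps Pi_Ls intro!:
      subspace_alt[OF subspace_Ls])

lemma Ss_Ls_eq: "(\<lambda>x. Ss *v x) ` Ls L = Ls L"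
proof (intro set_eqI iffI)
  fix x assume "x \<in> Ls L"
  then have "x = Ss *v (- (Ss *v x))" "- (Ss *v x) \<in> Ls L"
    using Ss_Ls subspace_alt(5)[OF subspace_Ls] by (auto simp: matrix_vector_simps mv_mm Ss_props)
  then show "x \<in> (\<lambda>x. Ss *v x) ` Ls L" by blast
qed (use Ss_Ls in auto)

text \<open>r(\<infinity>) sends the S_- component of x to the eigenspace of \<open>Ss\<close> for
  -\<i>, where \<open>PiP Ss\<close> vanishes; so only \<open>PiP S *v x\<close> matters, and the
  map in \<open>Lp\<close> may be applied to vectors outside S_+.\<close>

lemma Ls_from_Ri: assumes "PiP S *v x \<in> L" shows "PiP Ss *v (Ri *v x) \<in> Lp L"
proof -
  have "Ri *v x = Ri *v (PiP S *v x) + (Ri ** PiM S) *v x"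
    by (metis Pi_decomp matrix_vector_simps(4) matrix_vector_mul_assoc)
  then have "PiP Ss *v (Ri *v x) = PiP Ss *v (Ri *v (PiP S *v x))"
    by (simp add: matrix_vector_simps mv_mm Pi_Ss_R(1-4))
  moreover have "PiP S *v (PiP S *v x) = PiP S *v x" by (simp add: mv_mm Pi_simps[OF SS])
  ultimately show ?thesis unfolding Lp_def using assms by auto
qed

lemma Ls_from_Rz: assumes "PiM S *v x \<in> L" shows "PiM Ss *v (Rz *v x) \<in> Ls L"
proof -
  have "PiP S *v jmap x \<in> L" using assms jmap_L jPi_S by metis
  then have "PiP Ss *v (Ri *v jmap x) \<in> Ls L" using Ls_from_Ri Lp_in_Ls by blast
  moreover have "jmap (PiM Ss *v (Rz *v x)) = PiP Ss *v (Ri *v jmap x)" by (simp add: jPi_Ss jmap_mv jc_R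
      jc_Pi[OF Ss_props(2)])
  ultimately show ?thesis
    by (metis jmap_Ls jmap_simps(5) minus_minus subspace_alt(5)[OF subspace_Ls])
qed

text \<open>The component of r(\<infinity>) l dropped by \<open>PiP Ss\<close> returns to S_- under
  the inverse of r(\<infinity>), and \<open>PiP S\<close> removes it. So \<open>Lp\<close> is a
  faithful image of L_+.\<close>

lemma Lp_inverse: assumes "PiP S *v l = l" shows "PiP S *v (Rii *v (PiP Ss *v (Ri *v l))) = l"
proof -
  have "PiP Ss *v (Ri *v l) = Ri *v l - PiM Ss *v (Ri *v l)" using Pi_decomp[of Ss "Ri *v l"] by
      (metis add_diff_cancel_right')
  then have "PiP S *v (Rii *v (PiP Ss *v (Ri *v l))) = PiP S *v l - (PiP S ** (Rii ** PiM Ss)) *v (Ri *v l)"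
    by (simp add: matrix_vector_simps) (simp add: mv_mm R_inv assoc_rule[OF R_inv(4)] matrix_ring_simps)
  then show ?thesis using assms by (simp add: Rii_PiM)
qed

lemma Lp_back: assumes "x \<in> Lp L" shows "PiP S *v (Rii *v x) \<in> L"
  using assms Lp_inverse unfolding Lp_def by auto

text \<open>\<open>Ps2 M\<close> sees only the \<i>-component, so its value at x is its value at
  r(\<infinity>) l for some l in L; there r(\<infinity>) cancels against its inverse and M meets
  \<open>PiP S *v l\<close>, again a vector of L.\<close>

lemma Ps_Ls:
  assumes "\<And>x. x \<in> L \<Longrightarrow> M *v x = 0" "x \<in> Ls L"
  shows "Ps2 M *v x = 0"
proof -
  obtain l where l: "PiP Ss *v x = PiP Ss *v (Ri *v l)" "l \<in> L"
    using assms(2) unfolding Ls_iff unfolding Lp_def by blast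
  have k: "Ps2 M *v y = Ps2 M *v (PiP Ss *v y)" for y by (simp add: mv_mm Ps_kernel)
  have "Ps2 M *v x = Ps2 M *v (Ri *v l)" using k[of x] k[of "Ri *v l"] l by simp
  also have "\<dots> = Ri *v (M *v (PiP S *v l))"
    by (simp add: Ps2_def mv_mm matrix_ring_simps R_inv)
  also have "\<dots> = 0" using assms(1) Pi_L l by simp
  finally show ?thesis .
qed

lemma Ps1_Ls:
  assumes "\<And>x. x \<in> L \<Longrightarrow> M *v x = 0" "x \<in> Ls L"
  shows "Ps1 M *v x = 0"
proof -
  have j: "jc M *v y = 0" if "y \<in> L" for y
  proof -
    have "y = jmap (- jmap y)" "- jmap y \<in> L" using that jmap_L subspace_alt(5)[OF L] by
        (auto simp: jmap_simps)
    then show ?thesis using assms(1) jmap_mv[of M "- jmap y"] by (simp add: jmap_simps)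
  qed
  have "jmap (Ps1 M *v x) = 0"
    using Ps_Ls[OF j jmap_Ls[OF assms(2)]] by (simp add: jmap_mv jc_Ps)
  then show ?thesis by (simp add: jmap_eq_0)
qed

lemma Ps1_image:
  assumes "\<And>x. PiM S *v (M ** PiM S *v x) \<in> L"
  shows "PiM Ss *v (Ps1 M *v x) \<in> Ls L"
  using Ls_from_Rz[OF assms, of "Rzi *v x"] by (simp add: Ps1_def mv_mm matrix_ring_simps)

lemma Ps2_image:
  assumes "\<And>x. PiP S *v (M ** PiP S *v x) \<in> L"
  shows "PiP Ss *v (Ps2 M *v x) \<in> Ls L"
  using Lp_in_Ls[OF Ls_from_Ri[OF assms, of "Rii *v x"]] by (simp add: Ps2_def mv_mm matrix_ring_simps)

end

end

end

section \<open>Change of charts and the operators \<open>\<partial>\<close>\<close>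

lemma linear_expand_2: "linear f \<Longrightarrow> f (u :: real^2) = u $ 1 *\<^sub>R f (axis 1 1) + u $ 2 *\<^sub>R
    f (axis 2 1)"
proof -
  assume l: "linear f"
  have "u = u $ 1 *\<^sub>R axis 1 1 + u $ 2 *\<^sub>R axis 2 1" by (simp add: vec_eq_iff forall_2 axis_def)
  then have "f u = f (u $ 1 *\<^sub>R axis 1 1 + u $ 2 *\<^sub>R axis 2 1)" by (rule arg_cong)
  then show ?thesis by (simp only: linear_add[OF l] linear_cmul[OF l])
qed

lemma Ck_on_compose:
  fixes g :: "real^2 \<Rightarrow> real^2" and f :: "real^2 \<Rightarrow> 'e::real_normed_vector"
  assumes D: "open D" and E: "open E" and gE: "\<And>x. x \<in> D \<Longrightarrow> g x \<in> E" and g: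
      "\<And>k. Ck_on k D g"
    and "Ck_on k E f"
  shows "Ck_on k D (\<lambda>x. f (g x))"
  using assms(5)
proof (induction k arbitrary: f)
  case 0
  then show ?case using continuous_on_compose2[of E f D g] gE g[of 0] by auto
next
  case (Suc k)
  have gd: "(g has_derivative frechet_derivative g (at x)) (at x)" if "x \<in> D" for x
    using g[of 1] D that by (simp add: differentiable_on_eq_differentiable_at frechet_derivative_works)
  have fd: "(f has_derivative frechet_derivative f (at y)) (at y)" if "y \<in> E" for y
    using Suc.prems E that by (simp add: differentiable_on_eq_differentiable_at frechet_derivative_works)
  have h: "((\<lambda>x. f (g x)) has_derivative (\<lambda>v. frechet_derivative f (at (g x))
      (frechet_derivative g (at x) v))) (at x)"
    if "x \<in> D" for x
    by (rule has_derivative_compose[OF gd[OF that] fd[OF gE[OF that]]])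
  have expand: "frechet_derivative f (at (g x)) u = u $ 1 *\<^sub>R frechet_derivative f (at (g x)) (axis 1 1)
      + u $ 2 *\<^sub>R frechet_derivative f (at (g x)) (axis 2 1)" if "x \<in> D" for x u
    by (rule linear_expand_2) (use fd[OF gE[OF that]] has_derivative_linear in blast)
  have gv: "Ck_on k D (\<lambda>x. frechet_derivative g (at x) v)" for v using g[of "Suc k"] by simp
  have gi: "Ck_on k D (\<lambda>x. frechet_derivative g (at x) v $ i)" for v i
    by (rule Ck_on_linear[OF bounded_linear_vec_nth D gv])
  have fi: "Ck_on k D (\<lambda>x. frechet_derivative f (at (g x)) u)" for u
    by (rule Suc.IH[of "\<lambda>y. frechet_derivative f (at y) u"]) (use Suc.prems in simp)
  have "Ck_on k D (\<lambda>x. frechet_derivative (\<lambda>x. f (g x)) (at x) v)" for v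
    by (rule Ck_on_cong_imp[OF D _ Ck_on_add[OF D Ck_on_bilinear[OF bounded_bilinear_scaleR D gi fi]
           Ck_on_bilinear[OF bounded_bilinear_scaleR D gi fi]]])
      (subst frechet_derivative_at[OF h, symmetric], assumption, rule expand[symmetric], assumption)
  moreover have "(\<lambda>x. f (g x)) differentiable_on D"
    using h D by (auto simp: differentiable_on_eq_differentiable_at differentiable_def)
  ultimately show ?case by simp
qed

context surface begin

text \<open>Sections such as dS(w) l with a fixed coordinate vector w are a priori smooth in one
  chart only, whereas \<open>local_sec\<close> asks for smoothness in every chart of the
  atlas.\<close>

lemma sm_all_charts:
  assumes f: "sm {c} N f" and N: "N \<subseteq> dom_ch c"
  shows "sm A N f"
proof (rule smI)
  have c: "c \<in> A" using smD(1)[OF f] by simp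
  fix c' k assume c': "c' \<in> A" and o: "open (coord c' ` (dom_ch c' \<inter> N))"
  have sc: "sm {c'} (dom_ch c' \<inter> N) (coord c)"
    by (rule sm_subset[OF sm_coord[OF c' c]]) (use N chart_facts(1)[OF c'] sm_open[OF f] in
        \<open>auto intro: openin_Int\<close>)
  have "Ck_on k (coord c' ` (dom_ch c' \<inter> N)) (\<lambda>y. in_chart c f (in_chart c' (coord c) y))"
  proof (rule Ck_on_compose[OF o smD(3)[OF f]])
    show "in_chart c' (coord c) y \<in> coord c ` (dom_ch c \<inter> N)" if
        "y \<in> coord c' ` (dom_ch c' \<inter> N)" for y
      using that N by (auto simp: in_chart_coord[OF c'])
    show "Ck_on k (coord c' ` (dom_ch c' \<inter> N)) (in_chart c' (coord c))" for k
      using smD(4)[OF sc, of c'] by (simp add: Int_absorb1 inf.assoc[symmetric])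
  qed (use smD(4)[OF f] in auto)
  then show "Ck_on k (coord c' ` (dom_ch c' \<inter> N)) (in_chart c' f)"
  proof (rule Ck_on_cong_imp[OF o, rotated])
    fix y assume "y \<in> coord c' ` (dom_ch c' \<inter> N)"
    then obtain x where x: "y = coord c' x" "x \<in> dom_ch c'" "x \<in> N" by blast
    then show "in_chart c f (in_chart c' (coord c) y) = in_chart c' f y"
      using N by (simp add: in_chart_coord c c' subsetD)
  qed
qed (use sm_open[OF f] in auto)

lemma sm_nonzero_open:
  fixes f :: "'m \<Rightarrow> 'e::real_normed_vector"
  assumes f: "sm A N f" shows "openin X {x \<in> N. f x \<noteq> 0}"
proof (subst openin_subopen, intro ballI)
  fix p assume p: "p \<in> {x \<in> N. f x \<noteq> 0}"
  have N: "openin X N" using f by (simp add: sm_def)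
  have "p \<in> topspace X" using p openin_subset[OF N] by blast
  then obtain c where c: "c \<in> A" "p \<in> dom_ch c" using chart_at by blast
  define V where "V = {y \<in> coord c ` (dom_ch c \<inter> N). in_chart c f y \<in> - {0}}"
  have co: "continuous_on (coord c ` (dom_ch c \<inter> N)) (in_chart c f)"
    using smD(4)[OF f c(1), of 0] by simp
  have "open V" unfolding V_def
    using continuous_open_preimage[OF co open_image_chart[OF c(1) N], of "- {0}"] open_Compl[OF closed_singleton,
        of 0]
    by (simp add: vimage_def Int_def)
  then have "openin (subtopology euclidean (coord c ` dom_ch c)) (coord c ` dom_ch c \<inter> V)" by
      (metis openin_open)
  then have "openin (subtopology X (dom_ch c)) {x \<in> topspace (subtopology X (dom_ch c)). coord c x \<in> coord
      c ` dom_ch c \<inter> V}"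
    using homeomorphic_imp_continuous_map[OF chart_facts(4)[OF c(1)]] openin_continuous_map_preimage by blast
  then have "openin X {x \<in> topspace (subtopology X (dom_ch c)). coord c x \<in> coord c ` dom_ch c \<inter> V}"
    using chart_facts(1)[OF c(1)] openin_trans_full by blast
  moreover have "{x \<in> topspace (subtopology X (dom_ch c)). coord c x \<in> coord c ` dom_ch c \<inter> V} = {x
      \<in> dom_ch c \<inter> N. f x \<noteq> 0}"
  proof (intro set_eqI iffI)
    fix x assume x: "x \<in> {x \<in> topspace (subtopology X (dom_ch c)). coord c x \<in> coord c ` dom_ch c
        \<inter> V}"
    then have 1: "x \<in> dom_ch c" "coord c x \<in> V" by auto
    then obtain x' where x': "coord c x = coord c x'" "x' \<in> dom_ch c" "x' \<in> N" unfolding V_def by blast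
    then have "x = x'" using chart_facts(3)[OF c(1)] 1 by (meson inj_onD)
    then show "x \<in> {x \<in> dom_ch c \<inter> N. f x \<noteq> 0}" using 1 x' by
        (simp add: V_def in_chart_coord[OF c(1)])
  next
    fix x assume "x \<in> {x \<in> dom_ch c \<inter> N. f x \<noteq> 0}"
    then show "x \<in> {x \<in> topspace (subtopology X (dom_ch c)). coord c x \<in> coord c ` dom_ch c \<inter>
        V}"
      using chart_subset[OF c(1)] by (auto simp: V_def in_chart_coord[OF c(1)])
  qed
  ultimately show "\<exists>T. openin X T \<and> p \<in> T \<and> T \<subseteq> {x \<in> N. f x \<noteq> 0}" using
      p c by (intro exI[of _ "{x \<in> dom_ch c \<inter> N. f x \<noteq> 0}"]) auto
qed

end

section \<open>The complex structure, smooth forms and derivatives of type (1,0) and (0,1)\<close>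

locale conformal_surface = surface X A for X :: "'m topology" and A :: "'m chart set" +
  fixes J :: "('m, real^2) form"
  assumes cs: "complex_structure A J"
begin

lemma J_facts:
  assumes "c \<in> A" "p \<in> dom_ch c"
  shows "linear (J c p)" "J c p (J c p v) = - v"
      "v \<noteq> 0 \<Longrightarrow> det (vector [v, J c p v] :: real^2^2) > 0"
  using cs assms unfolding complex_structure_def by blast+

lemma sm_J: assumes "c \<in> A" shows "sm {c} (dom_ch c) (\<lambda>p. J c p v)"
proof -
  have "smooth_on (coord c ` dom_ch c) (in_chart c (\<lambda>p. J c p v))"
    using cs assms unfolding complex_structure_def by blast
  then show ?thesis using assms chart_facts(1)[OF assms] by (simp add: sm_def smooth_map_def)
qed

lemma J_change: assumes "c \<in> A" "c' \<in> A" "p \<in> dom_ch c" "p \<in> dom_ch c'"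
  shows "dd c (coord c') p (J c p v) = J c' p (dd c (coord c') p v)"
  using cs assms unfolding complex_structure_def by blast

lemma span_J:
  assumes "c \<in> A" "p \<in> dom_ch c" "v \<noteq> 0"
  shows "\<exists>\<alpha> \<beta>. w = \<alpha> *\<^sub>R v + \<beta> *\<^sub>R J c p v"
proof -
  define d where "d = v $ 1 * J c p v $ 2 - v $ 2 * J c p v $ 1"
  have d: "d > 0" using J_facts(3)[OF assms] by (simp add: det_2 vector_def d_def)
  define u where "u = J c p v"
  \<comment> \<open>Cramer's rule for the coefficients in the basis v, J v, whose determinant d is
    positive.\<close>
  have "w = ((w $ 1 * u $ 2 - w $ 2 * u $ 1) / d) *\<^sub>R v + ((v $ 1 * w $ 2 - v $ 2 * w $ 1) / d) *\<^sub>R u"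
    using d by (simp add: vec_eq_iff forall_2 divide_simps) (simp add: d_def u_def algebra_simps)
  then show ?thesis unfolding u_def by blast
qed

text \<open>v and J v span the plane for v \<noteq> 0, so on a surface an alternating form is
  determined by its values on the pairs (v, J v).\<close>

lemma two_form_eq_0:
  fixes F :: "real^2 \<Rightarrow> real^2 \<Rightarrow> 'e::real_vector"
  assumes c: "c \<in> A" "p \<in> dom_ch c" and lin: "\<And>v. linear (F v)" and alt: "\<And>v w. F w v = - F v w"
    and 0: "\<And>v. F v (J c p v) = 0"
  shows "F v w = 0"
proof (cases "v = 0")
  case True
  have "F w 0 = 0" using lin linear_0 by blast
  then show ?thesis using alt[of 0 w] True by simp
next
  case False
  then obtain \<alpha> \<beta> where w: "w = \<alpha> *\<^sub>R v + \<beta> *\<^sub>R J c p v" using span_J[OF c]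
      by blast
  have "F v v = - F v v" by (rule alt)
  then have "F v v = 0" by (simp add: eq_neg_iff_add_eq_0 scaleR_2[symmetric])
  then show ?thesis using lin[of v] 0[of v] by (simp add: w linear_add linear_cmul)
qed

definition smooth_form :: "'m chart \<Rightarrow> ('m, 'e::euclidean_space) form \<Rightarrow> bool" where
  "smooth_form c e \<longleftrightarrow> c \<in> A \<and> (\<forall>p\<in>dom_ch c. linear (e c p)) \<and>
      (\<forall>v. sm {c} (dom_ch c) (\<lambda>p. e c p v))"

lemma smooth_formD: "smooth_form c e \<Longrightarrow> sm {c} (dom_ch c) (\<lambda>p. e c p v)"
  "smooth_form c e \<Longrightarrow> p \<in> dom_ch c \<Longrightarrow> linear (e c p)"
  by (auto simp: smooth_form_def)

lemma smooth_form_J: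
  assumes e: "smooth_form c e" shows "smooth_form c (\<lambda>c p v. e c p (J c p v))"
proof -
  have c: "c \<in> A" using e by (simp add: smooth_form_def)
  have "sm {c} (dom_ch c) (\<lambda>p. e c p (J c p v))" for v
    by (rule sm_cong[rotated, OF sm_add[OF sm_scaleR[OF sm_nth[OF sm_J[OF c]] smooth_formD(1)[OF e]]
           sm_scaleR[OF sm_nth[OF sm_J[OF c]] smooth_formD(1)[OF e]]]])
      (rule linear_expand_2[OF smooth_formD(2)[OF e], symmetric])
  moreover have "linear (\<lambda>v. e c p (J c p v))" if "p \<in> dom_ch c" for p
    using linear_compose[OF J_facts(1)[OF c that] smooth_formD(2)[OF e that]] by (simp add: comp_def)
  ultimately show ?thesis using c by (simp add: smooth_form_def)
qed

text \<open>For a fixed coordinate vector w the field J w still varies with the point, because J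
  does; the second term is its derivative.\<close>

lemma dd_form_J:
  assumes e: "smooth_form c e" and p: "p \<in> dom_ch c"
  shows "dd c (\<lambda>x. e c x (J c x w)) p v = dd c (\<lambda>x. e c x (J c p w)) p v + e c p
      (dd c (\<lambda>x. J c x w) p v)"
proof -
  have c: "c \<in> A" using e by (simp add: smooth_form_def)
  note sJ = sm_nth[OF sm_J[OF c]] and se = smooth_formD(1)[OF e]
  have cp: "c \<in> {c}" by simp
  have nth: "dd c (\<lambda>x. J c x w $ i) p v = dd c (\<lambda>x. J c x w) p v $ i" for i
    by (rule dd_linear[OF bounded_linear_vec_nth sm_J[OF c] cp p p])
  have *: "dd c (\<lambda>x. e c x (J c x w)) p v = dd c (\<lambda>x. J c x w $ 1 *\<^sub>R e c x (axis 1 1) + J c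
      x w $ 2 *\<^sub>R e c x (axis 2 1)) p v"
    by (rule dd_cong[OF c chart_facts(1)[OF c] p p]) (rule linear_expand_2[OF smooth_formD(2)[OF e]])
  have **: "dd c (\<lambda>x. e c x u) p v = u $ 1 *\<^sub>R dd c (\<lambda>x. e c x (axis 1 1)) p v + u $ 2
      *\<^sub>R dd c (\<lambda>x. e c x (axis 2 1)) p v" for u
  proof -
    have "dd c (\<lambda>x. e c x u) p v = dd c (\<lambda>x. u $ 1 *\<^sub>R e c x (axis 1 1) + u $ 2 *\<^sub>R e c
        x (axis 2 1)) p v"
      by (rule dd_cong[OF c chart_facts(1)[OF c] p p]) (rule linear_expand_2[OF smooth_formD(2)[OF e]])
    also have "\<dots> = dd c (\<lambda>x. u $ 1 *\<^sub>R e c x (axis 1 1)) p v + dd c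
        (\<lambda>x. u $ 2 *\<^sub>R e c x (axis 2 1)) p v"
      by (rule dd_add[OF sm_linear[OF bounded_linear_scaleR_right se] sm_linear[OF bounded_linear_scaleR_right se]
          cp p p])
    finally show ?thesis by (simp add: dd_linear[OF bounded_linear_scaleR_right se cp p p])
  qed
  show ?thesis unfolding * dd_add[OF sm_scaleR[OF sJ se] sm_scaleR[OF sJ se] cp p p]
      dd_bilinear[OF bounded_bilinear_scaleR sJ se cp p p] nth **[of "J c p w"]
    by (subst (3) linear_expand_2[OF smooth_formD(2)[OF e p]]) simp
qed

lemma linear_dd_form:
  assumes e: "smooth_form c e" and p: "p \<in> dom_ch c"
  shows "linear (\<lambda>w. dd c (\<lambda>x. e c x w) p v)"
proof (rule linearI)
  have c: "c \<in> A" using e by (simp add: smooth_form_def)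
  note se = smooth_formD(1)[OF e]
  have cp: "c \<in> {c}" by simp
  show "dd c (\<lambda>x. e c x (u + w)) p v = dd c (\<lambda>x. e c x u) p v + dd c (\<lambda>x. e c x w) p v" for
      u w
    unfolding dd_add[OF se se cp p p, symmetric]
    by (rule dd_cong[OF c chart_facts(1)[OF c] p p]) (use smooth_formD(2)[OF e] linear_add in blast)
  show "dd c (\<lambda>x. e c x (r *\<^sub>R u)) p v = r *\<^sub>R dd c (\<lambda>x. e c x u) p v" for r u
    unfolding dd_linear[OF bounded_linear_scaleR_right se cp p p, symmetric]
    by (rule dd_cong[OF c chart_facts(1)[OF c] p p]) (use smooth_formD(2)[OF e] linear_cmul in blast)
qed

definition del :: "'m chart \<Rightarrow> ('m \<Rightarrow> complex^4^4) \<Rightarrow> 'm \<Rightarrow> real^2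
    \<Rightarrow> complex^4^4" where
  "del c f p v = (1/2) *k (dd c f p v - \<i> *k dd c f p (J c p v))"

definition delb :: "'m chart \<Rightarrow> ('m \<Rightarrow> complex^4^4) \<Rightarrow> 'm \<Rightarrow> real^2
    \<Rightarrow> complex^4^4" where
  "delb c f p v = (1/2) *k (dd c f p v + \<i> *k dd c f p (J c p v))"

definition vdel :: "'m chart \<Rightarrow> ('m \<Rightarrow> complex^4) \<Rightarrow> 'm \<Rightarrow> real^2
    \<Rightarrow> complex^4" where
  "vdel c f p v = (1/2) *s (dd c f p v - \<i> *s dd c f p (J c p v))"

definition vdelb :: "'m chart \<Rightarrow> ('m \<Rightarrow> complex^4) \<Rightarrow> 'm \<Rightarrow> real^2
    \<Rightarrow> complex^4" where
  "vdelb c f p v = (1/2) *s (dd c f p v + \<i> *s dd c f p (J c p v))"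

lemma dd_del: "dd c f p v = del c f p v + delb c f p v"
  by (simp add: del_def delb_def vec_eq_iff field_simps)

lemma del_mult:
  assumes "sm B N f" "sm B N g" "c \<in> B" "p \<in> N" "p \<in> dom_ch c"
  shows "del c (\<lambda>x. f x ** g x) p v = del c f p v ** g p + f p ** del c g p v"
    "delb c (\<lambda>x. f x ** g x) p v = delb c f p v ** g p + f p ** delb c g p v"
  unfolding del_def delb_def dd_bilinear[OF bb_mm assms]
  by (simp_all add: mat_alg)

lemma vdel_mult:
  assumes "sm B N f" "sm B N g" "c \<in> B" "p \<in> N" "p \<in> dom_ch c"
  shows "vdel c (\<lambda>x. f x *v g x) p v = del c f p v *v g p + f p *v vdel c g p v"
    "vdelb c (\<lambda>x. f x *v g x) p v = delb c f p v *v g p + f p *v vdelb c g p v"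
  unfolding del_def vdel_def delb_def vdelb_def dd_bilinear[OF bb_mv assms]
  by (simp_all add: mscale_simps matrix_vector_simps)

lemma del_const: "del c (\<lambda>x. k) p v = 0" "delb c (\<lambda>x. k) p v = 0"
  by (simp_all add: del_def delb_def dd_const mscale_simps)

lemma bl_mscale: "bounded_linear (\<lambda>x::complex^4^4. z *k x)"
  using bounded_bilinear.bounded_linear_right[OF bb_ks] .

lemma del_scale:
  assumes "sm B N f" "c \<in> B" "p \<in> N" "p \<in> dom_ch c"
  shows "del c (\<lambda>x. z *k f x) p v = z *k del c f p v"
      "delb c (\<lambda>x. z *k f x) p v = z *k delb c f p v"
  unfolding del_def delb_def dd_linear[OF bl_mscale assms]
  by (simp_all add: vec_eq_iff algebra_simps)

lemma del_add:
  assumes "sm B N f" "sm B N g" "c \<in> B" "p \<in> N" "p \<in> dom_ch c"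
  shows "del c (\<lambda>x. f x + g x) p v = del c f p v + del c g p v"
      "delb c (\<lambda>x. f x + g x) p v = delb c f p v + delb c g p v"
   "del c (\<lambda>x. f x - g x) p v = del c f p v - del c g p v"
       "delb c (\<lambda>x. f x - g x) p v = delb c f p v - delb c g p v"
  unfolding del_def delb_def dd_add[OF assms] dd_diff[OF assms]
  by (simp_all add: vec_eq_iff algebra_simps)

end

section \<open>The curvature equation\<close>

context conformal_surface begin

text \<open>-1/2 times the curvature of the connection d - 2e, evaluated on constant coordinate
  fields.\<close>

definition curv :: "('m, complex^4^4) form \<Rightarrow> 'm chart \<Rightarrow> 'm \<Rightarrow> real^2
    \<Rightarrow> real^2 \<Rightarrow> complex^4^4" where
  "curv e c p v w = dd c (\<lambda>x. e c x w) p v - dd c (\<lambda>x. e c x v) p w - 2 *k comm (e c p v)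
      (e c p w)"

text \<open>The assumption on dr says that r intertwines d - 2\<Phi> with d - 2\<Psi>.
  Differentiated once more and antisymmetrised, it loses the second derivatives of r and leaves the
  two curvatures.\<close>

lemma gauge_curvature:
  assumes \<Phi>: "smooth_form c \<Phi>" and \<Psi>: "smooth_form c \<Psi>" and r: "sm {c} (dom_ch c) r" and p:
      "p \<in> dom_ch c"
    and dr: "\<And>x v. x \<in> dom_ch c \<Longrightarrow> dd c r x v = 2 *k (\<Psi> c x v ** r x - r x ** \<Phi> c
        x v)"
  shows "curv \<Psi> c p v w ** r p = r p ** curv \<Phi> c p v w"
proof -
  have c: "c \<in> A" "c \<in> {c}" using \<Phi> by (simp_all add: smooth_form_def)
  note s\<Phi> = smooth_formD(1)[OF \<Phi>] and s\<Psi> = smooth_formD(1)[OF \<Psi>] and bl = bl_mscale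
  note s1 = sm_bilinear[OF bb_mm s\<Psi> r] and s2 = sm_bilinear[OF bb_mm r s\<Phi>]
  have d: "dd c (\<lambda>x. dd c r x w) p v = 2 *k ((\<Psi> c p w ** dd c r p v + dd c (\<lambda>x. \<Psi> c x w) p v ** r p)
      - (r p ** dd c (\<lambda>x. \<Phi> c x w) p v + dd c r p v ** \<Phi> c p w))" for v w
  proof -
    have "dd c (\<lambda>x. dd c r x w) p v = dd c (\<lambda>x. 2 *k (\<Psi> c x w ** r x - r x ** \<Phi> c x w)) p
        v"
      by (rule dd_cong[OF c(1) chart_facts(1)[OF c(1)] p p]) (rule dr)
    also have "\<dots> = 2 *k dd c (\<lambda>x. \<Psi> c x w ** r x - r x ** \<Phi> c x w) p v"
      by (rule dd_linear[OF bl sm_diff[OF s1 s2] c(2) p p])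
    finally show ?thesis
      unfolding dd_diff[OF s1 s2 c(2) p p] dd_bilinear[OF bb_mm s\<Psi> r c(2) p p] dd_bilinear[OF bb_mm r s\<Phi>
          c(2) p p] .
  qed
  have "dd c (\<lambda>x. dd c r x w) p v - dd c (\<lambda>x. dd c r x v) p w = 0"
    using dd_symmetric[OF r p p, of w v] by simp
  then have "2 *k (curv \<Psi> c p v w ** r p) = 2 *k (r p ** curv \<Phi> c p v w)"
    unfolding d unfolding dr[OF p] curv_def
    by (simp add: mat_alg) (simp add: vec_eq_iff algebra_simps)
  then show ?thesis by (simp add: vec_eq_iff)
qed

definition Phi :: "('m \<Rightarrow> complex^4^4) \<Rightarrow> ('m, complex^4^4) form \<Rightarrow>
    ('m, complex^4^4) form" where
  "Phi S q c p v = (1/2) *k (NS S c p v - S p ** NS S c p (J c p v)) + q c p v"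

end

text \<open>Isolates what the curvature equation uses of S and q, with no surface L in sight; it is
  instantiated with the given pair and with the transformed pair.\<close>

locale sphere_form = conformal_surface X A J for X :: "'m topology" and A :: "'m chart set" and J ::
    "('m, real^2) form" +
  fixes S :: "'m \<Rightarrow> complex^4^4" and q :: "('m, complex^4^4) form"
  assumes sS: "sm A (topspace X) S" and SS: "\<And>p. p \<in> topspace X \<Longrightarrow> S p ** S p = - mat 1"
    and q: "\<And>c. c \<in> A \<Longrightarrow> smooth_form c q"
    and qS: "\<And>c p v. c \<in> A \<Longrightarrow> p \<in> dom_ch c \<Longrightarrow> q c p v ** S p = S p ** q
        c p v"
    and qJ: "\<And>c p v. c \<in> A \<Longrightarrow> p \<in> dom_ch c \<Longrightarrow> q c p (J c p v) = -
        (S p ** q c p v)"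
begin

lemma in_top: "c \<in> A \<Longrightarrow> p \<in> dom_ch c \<Longrightarrow> p \<in> topspace X"
  using chart_subset by blast

lemma sS_chart: "c \<in> A \<Longrightarrow> sm {c} (dom_ch c) S"
  by (rule sm_subset[OF sS]) (auto simp: chart_facts in_top)

lemma SS_chart: "c \<in> A \<Longrightarrow> p \<in> dom_ch c \<Longrightarrow> S p ** S p = - mat 1"
  using SS in_top by blast

lemma dS_anti:
  assumes c: "c \<in> A" "p \<in> dom_ch c"
  shows "dd c S p v ** S p = - (S p ** dd c S p v)"
proof -
  have "dd c (\<lambda>x. S x ** S x) p v = dd c (\<lambda>x. - mat 1) p v"
    by (rule dd_cong[OF c(1) chart_facts(1)[OF c(1)] c(2) c(2)]) (rule SS_chart[OF c(1)])
  then have "S p ** dd c S p v + dd c S p v ** S p = 0"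
    using dd_bilinear[OF bb_mm sS_chart[OF c(1)] sS_chart[OF c(1)] _ c(2) c(2), of v]
        dd_const[of c "- mat 1 :: complex^4^4" p v] by simp
  then show ?thesis by (simp add: add_eq_0_iff)
qed

lemma NS_facts:
  assumes c: "c \<in> A" "p \<in> dom_ch c"
  shows "NS S c p v ** S p = - (S p ** NS S c p v)" "dd c S p v = - (2 *k (S p ** NS S c p v))"
  using dS_anti[OF c, of v] SS_chart[OF c]
  by (simp_all add: NS_def scaleR_mscale mat_alg assoc_rule[OF SS_chart[OF c]])

lemma form_dS: assumes c: "c \<in> A" shows "smooth_form c (\<lambda>c p v. dd c S p v)"
  unfolding smooth_form_def
  using c sm_dd[OF sS_chart[OF c]] dd_lin[OF sS_chart[OF c]] by auto

lemma form_mult: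
  fixes f :: "'m \<Rightarrow> complex^4^4" and e :: "('m, complex^4^4) form"
  assumes "sm {c} (dom_ch c) f" "smooth_form c e"
  shows "smooth_form c (\<lambda>c p v. f p ** e c p v)" "smooth_form c (\<lambda>c p v. e c p v ** f p)"
proof -
  have l: "linear (\<lambda>v. M ** g v)" "linear (\<lambda>v. g v ** M)" if "linear g" for M :: "complex^4^4" and
      g :: "real^2 \<Rightarrow> complex^4^4"
    using that unfolding linear_iff by (simp_all add: matrix_ring_simps scaleR_mscale mscale_simps)
  have c: "c \<in> A" using assms(2) by (simp add: smooth_form_def)
  show "smooth_form c (\<lambda>c p v. f p ** e c p v)" "smooth_form c (\<lambda>c p v. e c p v ** f p)"
    using c smooth_formD(2)[OF assms(2)] sm_bilinear[OF bb_mm assms(1) smooth_formD(1)[OF assms(2)]]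
      sm_bilinear[OF bb_mm smooth_formD(1)[OF assms(2)] assms(1)]
    by (simp_all add: smooth_form_def l)
qed

lemma form_add:
  assumes "smooth_form c (e :: ('m, complex^4^4) form)" "smooth_form c e'"
  shows "smooth_form c (\<lambda>c p v. e c p v + e' c p v)" "smooth_form c (\<lambda>c p v. e c p v - e' c p v)"
      "smooth_form c (\<lambda>c p v. z *k e c p v)"
proof -
  have l: "linear (\<lambda>v. g v + h v)" "linear (\<lambda>v. g v - h v)" "linear (\<lambda>v. z *k g v)" if
      "linear g" "linear h" for g h :: "real^2 \<Rightarrow> complex^4^4"
    using that unfolding linear_iff by (simp_all add: scaleR_mscale mscale_simps mult.commute)
  show "smooth_form c (\<lambda>c p v. e c p v + e' c p v)" "smooth_form c (\<lambda>c p v. e c p v - e' c p v)"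
      "smooth_form c (\<lambda>c p v. z *k e c p v)"
    using assms l unfolding smooth_form_def by (auto intro!: sm_add sm_diff sm_linear[OF bl_mscale])
qed

lemma form_NS: assumes c: "c \<in> A" shows "smooth_form c (NS S)"
proof -
  have "NS S = (\<lambda>c p v. (1/2) *k (S p ** dd c S p v))" by (simp add: fun_eq_iff NS_def scaleR_mscale)
  then show ?thesis using form_add(3)[OF form_mult(1)[OF sS_chart[OF c] form_dS[OF c]] form_dS[OF c]] by simp
qed

lemma form_star: assumes c: "c \<in> A" shows "smooth_form c (star J (NS S))"
proof -
  have "star J (NS S) = (\<lambda>c p v. (-1) *k NS S c p (J c p v))" by (simp add: fun_eq_iff star_def vec_eq_iff)
  then show ?thesis using form_add(3)[OF smooth_form_J[OF form_NS[OF c]] form_NS[OF c]] by simp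
qed

lemma Phi_star: "Phi S q = (\<lambda>c p v. (1/2) *k (NS S c p v + S p ** star J (NS S) c p v) + q c p v)"
  by (simp add: fun_eq_iff Phi_def star_def matrix_ring_simps)

lemma form_Phi: assumes c: "c \<in> A" shows "smooth_form c (Phi S q)"
  unfolding Phi_star
  by (rule form_add(1)[OF form_add(3)[OF form_add(1)[OF form_NS[OF c] form_mult(1)[OF sS_chart[OF c]
      form_star[OF c]]] form_NS[OF c]] q[OF c]])

lemma dd_NS:
  assumes c: "c \<in> A" "p \<in> dom_ch c"
  shows "dd c (\<lambda>x. NS S c x w) p v = (1/2) *k (S p ** dd c (\<lambda>x. dd c S x w) p v + dd c S p v ** dd
      c S p w)"
proof -
  note s = sS_chart[OF c(1)] smooth_formD(1)[OF form_dS[OF c(1)]]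
  have e: "(\<lambda>x. NS S c x w) = (\<lambda>x. (1/2) *k (S x ** dd c S x w))" by
      (simp add: fun_eq_iff NS_def scaleR_mscale)
  show ?thesis unfolding e dd_linear[OF bl_mscale sm_bilinear[OF bb_mm s] insertI1 c(2) c(2)]
    using dd_bilinear[OF bb_mm s insertI1 c(2) c(2)] by simp
qed

lemma dd_Phi:
  assumes c: "c \<in> A" "p \<in> dom_ch c"
  shows "dd c (\<lambda>x. Phi S q c x w) p v = (1/2) *k (dd c (\<lambda>x. NS S c x w) p v + (S p ** dd c (\<lambda>x. star J (NS S) c x w) p v
     + dd c S p v ** star J (NS S) c p w)) + dd c (\<lambda>x. q c x w) p v"
proof -
  note s = sS_chart[OF c(1)] and N = smooth_formD(1)[OF form_NS[OF c(1)]] and st =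
      smooth_formD(1)[OF form_star[OF c(1)]]
    and sq = smooth_formD(1)[OF q[OF c(1)]]
  note p = insertI1 c(2) c(2)
  note m = sm_bilinear[OF bb_mm s st]
  note a = sm_add[OF N m]
  show ?thesis unfolding Phi_star dd_add[OF sm_linear[OF bl_mscale a] sq p] dd_linear[OF bl_mscale a p]
      dd_add[OF N m p]
    dd_bilinear[OF bb_mm s st p] ..
qed

lemma Phi_alt:
  assumes c: "c \<in> A" "p \<in> dom_ch c"
  shows "Phi S q c p v = (1/4) *k (S p ** dd c S p v + dd c S p (J c p v)) + q c p v"
  by (simp add: Phi_def NS_def scaleR_mscale mat_alg SS_chart[OF c] assoc_rule[OF SS_chart[OF c]])

lemma Phi_J:
  assumes c: "c \<in> A" "p \<in> dom_ch c"
  shows "Phi S q c p (J c p v) = - (Phi S q c p v ** S p)"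
proof -
  have "dd c S p (J c p (J c p v)) = - dd c S p v"
    using smooth_formD(2)[OF form_dS[OF c(1)] c(2)] by (simp add: J_facts(2)[OF c] linear_neg)
  then show ?thesis
    unfolding Phi_alt[OF c]
    by (simp add: mat_alg dS_anti[OF c] assoc_rule[OF dS_anti[OF c]] qJ[OF c] qS[OF c] SS_chart[OF c]
        assoc_rule[OF SS_chart[OF c]])
qed

text \<open>\<open>PiM\<close> and \<open>PiP\<close> diagonalise right multiplication by S, so by
  \<open>Phi_J\<close> they split \<Phi> by type: multiplied by \<open>PiM\<close> from the right it
  becomes the (1,0)-part \<Phi>', by \<open>PiP\<close> the (0,1)-part \<Phi>''.\<close>

lemma Phi_type:
  assumes c: "c \<in> A" "p \<in> dom_ch c"
  shows "Phi S q c p (J c p v) ** PiM (S p) = \<i> *k (Phi S q c p v ** PiM (S p))"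
    "Phi S q c p (J c p v) ** PiP (S p) = - (\<i> *k (Phi S q c p v ** PiP (S p)))"
  unfolding Phi_J[OF c] by (simp_all add: mat_alg Pi_simps[OF SS_chart[OF c]])

lemma del_Pi:
  assumes c: "c \<in> A" "p \<in> dom_ch c"
  shows "del c (\<lambda>x. PiP (S x)) p v = (- \<i> / 2) *k del c S p v"
      "del c (\<lambda>x. PiM (S x)) p v = (\<i> / 2) *k del c S p v"
    "delb c (\<lambda>x. PiP (S x)) p v = (- \<i> / 2) *k delb c S p v"
        "delb c (\<lambda>x. PiM (S x)) p v = (\<i> / 2) *k delb c S p v"
proof -
  note p = insertI1 c(2) c(2)
  have k: "sm {c} (dom_ch c) (\<lambda>x. mat 1 :: complex^4^4)" using c chart_facts(1)[OF c(1)] by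
      (simp add: sm_const)
  note s = sS_chart[OF c(1)] and si = sm_linear[OF bl_mscale sS_chart[OF c(1)]]
  show "del c (\<lambda>x. PiP (S x)) p v = (- \<i> / 2) *k del c S p v"
      "del c (\<lambda>x. PiM (S x)) p v = (\<i> / 2) *k del c S p v"
    "delb c (\<lambda>x. PiP (S x)) p v = (- \<i> / 2) *k delb c S p v"
        "delb c (\<lambda>x. PiM (S x)) p v = (\<i> / 2) *k delb c S p v"
    unfolding PiP_def PiM_def del_scale[OF sm_add[OF k si] p] del_scale[OF sm_diff[OF k si] p] del_add[OF k si p]
      del_const del_scale[OF s p]
    by (simp_all add: mscale_simps) (simp_all add: vec_eq_iff)
qed

text \<open>\<open>del c S\<close> anticommutes with S, so it consists of two off-diagonal blocks.
  Up to constants, the block from S_- to S_+ is the (1,0)-part of the Hopf field Q and the other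
  block comes from the Hopf field A; q commutes with S and drops out of the first identity.\<close>

lemma sphere_identities:
  assumes c: "c \<in> A" "p \<in> dom_ch c"
  shows "PiP (S p) ** ((\<i> / 2) *k del c S p v) = PiP (S p) ** (Phi S q c p v ** PiM (S p))"
    "(1/4) *k (S p ** dd c S p v + dd c S p (J c p v)) ** PiM (S p) = (\<i> / 2) *k (del c S p v ** PiM (S p))"
    "(S p ** dd c S p v - dd c S p (J c p v)) ** PiP (S p) = (- 2 * \<i>) *k (del c S p v ** PiP (S p))"
    "PiM (S p) ** del c S p v = del c S p v ** PiP (S p)"
    "PiM (S p) ** del c S p v = (1/4) *k (\<i> *k (S p ** dd c S p v - dd c S p (J c p v)) - S p **
        (S p ** dd c S p v - dd c S p (J c p v)))"
  unfolding Phi_alt[OF c] del_def PiP_def PiM_def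
  by (simp_all add: mat_alg dS_anti[OF c] assoc_rule[OF dS_anti[OF c]] qS[OF c] assoc_rule[OF qS[OF c]]
      SS_chart[OF c] assoc_rule[OF SS_chart[OF c]])
    (simp_all add: vec_eq_iff field_simps)

definition EqN where "EqN c p v w = ext_deriv (NS S) (star J (NS S)) c p v w - 2 *\<^sub>R bracket_wedge q
    (star J (NS S)) c p v w"
definition Eqq where "Eqq c p v w = ext_deriv (NS S) q c p v w"

lemma curv_Phi:
  assumes c: "c \<in> A" "p \<in> dom_ch c"
  shows "curv (Phi S q) c p v (J c p v) = (1/2) *k (S p ** EqN c p v (J c p v)) + Eqq c p v (J c p v)"
    and EqN_formula: "EqN c p v (J c p v) = (dd c (\<lambda>x. star J (NS S) c x (J c p v)) p v - dd c (\<lambda>x. star J (NS S) c x v) p (J c p v))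
      - (comm (NS S c p v) (NS S c p v) - comm (NS S c p (J c p v)) (- NS S c p (J c p v)))
      - 2 *k (comm (q c p v) (NS S c p v) - comm (q c p (J c p v)) (- NS S c p (J c p v)))"
    and Eqq_formula: "Eqq c p v (J c p v) = (dd c (\<lambda>x. q c x (J c p v)) p v - dd c (\<lambda>x. q c x v) p (J c p v))
      - (comm (NS S c p v) (q c p (J c p v)) - comm (NS S c p (J c p v)) (q c p v))"
proof -
  define dsN where "dsN = dd c (\<lambda>x. star J (NS S) c x (J c p v)) p v - dd c (\<lambda>x. star J (NS S) c x
      v) p (J c p v)"
  define dq where "dq = dd c (\<lambda>x. q c x (J c p v)) p v - dd c (\<lambda>x. q c x v) p (J c p v)"
  have NJJ: "NS S c p (J c p (J c p v)) = - NS S c p v"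
    using smooth_formD(2)[OF form_NS[OF c(1)] c(2)] by (simp add: J_facts(2)[OF c] linear_neg)
  have st: "star J (NS S) c p (J c p v) = NS S c p v" "star J (NS S) c p v = - NS S c p (J c p v)"
    by (simp_all add: star_def NJJ)
  show N: "EqN c p v (J c p v) = dsN
      - (comm (NS S c p v) (NS S c p v) - comm (NS S c p (J c p v)) (- NS S c p (J c p v)))
      - 2 *k (comm (q c p v) (NS S c p v) - comm (q c p (J c p v)) (- NS S c p (J c p v)))"
    unfolding EqN_def ext_deriv_def bracket_wedge_def st scaleR_mscale dsN_def
    by simp
  show Q: "Eqq c p v (J c p v) = dq - (comm (NS S c p v) (q c p (J c p v)) - comm (NS S c p (J c p v)) (q c p v))"
    unfolding Eqq_def ext_deriv_def dq_def by simp
  have sym: "dd c (\<lambda>x. dd c S x (J c p v)) p v = dd c (\<lambda>x. dd c S x v) p (J c p v)"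
    by (rule dd_symmetric[OF sS_chart[OF c(1)] c(2) c(2)])
  have PJ: "Phi S q c p (J c p v) = (1/2) *k (NS S c p (J c p v) + S p ** NS S c p v) + q c p (J c p v)"
    by (simp add: Phi_def NJJ matrix_ring_simps)
  have "dd c (\<lambda>x. Phi S q c x (J c p v)) p v - dd c (\<lambda>x. Phi S q c x v) p (J c p v) =
     (1/2) *k ((1/2) *k (dd c S p v ** dd c S p (J c p v) - dd c S p (J c p v) ** dd c S p v)
       + (dd c S p v ** NS S c p v + dd c S p (J c p v) ** NS S c p (J c p v)) + S p ** dsN) + dq"
    unfolding dd_Phi[OF c] dd_NS[OF c] sym st dsN_def dq_def
    by (simp add: mat_alg)
  then show "curv (Phi S q) c p v (J c p v) = (1/2) *k (S p ** EqN c p v (J c p v)) + Eqq c p v (J c p v)"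
    unfolding N Q curv_def PJ Phi_def[of S q c p v]
    using curvature_identity[OF SS_chart[OF c] NS_facts(1)[OF c, of v] NS_facts(1)[OF c, of "J c p v"]
        NS_facts(2)[OF c, of v] NS_facts(2)[OF c, of "J c p v"] qS[OF c, of v] qJ[OF c, of v], where dsN = dsN and
            dq = dq]
    by simp
qed

text \<open>S is parallel for D_S = d - N, because dS = -2 S N and N anticommutes with S. The
  exterior derivative of D_S therefore respects the type of a form with respect to S:
  \<open>star J (NS S)\<close> anticommutes with S and q commutes.\<close>

lemma Eq_types:
  assumes c: "c \<in> A" "p \<in> dom_ch c"
  shows "EqN c p v (J c p v) ** S p = - (S p ** EqN c p v (J c p v))"
    "Eqq c p v (J c p v) ** S p = S p ** Eqq c p v (J c p v)"
proof -
  note s = sS_chart[OF c(1)] and st = smooth_formD(1)[OF form_star[OF c(1)]] and sq =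
      smooth_formD(1)[OF q[OF c(1)]]
  note p = insertI1 c(2) c(2)
  have NJJ: "NS S c p (J c p (J c p v)) = - NS S c p v"
    using smooth_formD(2)[OF form_NS[OF c(1)] c(2)] by (simp add: J_facts(2)[OF c] linear_neg)
  have stv: "star J (NS S) c p (J c p v) = NS S c p v" "star J (NS S) c p v = - NS S c p (J c p v)"
    by (simp_all add: star_def NJJ)
  have h: "y = - x - (a + d)" if "a + y = - (x + d)" for a x y d :: "complex^4^4"
  proof -
    have "y = (a + y) - a" by simp
    then show ?thesis unfolding that by simp
  qed
  have h': "y = x + (d - a)" if "a + y = x + d" for a x y d :: "complex^4^4"
  proof -
    have "y = (a + y) - a" by simp
    then show ?thesis unfolding that by simp
  qed
  have E: "dd c (\<lambda>x. star J (NS S) c x w) p u ** S p =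
      - (S p ** dd c (\<lambda>x. star J (NS S) c x w) p u) - (star J (NS S) c p w ** dd c S p u + dd c S p u ** star J (NS S) c p w)" for w u
  proof -
    have "dd c (\<lambda>x. star J (NS S) c x w ** S x) p u = dd c (\<lambda>x. - (S x ** star J (NS S) c x w)) p
        u"
      by (rule dd_cong[OF c(1) chart_facts(1)[OF c(1)] c(2) c(2)])
        (simp add: star_def NS_facts(1)[OF c(1)] matrix_ring_simps)
    then show ?thesis
      unfolding dd_minus[OF sm_bilinear[OF bb_mm s st] p] dd_bilinear[OF bb_mm s st p] dd_bilinear[OF bb_mm st s p]
      by (rule h)
  qed
  have D: "dd c (\<lambda>x. q c x w) p u ** S p =
      S p ** dd c (\<lambda>x. q c x w) p u + (dd c S p u ** q c p w - q c p w ** dd c S p u)" for w u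
  proof -
    have "dd c (\<lambda>x. q c x w ** S x) p u = dd c (\<lambda>x. S x ** q c x w) p u"
      by (rule dd_cong[OF c(1) chart_facts(1)[OF c(1)] c(2) c(2)]) (rule qS[OF c(1)])
    then show ?thesis
      unfolding dd_bilinear[OF bb_mm s sq p] dd_bilinear[OF bb_mm sq s p]
      by (rule h')
  qed
  note S0 = SS_chart[OF c] and n0 = NS_facts(1)[OF c] and q0 = qS[OF c]
  show "EqN c p v (J c p v) ** S p = - (S p ** EqN c p v (J c p v))"
    unfolding EqN_formula[OF c] qJ[OF c]
    by (simp add: mat_alg E stv NS_facts(2)[OF c] S0 n0 q0 assoc_rule[OF S0] assoc_rule[OF n0] assoc_rule[OF q0])
  show "Eqq c p v (J c p v) ** S p = S p ** Eqq c p v (J c p v)"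
    unfolding Eqq_formula[OF c] 
    by (simp add: mat_alg D qJ[OF c] NS_facts(2)[OF c] S0 n0 q0 assoc_rule[OF S0] assoc_rule[OF n0]
        assoc_rule[OF q0])
      (simp add: vec_eq_iff algebra_simps)
qed

text \<open>On pairs (v, J v) the curvature splits by type with respect to S into the two equations,
  and \<open>two_form_eq_0\<close> extends these to all pairs of tangent vectors.\<close>

lemma Willmore_iff_flat:
  assumes "c \<in> A" "p \<in> dom_ch c" and flat: "\<And>v. curv (Phi S q) c p v (J c p v) = 0"
  shows "ext_deriv (NS S) q c p v w = 0"
    "ext_deriv (NS S) (star J (NS S)) c p v w = 2 *\<^sub>R bracket_wedge q (star J (NS S)) c p v w"
proof -
  note c = assms(1,2)
  have "(1/2) *k (S p ** EqN c p v (J c p v)) + Eqq c p v (J c p v) = 0" for v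
    using flat curv_Phi[OF c] by simp
  note z = split_type[OF SS_chart[OF c] Eq_types[OF c] this]
  have bl: "linear (\<lambda>w. comm M (e w))" if "linear e" for M :: "complex^4^4" and e ::
      "real^2 \<Rightarrow> complex^4^4"
    using that unfolding linear_iff by (simp add: matrix_ring_simps scaleR_mscale mscale_simps)
  have bl': "linear (\<lambda>w. comm (e w) M)" if "linear e" for M :: "complex^4^4" and e ::
      "real^2 \<Rightarrow> complex^4^4"
    using that unfolding linear_iff by (simp add: matrix_ring_simps scaleR_mscale mscale_simps)
  note lN = smooth_formD(2)[OF form_NS[OF c(1)] c(2)] and ls = smooth_formD(2)[OF form_star[OF c(1)] c(2)] and lq =
      smooth_formD(2)[OF q[OF c(1)] c(2)]
  have ld: "linear (dd c (\<lambda>x. e c x v) p)" if "smooth_form c e" for e :: "('m, complex^4^4) form" and v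
    by (rule dd_lin[OF smooth_formD(1)[OF that] insertI1 c(2) c(2)])
  have l: "linear (\<lambda>w. ext_deriv (NS S) e c p v w)" if e: "smooth_form c e" for e v
    unfolding ext_deriv_def
    by (intro linear_compose_sub linear_dd_form[OF e c(2)] bl bl' lN ld[OF e] smooth_formD(2)[OF e c(2)])
  have lb: "linear (\<lambda>w. 2 *\<^sub>R bracket_wedge q (star J (NS S)) c p v w)" for v
    unfolding bracket_wedge_def
    by (intro linear_compose_scale_right linear_compose_sub bl bl' ls lq)
  have lN': "linear (EqN c p v)" for v
    using linear_compose_sub[OF l[OF form_star[OF c(1)]] lb, of v v] by (simp add: EqN_def[abs_def])
  have aN: "EqN c p w v = - EqN c p v w" for v w
    by (simp add: EqN_def ext_deriv_def bracket_wedge_def algebra_simps)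
  have "EqN c p v w = 0" by (rule two_form_eq_0[OF c lN' aN z(1)])
  then show "ext_deriv (NS S) (star J (NS S)) c p v w = 2 *\<^sub>R bracket_wedge q (star J (NS S)) c p v w"
    by (simp add: EqN_def)
  have lq': "linear (Eqq c p v)" for v
    using l[OF q[OF c(1)], of v] by (simp add: Eqq_def[abs_def])
  have aq: "Eqq c p w v = - Eqq c p v w" for v w
    by (simp add: Eqq_def ext_deriv_def algebra_simps)
  have "Eqq c p v w = 0" by (rule two_form_eq_0[OF c lq' aq z(2)])
  then show "ext_deriv (NS S) q c p v w = 0" by (simp add: Eqq_def)
qed

end

section \<open>Constrained Willmore surfaces\<close>

lemma cols4_mult: "transpose (rows4 a b c d) *v x = x $ 1 *s a + x $ 2 *s b + x $ 3 *s c + x $ 4 *s d"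
  by (simp add: vec_eq_iff matrix_vector_mult_def transpose_def sum_4 algebra_simps)

lemma invertible_cols4:
  assumes "\<And>z1 z2 z3 z4. z1 *s a + z2 *s b + z3 *s c + z4 *s d = 0 \<Longrightarrow> z1 = 0 \<and> z2 = 0
      \<and> z3 = 0 \<and> z4 = 0"
  shows "invertible (transpose (rows4 a b c d))"
proof -
  have "x = y" if "transpose (rows4 a b c d) *v x = transpose (rows4 a b c d) *v y" for x y
  proof -
    have "transpose (rows4 a b c d) *v (x - y) = 0" using that by (simp add: matrix_vector_simps)
    then have "x - y = 0" using assms[of "(x-y)$1" "(x-y)$2" "(x-y)$3" "(x-y)$4"]
      unfolding cols4_mult by (simp add: vec_eq_iff forall_4)
    then show ?thesis by simp
  qed
  then have "inj ((*v) (transpose (rows4 a b c d)))" by (auto intro: injI)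
  then show ?thesis using matrix_left_invertible_injective invertible_left_inverse by blast
qed

text \<open>The quotient by a j-stable L is a quaternionic vector space. Explicitly, y = c u + d ju
  satisfies conj(c) y - d jy = (|c|^2 + |d|^2) u.\<close>

lemma quaternionic_independence:
  assumes L: "vec.subspace (L :: (complex^4) set)" and jL: "\<And>x. x \<in> L \<Longrightarrow> jmap x \<in> L"
    and u: "u \<notin> L" and cd: "c *s u + d *s jmap u \<in> L"
  shows "c = 0 \<and> d = 0"
proof -
  let ?y = "c *s u + d *s jmap u"
  have "cnj c *s ?y - d *s jmap ?y \<in> L" 
    by (rule subspace_alt(3)[OF L subspace_alt(4)[OF L cd] subspace_alt(4)[OF L jL[OF cd]]])
  also have "cnj c *s ?y - d *s jmap ?y = (c * cnj c + d * cnj d) *s u"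
    by (simp add: jmap_simps) (simp add: vec_eq_iff algebra_simps)
  finally have m: "(c * cnj c + d * cnj d) *s u \<in> L" .
  have "c * cnj c + d * cnj d = 0"
  proof (rule ccontr)
    define e where "e = c * cnj c + d * cnj d"
    assume "c * cnj c + d * cnj d \<noteq> 0"
    then have "e \<noteq> 0" by (simp add: e_def)
    moreover have "inverse e *s (e *s u) \<in> L" by (rule subspace_alt(4)[OF L m[folded e_def]])
    ultimately show False using u by simp
  qed
  then have "complex_of_real ((cmod c)^2 + (cmod d)^2) = 0" by (simp add: complex_norm_square[symmetric])
  then have "(cmod c)^2 + (cmod d)^2 = 0" using of_real_eq_0_iff by blast
  then show ?thesis by (simp add: add_nonneg_eq_0_iff)
qed

lemma span_pair: "vec.span {a, b :: complex^'n} = {y. \<exists>z w. y = z *s a + w *s b}"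
  by (auto simp: vec.span_insert vec.span_singleton algebra_simps)

lemma (in surface) subbundle_frame:
  assumes E: "smooth_subbundle X A k E" and p: "p \<in> topspace X"
  obtains N s where "p \<in> N" "openin X N" "\<And>i. i < k \<Longrightarrow> sm A N (s i)"
    "\<And>x. x \<in> N \<Longrightarrow> E x = vec.span ((\<lambda>i::nat. s i x) ` {..<k})"
        "\<And>x. x \<in> N \<Longrightarrow> vec.dim (E x) = k"
proof -
  obtain N s where h: "openin X N \<and> p \<in> N \<and> (\<forall>i<k. smooth_map A N (s i)) \<and>
        (\<forall>x\<in>N. E x = vec.span ((\<lambda>i::nat. s i x) ` {..<k}) \<and> vec.dim (E x) = k)"
    using bspec[OF E[unfolded smooth_subbundle_def] p] by (elim exE)
  show ?thesis
  proof (rule that[of N s])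
    show "p \<in> N" "openin X N" using h by simp_all
    show "sm A N (s i)" if "i < k" for i using h that by (simp add: sm_def)
    show "E x = vec.span ((\<lambda>i::nat. s i x) ` {..<k})" if "x \<in> N" for x
      using bspec[OF conjunct2[OF conjunct2[OF conjunct2[OF h]]] that] by (rule conjunct1)
    show "vec.dim (E x) = k" if "x \<in> N" for x
      using bspec[OF conjunct2[OF conjunct2[OF conjunct2[OF h]]] that] by (rule conjunct2)
  qed
qed

locale willmore = surface X A for X :: "'m topology" and A :: "'m chart set" +
  fixes \<kappa> :: complex and J :: "('m, real^2) form" and S :: "'m \<Rightarrow> complex^4^4"
    and q :: "('m, complex^4^4) form" and L :: "'m \<Rightarrow> (complex^4) set"
  assumes W: "q_constrained_Willmore \<kappa> X A J S q L"
begin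

lemma W_parts: "surface_S4 X A L" "complex_structure A J" "mean_curvature_sphere X A J L S" "one_form A q"
  using W unfolding q_constrained_Willmore_def induced_complex_structure_def by blast+

lemmas mcs = W_parts(3)[unfolded mean_curvature_sphere_def]
lemmas mcs_pt = mcs[THEN conjunct2, THEN conjunct1]
lemmas mcs_dS = mcs[THEN conjunct2, THEN conjunct2, THEN conjunct1]
lemmas mcs_delta = mcs[THEN conjunct2, THEN conjunct2, THEN conjunct2, THEN conjunct1]
lemmas mcs_Q = mcs[THEN conjunct2, THEN conjunct2, THEN conjunct2, THEN conjunct2]

lemma W_q:
  assumes "c \<in> A" "p \<in> dom_ch c"
  shows "jc (q c p v) = q c p v" "x \<in> L p \<Longrightarrow> q c p v *v x = 0" "q c p v *v x \<in> L p"
    "S p ** q c p v = - q c p (J c p v)" "q c p v ** S p = - q c p (J c p v)"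
    "ext_deriv (NS S) q c p v w = 0"
    "ext_deriv (NS S) (star J (NS S)) c p v w = 2 *\<^sub>R bracket_wedge q (star J (NS S)) c p v w"
proof -
  have "j_commuting (q c p v) \<and> (\<forall>x\<in>L p. q c p v *v x = 0) \<and> (\<forall>x. q c p v *v x \<in> L p) \<and>
        S p ** q c p v = star J q c p v \<and> star J q c p v = q c p v ** S p"
    using W assms unfolding q_constrained_Willmore_def by blast
  then show "jc (q c p v) = q c p v" "x \<in> L p \<Longrightarrow> q c p v *v x = 0" "q c p v *v x \<in> L p"
    "S p ** q c p v = - q c p (J c p v)" "q c p v ** S p = - q c p (J c p v)"
    by (auto simp: j_commuting_iff star_def)
  show "ext_deriv (NS S) q c p v w = 0"
    "ext_deriv (NS S) (star J (NS S)) c p v w = 2 *\<^sub>R bracket_wedge q (star J (NS S)) c p v w"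
    using W assms unfolding q_constrained_Willmore_def by blast+
qed

lemma W_S:
  assumes "p \<in> topspace X"
  shows "jc (S p) = S p" "S p ** S p = - mat 1" "x \<in> L p \<Longrightarrow> S p *v x \<in> L p"
proof -
  have "j_commuting (S p) \<and> S p ** S p = - mat 1 \<and> (\<lambda>x. S p *v x) ` L p = L p"
    using mcs_pt assms by (rule bspec)
  then have h: "j_commuting (S p)" "S p ** S p = - mat 1" "(\<lambda>x. S p *v x) ` L p = L p" by simp_all
  show "jc (S p) = S p" "S p ** S p = - mat 1" using h by (simp_all only: j_commuting_iff)
  show "x \<in> L p \<Longrightarrow> S p *v x \<in> L p" using h(3) by blast
qed

lemma W_smooth: "sm A (topspace X) S"
  using W_parts(3) unfolding mean_curvature_sphere_def sm_def by auto

lemma W_form: "c \<in> A \<Longrightarrow> p \<in> dom_ch c \<Longrightarrow> linear (q c p)"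
    "c \<in> A \<Longrightarrow> sm {c} (dom_ch c) (\<lambda>p. q c p v)"
proof -
  show "linear (q c p)" if "c \<in> A" "p \<in> dom_ch c"
    using W_parts(4) that unfolding one_form_def by blast
  assume c: "c \<in> A"
  then have "smooth_on (coord c ` dom_ch c) (in_chart c (\<lambda>p. q c p v))"
    using W_parts(4) unfolding one_form_def by blast
  then show "sm {c} (dom_ch c) (\<lambda>p. q c p v)" using c chart_facts(1)[OF c] by
      (simp add: sm_def smooth_map_def)
qed

end

sublocale willmore \<subseteq> conformal_surface X A J
  by unfold_locales (rule W_parts)

sublocale willmore \<subseteq> sphere_form X A J S q
  by unfold_locales (simp_all add: W_smooth W_S smooth_form_def W_form W_q)

context willmore begin

lemma jS: "p \<in> topspace X \<Longrightarrow> jc (S p) = S p" by (rule W_S)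

lemma L_facts:
  assumes "p \<in> topspace X"
  shows "vec.subspace (L p)" "vec.dim (L p) = 2" "jmap ` L p = L p"
      "x \<in> L p \<Longrightarrow> jmap x \<in> L p"
    "x \<in> L p \<Longrightarrow> PiP (S p) *v x \<in> L p"
        "x \<in> L p \<Longrightarrow> PiM (S p) *v x \<in> L p"
proof -
  have "smooth_subbundle X A 2 L" using W_parts(1) unfolding surface_S4_def by blast
  then obtain s where s: "L p = vec.span ((\<lambda>i::nat. s i p) ` {..<2})" "vec.dim (L p) = 2"
    using assms by (rule subbundle_frame) blast
  show L: "vec.subspace (L p)" unfolding s(1) by (rule vec.subspace_span)
  show "vec.dim (L p) = 2" by (rule s)
  show j: "jmap ` L p = L p" using W_parts(1) assms unfolding surface_S4_def by blast
  then show "x \<in> L p \<Longrightarrow> jmap x \<in> L p" by blast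
  show "x \<in> L p \<Longrightarrow> PiP (S p) *v x \<in> L p"
      "x \<in> L p \<Longrightarrow> PiM (S p) *v x \<in> L p"
    using W_S(3)[OF assms] by (auto simp: PiP_def PiM_def mscale_simps matrix_vector_simps intro!:
        subspace_alt[OF L])
qed

lemma dS_L: "c \<in> A \<Longrightarrow> p \<in> dom_ch c \<Longrightarrow> x \<in> L p \<Longrightarrow> dd c S p
    v *v x \<in> L p"
  using mcs_dS by blast

lemma Q_L: "c \<in> A \<Longrightarrow> p \<in> dom_ch c \<Longrightarrow> x \<in> L p \<Longrightarrow> S p *v
    (dd c S p v *v x) + dd c S p (J c p v) *v x = 0"
  using mcs_Q by blast

lemma delta:
  assumes "sm A N s" "\<And>x. x \<in> N \<Longrightarrow> s x \<in> L x" "p \<in> N" "c \<in> A"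
      "p \<in> dom_ch c"
  shows "dd c s p (J c p v) + S p *v dd c s p v \<in> L p"
      "S p *v dd c s p v - dd c (\<lambda>x. S x *v s x) p v \<in> L p"
proof -
  have "local_sec X A L N s" using assms unfolding local_sec_def sm_def by blast
  from mcs_delta[rule_format, OF this assms(3-5), of v]
  have h: "- dd c s p (J c p v) - S p *v dd c s p v \<in> L p"
      "S p *v dd c s p v - dd c (\<lambda>x. S x *v s x) p v \<in> L p" by simp_all
  show "S p *v dd c s p v - dd c (\<lambda>x. S x *v s x) p v \<in> L p" by (rule h)
  have "- (- dd c s p (J c p v) - S p *v dd c s p v) \<in> L p"
    using subspace_alt(5)[OF L_facts(1)[OF in_top[OF assms(4,5)]] h(1)] .
  then show "dd c s p (J c p v) + S p *v dd c s p v \<in> L p" by (simp add: add.commute)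
qed

lemma flat: "c \<in> A \<Longrightarrow> p \<in> dom_ch c \<Longrightarrow> curv (Phi S q) c p v (J c p v) = 0"
  by (simp add: curv_Phi EqN_def Eqq_def W_q mscale_simps matrix_ring_simps)

lemma Phi_L:
  assumes c: "c \<in> A" "p \<in> dom_ch c" and x: "x \<in> L p"
  shows "Phi S q c p v *v x = 0"
  using Q_L[OF c x, of v] W_q(2)[OF c x, of v] unfolding Phi_alt[OF c]
  by (simp add: mscale_simps(10) matrix_vector_simps(1) matrix_vector_mul_assoc[symmetric])

text \<open>Q anticommutes with S and disappears from the diagonal blocks; what remains of \<Phi>
  there is q, whose image lies in L.\<close>

lemma Phi_image:
  assumes c: "c \<in> A" "p \<in> dom_ch c"
  shows "PiM (S p) *v (Phi S q c p v ** PiM (S p) *v x) \<in> L p"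
      "PiP (S p) *v (Phi S q c p v ** PiP (S p) *v x) \<in> L p"
proof -
  note r = SS_chart[OF c] NS_facts(1)[OF c] qS[OF c] assoc_rule[OF SS_chart[OF c]] assoc_rule[OF NS_facts(1)[OF c]]
      assoc_rule[OF qS[OF c]]
  have "PiM (S p) ** (Phi S q c p v ** PiM (S p)) = q c p v ** PiM (S p)"
     "PiP (S p) ** (Phi S q c p v ** PiP (S p)) = q c p v ** PiP (S p)"
    unfolding PiM_def PiP_def Phi_def
    by (simp_all add: mat_alg r) (simp_all add: vec_eq_iff field_simps)
  then show "PiM (S p) *v (Phi S q c p v ** PiM (S p) *v x) \<in> L p"
      "PiP (S p) *v (Phi S q c p v ** PiP (S p) *v x) \<in> L p"
    using W_q(3)[OF c] by (metis matrix_vector_mul_assoc)+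
qed

lemma jc_dS: assumes c: "c \<in> A" "p \<in> dom_ch c" shows "jc (dd c S p v) = dd c S p v"
proof -
  have "dd c (\<lambda>x. jc (S x)) p v = dd c S p v"
    by (rule dd_cong[OF c(1) chart_facts(1)[OF c(1)] c(2) c(2)]) (use jS in_top[OF c(1)] in auto)
  then show ?thesis using dd_linear[OF bl_jc sS_chart[OF c(1)] insertI1 c(2) c(2), of v] by simp
qed

lemma jc_Phi: assumes c: "c \<in> A" "p \<in> dom_ch c" shows "jc (Phi S q c p v) = Phi S q c p v"
  unfolding Phi_alt[OF c] by (simp add: jc_simps jc_dS[OF c] jS[OF in_top[OF c]] W_q(1)[OF c])

text \<open>Some vector of \<open>L p\<close> has a nonzero S_+ component: if x has none, then jx
  lies in S_+. Extending it with constant coefficients in a frame of L, projecting to S_+ and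
  shrinking the neighbourhood gives a nowhere-zero section of L_+.\<close>

lemma frame:
  assumes p: "p \<in> topspace X"
  obtains N l where "sm A N l" "p \<in> N" "\<And>x. x \<in> N \<Longrightarrow> l x \<in> L x \<and> PiP (S x) *v
      l x = l x \<and> l x \<noteq> 0"
proof -
  have "smooth_subbundle X A 2 L" using W_parts(1) unfolding surface_S4_def by blast
  then obtain N s where N: "openin X N" "p \<in> N" and s: "\<And>i. i < 2 \<Longrightarrow> sm A N (s i)"
    and sp: "\<And>x. x \<in> N \<Longrightarrow> L x = vec.span ((\<lambda>i::nat. s i x) ` {..<2})"
    using p by (rule subbundle_frame) blast
  have N_top: "x \<in> topspace X" if "x \<in> N" for x using openin_subset[OF N(1)] that by blast
  have sm: "sm A N (s 0)" "sm A N (s 1)" using s by simp_all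
  have in_L: "s i x \<in> L x" if "i < 2" "x \<in> N" for i x
    unfolding sp[OF that(2)] by (rule vec.span_base) (use that in auto)
  have "\<exists>y\<in>L p. PiP (S p) *v y \<noteq> 0"
  proof -
    have "\<not> L p \<subseteq> {0}" using L_facts(2)[OF p] vec.dim_eq_0[of "L p"] by linarith
    then obtain x where x: "x \<in> L p" "x \<noteq> 0" by blast
    show ?thesis
    proof (cases "PiP (S p) *v x = 0")
      case True
      then have "PiM (S p) *v x = x" using Pi_decomp[of "S p" x] by simp
      then have "PiP (S p) *v jmap x = jmap x" using jmap_mv[of "PiM (S p)" x] jc_Pi(2)[OF jS[OF p]] by simp
      then show ?thesis using x L_facts(4)[OF p] jmap_eq_0 by metis
    qed (use x in blast)
  qed
  then obtain y where y: "y \<in> L p" "PiP (S p) *v y \<noteq> 0" by blast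
  have "(\<lambda>i::nat. s i p) ` {..<2} = {s 0 p, s 1 p}" by (auto simp: numeral_2_eq_2 lessThan_Suc)
  then have "y \<in> vec.span {s 0 p, s 1 p}" using y(1) unfolding sp[OF N(2)] by simp
  then obtain z w where yzw: "y = z *s s 0 p + w *s s 1 p" unfolding span_pair by blast
  define l where "l x = PiP (S x) *v (z *s s 0 x + w *s s 1 x)" for x
  have sS': "sm A N S" by (rule sm_subset[OF sS N(1)]) (use N_top in auto)
  have sP: "sm A N (\<lambda>x. PiP (S x))" unfolding PiP_def
    by (intro sm_linear[OF bl_mscale] sm_diff sm_const sS' N(1) order_refl)
  have bv: "bounded_linear (\<lambda>x::complex^4. z *s x)" for z by
      (rule bounded_bilinear.bounded_linear_right[OF bb_vs])
  have sl: "sm A N l" unfolding l_def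
    by (intro sm_bilinear[OF bb_mv sP] sm_add sm_linear[OF bv] sm)
  have l: "l x \<in> L x" "PiP (S x) *v l x = l x" if "x \<in> N" for x
  proof -
    have "z *s s 0 x + w *s s 1 x \<in> L x" using in_L[OF _ that] by
        (intro subspace_alt[OF L_facts(1)[OF N_top[OF that]]]) auto
    then show "l x \<in> L x" unfolding l_def by (rule L_facts(5)[OF N_top[OF that]])
    show "PiP (S x) *v l x = l x" unfolding l_def by (simp add: matrix_vector_mul_assoc
        Pi_simps[OF SS[OF N_top[OF that]]])
  qed
  show ?thesis
  proof (rule that[of "{x \<in> N. l x \<noteq> 0}" l])
    show "sm A {x \<in> N. l x \<noteq> 0} l" by (rule sm_subset[OF sl sm_nonzero_open[OF sl]]) auto
    show "p \<in> {x \<in> N. l x \<noteq> 0}" using N(2) y(2) by (simp add: l_def yzw)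
  qed (use l in auto)
qed

lemma L_basis:
  assumes p: "p \<in> topspace X" and l: "l \<in> L p" "PiP (S p) *v l = l" "l \<noteq> 0"
  shows "z *s l + w *s jmap l = 0 \<Longrightarrow> z = 0 \<and> w = 0"
      "y \<in> L p \<Longrightarrow> \<exists>z w. y = z *s l + w *s jmap l"
    "y \<in> L p \<Longrightarrow> PiP (S p) *v y = y \<Longrightarrow> \<exists>z. y = z *s l"
proof -
  note qp = quaternionic_pair[OF SS[OF p] jS[OF p] l(2,3)]
  note jl = qp(1) and ne = qp(3)
  show "z *s l + w *s jmap l = 0 \<Longrightarrow> z = 0 \<and> w = 0" by (rule qp(2))
  have "vec.independent {l, jmap l}" by (rule qp(4))
  then have "L p \<subseteq> vec.span {l, jmap l}"
    by (intro vec.card_ge_dim_independent) (use l(1) L_facts(2,4)[OF p] ne in auto)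
  then show ex: "\<exists>z w. y = z *s l + w *s jmap l" if "y \<in> L p" for y using that unfolding span_pair by
      blast
  show "\<exists>z. y = z *s l" if y: "y \<in> L p" "PiP (S p) *v y = y"
  proof -
    obtain z w where "y = z *s l + w *s jmap l" using ex[OF y(1)] by blast
    then have "y = z *s l" using y(2) by (simp add: matrix_vector_simps l jl)
    then show ?thesis by blast
  qed
qed

text \<open>With S l = \<i> l the two conditions on \<delta> combine to dl(J v) + \<i> dl(v) \<in>
  L, and this vector is \<partial>l up to the factor -\<i>/2.\<close>

lemma del_section:
  assumes l: "sm A N l" "\<And>x. x \<in> N \<Longrightarrow> l x \<in> L x \<and> PiP (S x) *v l x = l x" and p:
      "p \<in> N" "c \<in> A" "p \<in> dom_ch c"
  shows "vdel c l p v \<in> L p"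
proof -
  have N: "openin X N" using sm_open[OF l(1)] by blast
  have top: "x \<in> topspace X" if "x \<in> N" for x using openin_subset[OF N] that by blast
  have Sl: "S x *v l x = \<i> *s l x" if "x \<in> N" for x
    using l(2)[OF that] Splus_iff(1)[OF SS[OF top[OF that]], of "l x"] by (simp add: Splus_def)
  have bv: "bounded_linear (\<lambda>x::complex^4. \<i> *s x)" by
      (rule bounded_bilinear.bounded_linear_right[OF bb_vs])
  have "dd c (\<lambda>x. S x *v l x) p v = dd c (\<lambda>x. \<i> *s l x) p v"
    by (rule dd_cong[OF p(2) N p(1,3)]) (rule Sl)
  also have "\<dots> = \<i> *s dd c l p v" by (rule dd_linear[OF bv l(1) p(2,1,3)])
  finally have 2: "S p *v dd c l p v - \<i> *s dd c l p v \<in> L p"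
    using delta(2)[OF l(1) _ p, of v] l(2) by simp
  have "dd c l p (J c p v) + S p *v dd c l p v \<in> L p"
    using delta(1)[OF l(1) _ p, of v] l(2) by simp
  note sub = subspace_alt[OF L_facts(1)[OF in_top[OF p(2,3)]]]
  have "(- \<i> / 2) *s ((dd c l p (J c p v) + S p *v dd c l p v) - (S p *v dd c l p v - \<i> *s dd c l p v)) \<in>
      L p"
    using sub \<open>dd c l p (J c p v) + S p *v dd c l p v \<in> L p\<close> 2 by blast
  also have "(- \<i> / 2) *s ((dd c l p (J c p v) + S p *v dd c l p v) - (S p *v dd c l p v - \<i> *s dd c l p v))
      = vdel c l p v"
    by (simp add: vdel_def vec_eq_iff field_simps)
  finally show ?thesis .
qed

text \<open>The Hopf field \<open>A = (S dS + *dS) / 4\<close> has its image in L: differentiate the sections \<open>(dS)l\<close>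
  of L, antisymmetrise, and use that \<open>d\<^sub>v l\<close> and L span \<open>\<complex>\<^sup>4\<close> over the quaternions since L immerses.\<close>

lemma Hopf_image:
  assumes c: "c \<in> A" "p \<in> dom_ch c"
  shows "(S p ** dd c S p v - dd c S p (J c p v)) *v y \<in> L p"
proof (cases "v = 0")
  case True
  have "dd c S p 0 = 0" "J c p 0 = 0"
    using dd_lin[OF sS_chart[OF c(1)] insertI1 c(2) c(2)] J_facts(1)[OF c] linear_0 by blast+
  then show ?thesis using True subspace_alt(1)[OF L_facts(1)[OF in_top[OF c]]] by (simp add: matrix_ring_simps)
next
  case v: False
  note top = in_top[OF c]
  note sub = subspace_alt[OF L_facts(1)[OF top]]
  obtain N l where l: "sm A N l" "p \<in> N" "\<And>x. x \<in> N \<Longrightarrow> l x \<in> L x \<and> PiP (S x)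
      *v l x = l x \<and> l x \<noteq> 0"
    using frame[OF top] by blast
  have N: "openin X N" using sm_open[OF l(1)] by blast
  define N' where "N' = N \<inter> dom_ch c"
  have N': "openin X N'" "p \<in> N'" "N' \<subseteq> dom_ch c" using N chart_facts(1)[OF c(1)] l(2) c(2) by
      (auto simp: N'_def)
  have sl: "sm {c} N' l" by (rule sm_subset[OF l(1) N'(1)]) (use c in \<open>auto simp: N'_def\<close>)
  have sS': "sm {c} N' S" by (rule sm_subset[OF sS_chart[OF c(1)] N'(1,3)]) auto
  have sD: "sm {c} N' (\<lambda>x. dd c S x w)" for w by (rule sm_dd[OF sS'])
  define g where "g w x = dd c S x w *v l x" for w x
  have sg: "sm {c} N' (g w)" for w unfolding g_def by (rule sm_bilinear[OF bb_mv sD sl])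
  have gL: "g w x \<in> L x" if "x \<in> N'" for w x
    unfolding g_def using dS_L[OF c(1)] l(3) that by (auto simp: N'_def)
  have dg: "dd c (g w) p u = dd c S p w *v dd c l p u + dd c (\<lambda>x. dd c S x w) p u *v l p" for w u
    unfolding g_def by (rule dd_bilinear[OF bb_mv sD sl insertI1 N'(2) c(2)])
  define u where "u = dd c l p v"
  define w where "w = J c p v"
  \<comment> \<open>The first condition on \<delta>, applied to the section dS(v) l of L.\<close>
  have B3: "dd c (g v) p w + S p *v dd c (g v) p v \<in> L p"
    unfolding w_def by (rule delta(1)[OF sm_all_charts[OF sg N'(3)] gL N'(2) c])
  \<comment> \<open>On L one has dS(J v) = - S dS(v). Differentiate this along v: all terms other
    than the two kept here are values of dS on vectors of L.\<close>
  have B4: "dd c (g w) p v + S p *v dd c (g v) p v \<in> L p"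
  proof -
    have "dd c (\<lambda>x. dd c S x (J c x v) *v l x) p v = dd c (\<lambda>x. - (S x *v g v x)) p v"
    proof (rule dd_cong[OF c(1) N'(1,2) c(2)])
      fix x assume x: "x \<in> N'" "x \<in> dom_ch c"
      show "dd c S x (J c x v) *v l x = - (S x *v g v x)"
        using Q_L[OF c(1) x(2), of "l x" v] l(3) x by (simp add: N'_def g_def add_eq_0_iff)
    qed
    also have "\<dots> = - (S p *v dd c (g v) p v + dd c S p v *v g v p)"
      unfolding dd_minus[OF sm_bilinear[OF bb_mv sS' sg] insertI1 N'(2) c(2)]
        dd_bilinear[OF bb_mv sS' sg insertI1 N'(2) c(2)] ..
    finally have 1: "dd c (\<lambda>x. dd c S x (J c x v) *v l x) p v = - (S p *v dd c (g v) p v + dd c S p v *v g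
        v p)" .
    have sDJ: "sm {c} N' (\<lambda>x. dd c S x (J c x v))"
      by (rule sm_subset[OF smooth_formD(1)[OF smooth_form_J[OF form_dS[OF c(1)]]] N'(1,3)]) auto
    have 2: "dd c (\<lambda>x. dd c S x (J c x v) *v l x) p v = dd c (g w) p v + dd c S p
        (dd c (\<lambda>x. J c x v) p v) *v l p"
      unfolding dd_bilinear[OF bb_mv sDJ sl insertI1 N'(2) c(2)] dg dd_form_J[OF form_dS[OF c(1)] c(2)] w_def
      by (simp add: matrix_vector_simps)
    have "dd c (g w) p v + S p *v dd c (g v) p v = - (dd c S p v *v g v p) - dd c S p
        (dd c (\<lambda>x. J c x v) p v) *v l p"
      (is "?a + ?b = - ?d - ?e")
    proof -
      have "?a + ?e = - (?b + ?d)" using 1 2 by simp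
      moreover have "?a + ?b = (?a + ?e) + ?b - ?e" by simp
      ultimately show ?thesis by simp
    qed
    then show ?thesis
      using sub(3)[OF sub(5)[OF dS_L[OF c gL[OF N'(2)], of v v]]
          dS_L[OF c, of "l p" "dd c (\<lambda>x. J c x v) p v"]] l(3)[OF l(2)]
      by simp
  qed
  have sym: "dd c (\<lambda>x. dd c S x w) p v = dd c (\<lambda>x. dd c S x v) p w"
    by (rule dd_symmetric[OF sS' N'(2) c(2)])
  \<comment> \<open>In the difference of \<open>B4\<close> and \<open>B3\<close> the second
    derivatives of S cancel by symmetry.\<close>
  have e1: "dd c S p w *v u - dd c S p v *v dd c l p w \<in> L p"
  proof -
    have "dd c S p w *v u - dd c S p v *v dd c l p w = (dd c (g w) p v + S p *v dd c (g v) p v) -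
        (dd c (g v) p w + S p *v dd c (g v) p v)"
      unfolding dg u_def sym by (simp add: algebra_simps)
    then show ?thesis using sub(3)[OF B4 B3] by simp
  qed
  have k: "dd c l p w + S p *v u \<in> L p" unfolding w_def u_def by (rule delta(1)[OF l(1) _ l(2) c])
      (use l(3) in auto)
  define B where "B = S p ** dd c S p v - dd c S p w"
  have Bu: "B *v u \<in> L p"
  proof -
    have "dd c S p v *v (S p *v u) = - (S p *v (dd c S p v *v u))"
      by (simp add: matrix_vector_mul_assoc dS_anti[OF c] matrix_vector_simps)
    then have "B *v u = - ((dd c S p w *v u - dd c S p v *v dd c l p w) + dd c S p v *v (dd c l p w + S p *v u))"
      by (simp add: B_def matrix_vector_simps matrix_vector_mul_assoc[symmetric])
    then show ?thesis using sub(5)[OF sub(2)[OF e1 dS_L[OF c k]]] by simp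
  qed
  have BL: "B *v x \<in> L p" if "x \<in> L p" for x
    unfolding B_def using dS_L[OF c that] W_S(3)[OF top]
    by (auto simp: matrix_vector_simps matrix_vector_mul_assoc[symmetric] intro!: sub)
  have jB: "jc B = B" by (simp add: B_def jc_simps jc_dS[OF c] jS[OF top])
  have Bju: "B *v jmap u \<in> L p" using L_facts(4)[OF top Bu] jmap_mv[of B u] jB by simp
  \<comment> \<open>Were u in L, the real lift l \<and> jl would have a derivative along v inside
    \<Lambda>^2 L, although L immerses and v \<noteq> 0.\<close>
  have uL: "u \<notin> L p"
  proof
    assume u: "u \<in> L p"
    define \<sigma> where "\<sigma> x = wedge (l x) (jmap (l x))" for x
    have sj: "sm A N (\<lambda>x. jmap (l x))" by (rule sm_linear[OF bl_jmap l(1)])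
    have s\<sigma>: "sm A N \<sigma>" unfolding \<sigma>_def by (rule sm_bilinear[OF bb_wedge l(1) sj])
    have rl: "real_lift X A L N \<sigma>"
      unfolding real_lift_def local_sec_def
    proof (intro conjI ballI)
      show "openin X N" "smooth_map A N \<sigma>" using s\<sigma> by (auto simp: sm_def)
      fix x assume x: "x \<in> N"
      have xt: "x \<in> topspace X" using x openin_subset[OF N] by blast
      show "\<sigma> x \<in> wedge_space (L x) (L x)"
        unfolding \<sigma>_def using l(3)[OF x] L_facts(4)[OF xt] by (intro wedge_in_space) auto
      show "conj2 (\<sigma> x) = \<sigma> x"
        unfolding \<sigma>_def conj2_wedge jmap_simps wedge_simps using wedge_swap[of "jmap (l x)" "l x"] by simp
      show "\<sigma> x \<noteq> 0"
      proof
        assume "\<sigma> x = 0"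
        have "wedge a b = 0 \<Longrightarrow> a $ i * b $ j = b $ i * a $ j" for a b :: "complex^4" and i j
          by (auto simp: wedge_def vec_eq_iff)
        then have ij: "l x $ i * jmap (l x) $ j = jmap (l x) $ i * l x $ j" for i j using
            \<open>\<sigma> x = 0\<close> unfolding \<sigma>_def by blast
        obtain i where i: "l x $ i \<noteq> 0" using l(3)[OF x] by (auto simp: vec_eq_iff)
        have "(- jmap (l x) $ i) *s l x + l x $ i *s jmap (l x) = 0"
          using ij by (simp add: vec_eq_iff mult.commute)
        then show False using L_basis(1)[OF xt, of "l x" "- jmap (l x) $ i" "l x $ i"] l(3)[OF x] i by blast
      qed
    qed
    have "dd c \<sigma> p v = wedge (l p) (jmap u) + wedge u (jmap (l p))"
      unfolding \<sigma>_def u_def dd_bilinear[OF bb_wedge l(1) sj c(1) l(2) c(2)] dd_linear[OF bl_jmap l(1) c(1)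
          l(2) c(2)] ..
    then have "dd c \<sigma> p v \<in> wedge_space (L p) (L p)"
      using u l(3)[OF l(2)] L_facts(4)[OF top] by (auto intro!: vec.subspace_add[OF subspace_wedge_space]
          wedge_in_space)
    then have "v = 0" using W_parts(1) rl l(2) c unfolding surface_S4_def immerses_def by blast
    then show False using v by blast
  qed
  have lp: "l p \<in> L p" "PiP (S p) *v l p = l p" "l p \<noteq> 0" using l(3)[OF l(2)] by auto
  \<comment> \<open>The columns l, jl, u, ju form a basis of \<open>complex^4\<close>, since u lies
    outside the j-stable plane L.\<close>
  define K where "K = transpose (rows4 (l p) (jmap (l p)) u (jmap u))"
  have "invertible K"
    unfolding K_def
  proof (rule invertible_cols4)
    fix z1 z2 z3 z4 assume h: "z1 *s l p + z2 *s jmap (l p) + z3 *s u + z4 *s jmap u = 0"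
    have "z3 *s u + z4 *s jmap u = - (z1 *s l p + z2 *s jmap (l p))"
      using h by (simp add: eq_neg_iff_add_eq_0 algebra_simps)
    also have "\<dots> \<in> L p" using lp L_facts(4)[OF top] by (auto intro!: sub)
    finally have "z3 = 0 \<and> z4 = 0" using quaternionic_independence[OF L_facts(1)[OF top] L_facts(4)[OF top]
        uL] by blast
    then show "z1 = 0 \<and> z2 = 0 \<and> z3 = 0 \<and> z4 = 0" using h L_basis(1)[OF top lp, of z1 z2] by simp
  qed
  then have "y = K *v (matrix_inv K *v y)" by (simp add: matrix_vector_mul_assoc matrix_inv_cancel)
  then obtain x :: "complex^4" where "y = x $ 1 *s l p + x $ 2 *s jmap (l p) + x $ 3 *s u + x $ 4 *s jmap u"
    unfolding K_def cols4_mult by blast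
  then have "B *v y \<in> L p"
    using BL[OF lp(1)] BL[OF L_facts(4)[OF top lp(1)]] Bu Bju
    by (auto simp: matrix_vector_simps intro!: sub)
  then show ?thesis by (simp add: B_def w_def)
qed

end

section \<open>Dressing a constrained Willmore surface\<close>

lemma sm_dress: assumes "surface X A" "surface.sm X A B N P"
  shows "surface.sm X A B N (\<lambda>x. dress k l (P x))"
proof -
  interpret surface X A by fact
  have s: "sm B N P" by fact
  show ?thesis unfolding dress_def
    by (intro sm_add sm_linear[OF bounded_bilinear.bounded_linear_right[OF bb_ks]] sm_diff sm_const s
        sm_open[OF s])
qed

text \<open>W enters only through P, the projection onto W along jW; a and b are the zero and the
  pole of r_\<alpha>. \<open>ddP\<close> says that W is parallel at \<mu> = a and jW at \<mu> = b,
  \<open>inv0\<close> that the new eigenbundles are complementary, and \<open>L'\<close> is the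
  transform.\<close>

locale dressed = willmore X A \<kappa> J S q L for X :: "'m topology" and A :: "'m chart set" and \<kappa> ::
    complex
    and J :: "('m, real^2) form" and S :: "'m \<Rightarrow> complex^4^4" and q :: "('m, complex^4^4) form"
    and L :: "'m \<Rightarrow> (complex^4) set" +
  fixes P :: "'m \<Rightarrow> complex^4^4" and s a b :: complex and L' :: "'m \<Rightarrow> (complex^4) set"
  assumes sP: "sm A (topspace X) P" and PP: "\<And>p. p \<in> topspace X \<Longrightarrow> P p ** P p = P p"
    and jP: "\<And>p. p \<in> topspace X \<Longrightarrow> jc (P p) = mat 1 - P p"
    and nz: "a \<noteq> 0" "b \<noteq> 0" "a \<noteq> 1" "b \<noteq> 1" "b \<noteq> -1" "a \<noteq> -1"
        "s \<noteq> 0"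
    and s: "s * s = (1 - b) * a / ((1 - a) * b)" and t: "cnj s * cnj s = (1 - a) / (1 - b)"
    and ddP: "\<And>c p v. c \<in> A \<Longrightarrow> p \<in> dom_ch c \<Longrightarrow> dd c P p v =
       P p ** ((inverse b - 1) *k (Phi S q c p v ** PiM (S p)) + (b - 1) *k (Phi S q c p v ** PiP (S p))) ** (mat 1 - P p)
       - (mat 1 - P p) ** ((inverse a - 1) *k (Phi S q c p v ** PiM (S p)) + (a - 1) *k (Phi S q c p v ** PiP (S p))) ** P p"
    and inv0: "\<And>p. p \<in> topspace X \<Longrightarrow>
       invertible (dress s (inverse s) (P p) ** PiP (S p) + dress (inverse (cnj s)) (cnj s) (P p) ** PiM (S p))"
    and L'_eq: "\<And>p. p \<in> topspace X \<Longrightarrow> dressing_algebra.Ls (S p) (P p) s (L p) = L' p"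
begin

definition "rz p = dress s (inverse s) (P p)"
definition "rzi p = dress (inverse s) s (P p)"
definition "ri p = dress (inverse (cnj s)) (cnj s) (P p)"
definition "rii p = dress (cnj s) (inverse (cnj s)) (P p)"
definition "RR p = rz p ** PiP (S p) + ri p ** PiM (S p)"
definition "S' p = RR p ** S p ** matrix_inv (RR p)"
definition "psi1 c p v = rz p ** (Phi S q c p v ** PiM (S p)) ** rzi p"
definition "psi2 c p v = ri p ** (Phi S q c p v ** PiP (S p)) ** rii p"
text \<open>\<open>psi1\<close> lives on the eigenspace of \<open>S'\<close> for -\<i> and
  \<open>psi2\<close> on the one for \<i>, so these are the diagonal blocks of
  \<open>psi1 + psi2\<close>; the off-diagonal blocks are left for the Hopf field Q of
  \<open>S'\<close>.\<close>

definition "q' c p v = PiM (S' p) ** psi1 c p v + PiP (S' p) ** psi2 c p v"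
lemma da: "p \<in> topspace X \<Longrightarrow> dressing_algebra (S p) (P p) s"
  using SS jS PP jP nz by unfold_locales auto

lemma da_eqs:
  assumes "p \<in> topspace X"
  shows "dressing_algebra.Rz (P p) s = rz p" "dressing_algebra.Rzi (P p) s = rzi p"
    "dressing_algebra.Ri (P p) s = ri p" "dressing_algebra.Rii (P p) s = rii p"
    "dressing_algebra.R (S p) (P p) s = RR p" "dressing_algebra.Ss (S p) (P p) s = S' p"
    "dressing_algebra.Ps1 (S p) (P p) s (Phi S q c p v) = psi1 c p v"
    "dressing_algebra.Ps2 (S p) (P p) s (Phi S q c p v) = psi2 c p v"
    "dressing_algebra.Ls (S p) (P p) s (L p) = L' p"
    "invertible (RR p)"
proof -
  interpret D: dressing_algebra "S p" "P p" s by (rule da[OF assms])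
  show e: "D.Rz = rz p" "D.Rzi = rzi p" "D.Ri = ri p" "D.Rii = rii p"
    by (simp_all add: D.Rz_def D.Rzi_def D.Ri_def D.Rii_def rz_def rzi_def ri_def rii_def)
  then show R: "D.R = RR p" by (simp add: D.R_def RR_def)
  then show Ss: "D.Ss = S' p" by (simp add: D.Ss_def S'_def)
  show "D.Ps1 (Phi S q c p v) = psi1 c p v" "D.Ps2 (Phi S q c p v) = psi2 c p v"
    by (simp_all add: D.Ps1_def D.Ps2_def psi1_def psi2_def e)
  show i: "invertible (RR p)" using inv0[OF assms] by (simp add: RR_def rz_def ri_def)
  show "D.Ls (L p) = L' p" by (rule L'_eq[OF assms])
qed

lemma sm_all: "sm A (topspace X) rz" "sm A (topspace X) ri" "sm A (topspace X) rzi" "sm A (topspace X) rii"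
    "sm A (topspace X) RR" "sm A (topspace X) S'"
    "sm A (topspace X) (\<lambda>x. PiP (S x))" "sm A (topspace X) (\<lambda>x. PiM (S x))"
    "sm A (topspace X) (\<lambda>x. PiP (S' x))" "sm A (topspace X) (\<lambda>x. PiM (S' x))"
proof -
  show r: "sm A (topspace X) rz" "sm A (topspace X) ri" "sm A (topspace X) rzi" "sm A (topspace X) rii"
    unfolding rz_def[abs_def] ri_def[abs_def] rzi_def[abs_def] rii_def[abs_def]
    by (rule sm_dress[OF surface_axioms sP])+
  have pi: "sm A (topspace X) (\<lambda>x. PiP (T x))" "sm A (topspace X) (\<lambda>x. PiM (T x))" if
      "sm A (topspace X) T" for T
    unfolding PiP_def PiM_def
    by (intro sm_linear[OF bl_mscale] sm_diff sm_add sm_const that sm_open[OF that])+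
  show p: "sm A (topspace X) (\<lambda>x. PiP (S x))" "sm A (topspace X) (\<lambda>x. PiM (S x))" using pi[OF sS]
      by auto
  show R: "sm A (topspace X) RR" unfolding RR_def[abs_def]
    by (intro sm_add sm_bilinear[OF bb_mm] r p)
  show S': "sm A (topspace X) S'" unfolding S'_def[abs_def]
    by (intro sm_bilinear[OF bb_mm] R sS sm_matrix_inv) (use da_eqs(10) in auto)
  show "sm A (topspace X) (\<lambda>x. PiP (S' x))" "sm A (topspace X) (\<lambda>x. PiM (S' x))" using pi[OF S'] by
      auto
qed

lemma chart_sm: "sm A (topspace X) f \<Longrightarrow> c \<in> A \<Longrightarrow> sm {c} (dom_ch c) f"
  by (rule sm_subset) (auto simp: chart_facts in_top)

lemma S'_facts: assumes "p \<in> topspace X" shows "S' p ** S' p = - mat 1" "jc (S' p) = S' p"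
proof -
  interpret D: dressing_algebra "S p" "P p" s by (rule da[OF assms])
  show "S' p ** S' p = - mat 1" "jc (S' p) = S' p"
    using D.Ss_props da_eqs[OF assms] by simp_all
qed

lemma psi_kernel:
  assumes "p \<in> topspace X"
  shows "psi1 c p v ** PiP (S' p) = 0" "psi2 c p v ** PiM (S' p) = 0" "psi1 c p v ** PiM (S' p) = psi1 c p v"
      "psi2 c p v ** PiP (S' p) = psi2 c p v"
proof -
  interpret D: dressing_algebra "S p" "P p" s by (rule da[OF assms])
  show "psi1 c p v ** PiP (S' p) = 0" "psi2 c p v ** PiM (S' p) = 0" "psi1 c p v ** PiM (S' p) = psi1 c p v"
      "psi2 c p v ** PiP (S' p) = psi2 c p v"
    using D.Ps_kernel[of "Phi S q c p v"] da_eqs[OF assms] by simp_all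
qed

lemma psi_type:
  assumes c: "c \<in> A" "p \<in> dom_ch c"
  shows "psi1 c p (J c p v) = \<i> *k psi1 c p v" "psi2 c p (J c p v) = - (\<i> *k psi2 c p v)"
  unfolding psi1_def psi2_def Phi_type[OF c] by (simp_all add: mat_alg)

lemma jc_psi:
  assumes c: "c \<in> A" "p \<in> dom_ch c"
  shows "jc (psi1 c p v) = psi2 c p v" "jc (psi2 c p v) = psi1 c p v"
proof -
  interpret D: dressing_algebra "S p" "P p" s by (rule da[OF in_top[OF c]])
  show "jc (psi1 c p v) = psi2 c p v" "jc (psi2 c p v) = psi1 c p v"
    using D.jc_Ps[of "Phi S q c p v"] da_eqs[OF in_top[OF c]] jc_Phi[OF c] by simp_all
qed

lemma form_psi: assumes c: "c \<in> A" shows "smooth_form c psi1" "smooth_form c psi2"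
  unfolding psi1_def[abs_def] psi2_def[abs_def]
  by (intro form_mult form_Phi chart_sm sm_all c)+

lemma form_q': assumes c: "c \<in> A" shows "smooth_form c q'"
  unfolding q'_def[abs_def]
  by (intro form_add(1) form_mult(1) form_psi chart_sm sm_all c)

sublocale star: sphere_form X A J S' q'
proof unfold_locales
  show "sm A (topspace X) S'" by (rule sm_all)
  show "S' p ** S' p = - mat 1" if "p \<in> topspace X" for p by (rule S'_facts[OF that])
  show "smooth_form c q'" if "c \<in> A" for c by (rule form_q'[OF that])
  fix c p v assume c: "c \<in> A" "p \<in> dom_ch c"
  note pi = Pi_simps[OF S'_facts(1)[OF in_top[OF c]]]
  note k = psi_kernel[OF in_top[OF c], of c v]
  have k2: "psi1 c p v ** S' p = - (\<i> *k psi1 c p v)" "psi2 c p v ** S' p = \<i> *k psi2 c p v"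
  proof -
    have "psi1 c p v ** S' p = psi1 c p v ** (PiM (S' p) ** S' p)" using k(3) by (metis matrix_mul_assoc)
    then show "psi1 c p v ** S' p = - (\<i> *k psi1 c p v)" by (simp add: pi mat_alg k)
    have "psi2 c p v ** S' p = psi2 c p v ** (PiP (S' p) ** S' p)" using k(4) by (metis matrix_mul_assoc)
    then show "psi2 c p v ** S' p = \<i> *k psi2 c p v" by (simp add: pi mat_alg k)
  qed
  show "q' c p v ** S' p = S' p ** q' c p v"
    by (simp add: q'_def mat_alg k2 assoc_rule[OF pi(1)] assoc_rule[OF pi(2)])
  show "q' c p (J c p v) = - (S' p ** q' c p v)"
    by (simp add: q'_def psi_type[OF c] mat_alg assoc_rule[OF pi(1)] assoc_rule[OF pi(2)])
qed

section \<open>Gauge equations for the dressing matrices and flatness of the dressed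
  connection\<close>

lemma del_P:
  assumes c: "c \<in> A" "p \<in> dom_ch c"
  shows "del c P p v = (inverse b - 1) *k (P p ** (Phi S q c p v ** PiM (S p)) ** (mat 1 - P p)) + (1 - inverse a)
      *k ((mat 1 - P p) ** (Phi S q c p v ** PiM (S p)) ** P p)"
    "delb c P p v = (b - 1) *k (P p ** (Phi S q c p v ** PiP (S p)) ** (mat 1 - P p)) + (1 - a) *k
        ((mat 1 - P p) ** (Phi S q c p v ** PiP (S p)) ** P p)"
  unfolding del_def delb_def ddP[OF c] Phi_type[OF c]
  by (simp_all add: mat_alg) (simp_all add: vec_eq_iff field_simps)

lemma t_nz: "cnj s \<noteq> 0" using nz by simp

definition "kk = (1 - b) * (1 + a) / ((1 - a) * (1 + b))"

lemma kk_nz: "kk \<noteq> 0"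
  using nz by (auto simp: kk_def add_eq_0_iff)

lemmas mult_ids = multiplier_identities[OF nz(1-5) nz(7) t_nz s t kk_def]

text \<open>Both halves, of type (1,0) and (0,1), are instances of \<open>dress_gauge\<close> with
  \<theta> = 2, one dressed by r(0) and the other by r(\<infinity>); the common factor 2 is the
  coefficient of \<Phi> at \<mu> = -1 up to sign.\<close>

lemma gauge_minus_one:
  assumes c: "c \<in> A" "p \<in> dom_ch c"
  shows "dd c (\<lambda>x. dress kk 1 (P x)) p v =
    2 *k ((psi1 c p v + psi2 c p v) ** dress kk 1 (P p) - dress kk 1 (P p) ** Phi S q c p v)"
proof -
  note p = insertI1 c(2) c(2) and sP' = chart_sm[OF sP c(1)]
  have 1: "(kk - 1) *k del c P p v = 2 *k (psi1 c p v ** dress kk 1 (P p) - dress kk 1 (P p) **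
      (Phi S q c p v ** PiM (S p)))"
    unfolding psi1_def rz_def rzi_def
    by (rule dress_gauge[OF PP[OF in_top[OF c]] kk_nz _ del_P(1)[OF c] mult_ids(1) mult_ids(2) nz(7)]) simp
  have 2: "(kk - 1) *k delb c P p v = 2 *k (psi2 c p v ** dress kk 1 (P p) - dress kk 1 (P p) **
      (Phi S q c p v ** PiP (S p)))"
    unfolding psi2_def ri_def rii_def
    using dress_gauge[OF PP[OF in_top[OF c]] kk_nz _ del_P(2)[OF c], of 1 2 "inverse (cnj s)"] mult_ids(3,4) t_nz
        by simp
  have k: "sm {c} (dom_ch c) (\<lambda>x. mat 1 :: complex^4^4)" using c chart_facts(1)[OF c(1)] by
      (simp add: sm_const)
  have "(\<lambda>x. dress kk 1 (P x)) = (\<lambda>x. (kk - 1) *k P x + mat 1)" by (simp add: dress_def fun_eq_iff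
      vec_eq_iff algebra_simps)
  then have "dd c (\<lambda>x. dress kk 1 (P x)) p v = (kk - 1) *k dd c P p v"
    using dd_add[OF sm_linear[OF bl_mscale sP'] k p] dd_linear[OF bl_mscale sP' p]
        dd_const[of c "mat 1 :: complex^4^4"] by simp
  also have "\<dots> = (kk - 1) *k del c P p v + (kk - 1) *k delb c P p v" by
      (simp add: dd_del[of c P] mscale_simps)
  finally have "dd c (\<lambda>x. dress kk 1 (P x)) p v = (kk - 1) *k del c P p v + (kk - 1) *k delb c P p v" .
  moreover have "Phi S q c p v = Phi S q c p v ** PiM (S p) + Phi S q c p v ** PiP (S p)"
    by (metis Pi_sum add.commute matrix_mul_rid matrix_add_ldistrib)
  ultimately show ?thesis unfolding 1 2
    by (metis (no_types, lifting) add_diff_add matrix_add_ldistrib matrix_ring_simps(3) mscale_simps(4))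
qed

text \<open>At \<mu> = \<infinity> the (1,0)-coefficient 1/\<mu> - 1 becomes -1, so r(\<infinity>)
  gauges \<partial> - \<Phi>' to \<partial> - \<open>psi1\<close>; this is
  \<open>dress_gauge\<close> with \<theta> = 1.\<close>

lemma del_ri:
  assumes c: "c \<in> A" "p \<in> dom_ch c"
  shows "del c ri p v = psi1 c p v ** ri p - ri p ** (Phi S q c p v ** PiM (S p))"
proof -
  note p = insertI1 c(2) c(2) and sP' = chart_sm[OF sP c(1)]
  have k: "sm {c} (dom_ch c) (\<lambda>x. cnj s *k mat 1 :: complex^4^4)" using c chart_facts(1)[OF c(1)] by
      (simp add: sm_const)
  have "ri = (\<lambda>x. (inverse (cnj s) - cnj s) *k P x + cnj s *k mat 1)" by
      (simp add: ri_def dress_def fun_eq_iff vec_eq_iff algebra_simps)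
  then have "del c ri p v = (inverse (cnj s) - cnj s) *k del c P p v"
    using del_add(1)[OF sm_linear[OF bl_mscale sP'] k p] del_scale(1)[OF sP' p] del_const[of c "cnj s *k mat 1"] by
        simp
  also have "\<dots> = 1 *k (psi1 c p v ** ri p - ri p ** (Phi S q c p v ** PiM (S p)))"
    unfolding psi1_def rz_def rzi_def ri_def
    by (rule dress_gauge[OF PP[OF in_top[OF c]] _ t_nz del_P(1)[OF c] mult_ids(5) mult_ids(6) nz(7)])
        (use t_nz in simp)
  finally show ?thesis by (simp add: mscale_simps)
qed

text \<open>S_+ is annihilated by \<Phi>', so \<open>dress_kernel\<close> applies. Only the factor
  \<open>psi1\<close> on the left matters later, since \<open>psi1\<close> followed by
  \<open>PiM (S' p)\<close> has its values in \<open>L'\<close>.\<close>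

lemma del_rz:
  assumes c: "c \<in> A" "p \<in> dom_ch c"
  shows "\<exists>K. del c rz p v ** PiP (S p) = psi1 c p v ** K"
proof -
  note p = insertI1 c(2) c(2) and sP' = chart_sm[OF sP c(1)]
  have k: "sm {c} (dom_ch c) (\<lambda>x. inverse s *k mat 1 :: complex^4^4)" using c chart_facts(1)[OF c(1)] by
      (simp add: sm_const)
  have "rz = (\<lambda>x. (s - inverse s) *k P x + inverse s *k mat 1)" by (simp add: rz_def dress_def fun_eq_iff
      vec_eq_iff algebra_simps)
  then have 1: "del c rz p v = (s - inverse s) *k del c P p v"
    using del_add(1)[OF sm_linear[OF bl_mscale sP'] k p] del_scale(1)[OF sP' p]
        del_const[of c "inverse s *k mat 1"] by simp
  have "del c P p v ** PiP (S p) = (- (inverse b - 1)) *k (psi1 c p v ** (P p ** PiP (S p)))"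
    unfolding psi1_def rz_def rzi_def
    by (rule dress_kernel[OF PP[OF in_top[OF c]] del_P(1)[OF c] mult_ids(7) nz(7)])
      (simp add: matrix_ring_simps Pi_simps[OF SS[OF in_top[OF c]]])
  then have "del c rz p v ** PiP (S p) = psi1 c p v ** (((s - inverse s) * (- (inverse b - 1))) *k
      (P p ** PiP (S p)))"
    unfolding 1 by (simp add: mscale_simps)
  then show ?thesis by blast
qed

lemma curv_psi:
  assumes c: "c \<in> A" "p \<in> dom_ch c"
  shows "curv (\<lambda>c p v. psi1 c p v + psi2 c p v) c p v (J c p v) = 0"
proof -
  have "curv (\<lambda>c p v. psi1 c p v + psi2 c p v) c p v (J c p v) ** dress kk 1 (P p) = dress kk 1 (P p) **
      curv (Phi S q) c p v (J c p v)"
    by (rule gauge_curvature[OF form_Phi[OF c(1)] form_add(1)[OF form_psi[OF c(1)]] _ c(2)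
        gauge_minus_one[OF c(1)]])
      (intro chart_sm sm_dress[OF surface_axioms sP] c)
  then have "curv (\<lambda>c p v. psi1 c p v + psi2 c p v) c p v (J c p v) ** dress kk 1 (P p) = 0"
    by (simp add: flat[OF c] matrix_ring_simps)
  then have "curv (\<lambda>c p v. psi1 c p v + psi2 c p v) c p v (J c p v) **
      (dress kk 1 (P p) ** dress (inverse kk) (inverse 1) (P p)) = 0"
    by (simp only: matrix_mul_assoc) (simp only: matrix_ring_simps)
  then show ?thesis using dress_inverse(1)[OF PP[OF in_top[OF c]] kk_nz, of 1] by simp
qed

lemma Pi_S'_R:
  assumes "p \<in> topspace X"
  shows "PiM (S' p) ** (rz p ** PiP (S p)) = 0" "PiP (S' p) ** (ri p ** PiM (S p)) = 0"
    "PiP (S' p) = rz p ** (PiP (S p) ** matrix_inv (RR p))" "PiM (S' p) = ri p ** (PiM (S p) ** matrix_inv (RR p))"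
proof -
  interpret D: dressing_algebra "S p" "P p" s by (rule da[OF assms])
  show "PiM (S' p) ** (rz p ** PiP (S p)) = 0" "PiP (S' p) ** (ri p ** PiM (S p)) = 0"
    "PiP (S' p) = rz p ** (PiP (S p) ** matrix_inv (RR p))" "PiM (S' p) = ri p ** (PiM (S p) ** matrix_inv (RR p))"
    using D.Pi_Ss_R da_eqs[OF assms] by simp_all
qed

text \<open>Differentiate \<open>\<Pi>*\<^sub>+ r(\<infinity>) \<Pi>\<^sub>- = 0\<close>; the operator \<open>\<partial> - \<Phi>'\<close> is gauged by \<open>r(\<infinity>)\<close> and preserves \<open>S\<^sub>-\<close>.\<close>

lemma psi1_PiP:
  assumes c: "c \<in> A" "p \<in> dom_ch c"
  shows "PiP (S' p) ** psi1 c p v = (\<i> / 2) *k (del c S' p v ** PiM (S' p))"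
proof -
  note top = in_top[OF c] and p = insertI1 c(2) c(2)
  define Q where "Q = PiP (S' p)"
  define F where "F = Phi S q c p v ** PiM (S p)"
  have z: "Q ** (ri p ** PiM (S p)) = 0" unfolding Q_def by (rule Pi_S'_R(2)[OF top])
  \<comment> \<open>By \<open>z\<close> the product \<open>Q ** ri p\<close> does not see S_-
    components.\<close>
  have z': "Q ** (ri p ** T) = Q ** (ri p ** (PiP (S p) ** T))" for T :: "complex^4^4"
  proof -
    have "Q ** (ri p ** (PiM (S p) ** T)) = (Q ** (ri p ** PiM (S p))) ** T" by (simp add: matrix_ring_simps)
    then have "Q ** (ri p ** ((PiP (S p) + PiM (S p)) ** T)) = Q ** (ri p ** (PiP (S p) ** T))"
      unfolding z by (simp add: matrix_ring_simps)
    then show ?thesis by (simp add: Pi_sum)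
  qed
  note sr = chart_sm[OF sm_all(2) c(1)] and sPM = chart_sm[OF sm_all(8) c(1)] and sQ = chart_sm[OF sm_all(9) c(1)]
  have "del c (\<lambda>x. PiP (S' x) ** (ri x ** PiM (S x))) p v = del c (\<lambda>x. 0) p v"
    unfolding del_def using dd_cong[OF c(1) chart_facts(1)[OF c(1)] c(2) c(2), of
        "\<lambda>x. PiP (S' x) ** (ri x ** PiM (S x))" "\<lambda>x. 0"]
      Pi_S'_R(2)[OF in_top[OF c(1)]] by simp
  then have d: "del c (\<lambda>x. PiP (S' x)) p v ** (ri p ** PiM (S p)) + Q ** (del c ri p v ** PiM (S p) + ri p
      ** ((\<i> / 2) *k del c S p v)) = 0"
    unfolding del_mult(1)[OF sQ sm_bilinear[OF bb_mm sr sPM] p] del_mult(1)[OF sr sPM p] del_const del_Pi(2)[OF c]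
        Q_def .
  have FM: "F ** PiM (S p) = F" by (simp add: F_def matrix_ring_simps Pi_simps[OF SS[OF top]])
  \<comment> \<open>\<partial> of \<open>PiM S\<close> and \<Phi>' have the same S_+ component by
    the first sphere identity, so one may replace the other behind \<open>Q ** ri p\<close>.\<close>
  have "Q ** (ri p ** ((\<i> / 2) *k del c S p v)) = Q ** (ri p ** (PiP (S p) ** F))"
    using z'[of "(\<i> / 2) *k del c S p v"] sphere_identities(1)[OF c] by (simp add: F_def)
  also have "\<dots> = Q ** (ri p ** F)" using z' by simp
  finally have "Q ** (del c ri p v ** PiM (S p) + ri p ** ((\<i> / 2) *k del c S p v)) = Q **
      (psi1 c p v ** (ri p ** PiM (S p)))"
    unfolding del_ri[OF c] F_def[symmetric] by (simp add: matrix_ring_simps FM)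
  with d have "del c (\<lambda>x. PiP (S' x)) p v ** (ri p ** PiM (S p)) + Q ** (psi1 c p v ** (ri p ** PiM (S p)))
      = 0" by simp
  \<comment> \<open>The inverse of \<open>RR p\<close> turns \<open>ri p ** PiM (S p)\<close> into
    \<open>PiM (S' p)\<close>.\<close>
  then have "(del c (\<lambda>x. PiP (S' x)) p v ** (ri p ** PiM (S p)) + Q ** (psi1 c p v ** (ri p ** PiM (S p))))
      ** matrix_inv (RR p) = 0"
    by (simp add: matrix_ring_simps)
  then have "del c (\<lambda>x. PiP (S' x)) p v ** PiM (S' p) + Q ** (psi1 c p v ** PiM (S' p)) = 0"
    unfolding Pi_S'_R(4)[OF top] by (simp add: matrix_ring_simps)
  then have "Q ** psi1 c p v = - (del c (\<lambda>x. PiP (S' x)) p v ** PiM (S' p))"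
    unfolding psi_kernel[OF top] by (simp add: add_eq_0_iff)
  also have "\<dots> = (\<i> / 2) *k (del c S' p v ** PiM (S' p))"
    unfolding star.del_Pi(1)[OF c] by (simp add: mscale_simps) (simp add: vec_eq_iff)
  finally show ?thesis by (simp add: Q_def)
qed

lemma jc_dS': assumes c: "c \<in> A" "p \<in> dom_ch c" shows "jc (dd c S' p v) = dd c S' p v"
proof -
  have "dd c (\<lambda>x. jc (S' x)) p v = dd c S' p v"
    by (rule dd_cong[OF c(1) chart_facts(1)[OF c(1)] c(2) c(2)]) (use S'_facts in_top[OF c(1)] in auto)
  then show ?thesis using dd_linear[OF bl_jc star.sS_chart[OF c(1)] insertI1 c(2) c(2), of v] by simp
qed

text \<open>One off-diagonal block of \<open>psi1 + psi2\<close> is identified with the Hopf field Q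
  of \<open>S'\<close> by \<open>psi1_PiP\<close>, the other by conjugation with j; the diagonal
  blocks are \<open>q'\<close> by construction.\<close>

lemma Phi_star_eq:
  assumes c: "c \<in> A" "p \<in> dom_ch c"
  shows "(1/4) *k (S' p ** dd c S' p v + dd c S' p (J c p v)) = PiP (S' p) ** psi1 c p v + PiM (S' p) ** psi2 c p
      v"
    and "Phi S' q' c p v = psi1 c p v + psi2 c p v"
proof -
  note top = in_top[OF c]
  define Q where "Q = (1/4) *k (S' p ** dd c S' p v + dd c S' p (J c p v))"
  have 1: "Q ** PiM (S' p) = PiP (S' p) ** psi1 c p v"
    unfolding Q_def star.sphere_identities(2)[OF c] psi1_PiP[OF c] ..
  have "jc Q = Q" by (simp add: Q_def jc_simps jc_dS'[OF c] S'_facts[OF top])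
  then have 2: "Q ** PiP (S' p) = PiM (S' p) ** psi2 c p v"
    using arg_cong[OF 1, of jc] by (simp add: jc_simps jc_Pi[OF S'_facts(2)[OF top]] jc_psi[OF c])
  have "Q = Q ** PiM (S' p) + Q ** PiP (S' p)" by (metis Pi_sum add.commute matrix_mul_rid matrix_add_ldistrib)
  then show 3: "Q = PiP (S' p) ** psi1 c p v + PiM (S' p) ** psi2 c p v" unfolding 1 2 .
  have "Phi S' q' c p v = (PiP (S' p) + PiM (S' p)) ** psi1 c p v + (PiP (S' p) + PiM (S' p)) ** psi2 c p v"
    unfolding star.Phi_alt[OF c] Q_def[symmetric] 3 q'_def by (simp add: matrix_ring_simps algebra_simps)
  then show "Phi S' q' c p v = psi1 c p v + psi2 c p v" by (simp add: Pi_sum)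
qed

lemma star_equations:
  assumes c: "c \<in> A" "p \<in> dom_ch c"
  shows "ext_deriv (NS S') q' c p v w = 0"
    "ext_deriv (NS S') (star J (NS S')) c p v w = 2 *\<^sub>R bracket_wedge q' (star J (NS S')) c p v w"
proof -
  have "curv (Phi S' q') c p v (J c p v) = 0" for v
  proof -
    have "dd c (\<lambda>x. Phi S' q' c x u) p w = dd c (\<lambda>x. psi1 c x u + psi2 c x u) p w" for u w
      by (rule dd_cong[OF c(1) chart_facts(1)[OF c(1)] c(2) c(2)]) (rule Phi_star_eq(2)[OF c(1)])
    then show ?thesis using curv_psi[OF c, of v] unfolding curv_def Phi_star_eq(2)[OF c] by simp
  qed
  then show "ext_deriv (NS S') q' c p v w = 0"
    "ext_deriv (NS S') (star J (NS S')) c p v w = 2 *\<^sub>R bracket_wedge q' (star J (NS S')) c p v w"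
    using star.Willmore_iff_flat[OF c] by blast+
qed

end

section \<open>The transformed surface\<close>

lemma metric2_sym: assumes "T \<in> Wedge2" "U \<in> Wedge2" shows "metric2 \<kappa> T U = metric2 \<kappa> U T"
proof -
  have w: "metric2 \<kappa> (wedge x y) (wedge z w) = metric2 \<kappa> (wedge z w) (wedge x y)" for x y z w
  proof -
    have "vol \<kappa> z w x y = - vol \<kappa> z x w y" by (rule vol_swap(3))
    also have "vol \<kappa> z x w y = - vol \<kappa> z x y w" by (rule vol_swap(2))
    also have "vol \<kappa> z x y w = - vol \<kappa> x z y w" by (rule vol_swap(1))
    also have "vol \<kappa> x z y w = - vol \<kappa> x y z w" by (rule vol_swap(3))
    finally show ?thesis by (simp add: metric2_wedge)
  qed
  have h: "metric2 \<kappa> T (wedge z w) = metric2 \<kappa> (wedge z w) T" for z w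
    using assms(1) by (induction rule: Wedge2_induct) (simp_all add: w metric2_simps)
  show ?thesis using assms(2) by (induction rule: Wedge2_induct) (simp_all add: h metric2_simps)
qed

lemma metric2_diff: "metric2 \<kappa> (T - T') U = metric2 \<kappa> T U - metric2 \<kappa> T' U"
    "metric2 \<kappa> T (U - U') = metric2 \<kappa> T U - metric2 \<kappa> T U'"
proof -
  have n: "x - y = x + (-1) *s y" for x y :: tensor2 by (simp add: vec_eq_iff)
  show "metric2 \<kappa> (T - T') U = metric2 \<kappa> T U - metric2 \<kappa> T' U" unfolding n metric2_simps by
      simp
  show "metric2 \<kappa> T (U - U') = metric2 \<kappa> T U - metric2 \<kappa> T U'" unfolding n metric2_simps by
      simp
qed

text \<open>b plays the role of a \<circ> J. Adding the two isotropy conditions shows that a v and b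
  v have the same square, and polarisation gives the rest.\<close>

lemma conformal_from_isotropic:
  fixes a b :: "real^2 \<Rightarrow> tensor2"
  assumes lin: "linear a" "linear b" and mem: "\<And>v. a v \<in> Wedge2" "\<And>v. b v \<in> Wedge2"
    and 1: "\<And>v. metric2 \<kappa> (a v - \<i> *s b v) (a v - \<i> *s b v) = 0"
    and 2: "\<And>v. metric2 \<kappa> (a v + \<i> *s b v) (a v + \<i> *s b v) = 0"
  shows "metric2 \<kappa> (b v) (b w) = metric2 \<kappa> (a v) (a w)"
proof -
  have d: "metric2 \<kappa> (a v) (a v) = metric2 \<kappa> (b v) (b v)" for v
  proof -
    have "2 * (metric2 \<kappa> (a v) (a v) - metric2 \<kappa> (b v) (b v)) =
       metric2 \<kappa> (a v - \<i> *s b v) (a v - \<i> *s b v) + metric2 \<kappa> (a v + \<i> *s b v) (a v + \<i> *s b v)"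
      by (simp add: metric2_simps metric2_diff algebra_simps)
    then show ?thesis unfolding 1 2 by simp
  qed
  have "2 * metric2 \<kappa> (a v) (a w) = 2 * metric2 \<kappa> (b v) (b w)"
    using d[of "v + w"] d[of v] d[of w] metric2_sym[OF mem(1) mem(1), of \<kappa> w v]
        metric2_sym[OF mem(2) mem(2), of \<kappa> w v]
    by (simp add: linear_add[OF lin(1)] linear_add[OF lin(2)] metric2_simps)
  then show ?thesis by simp
qed

section \<open>The mean curvature sphere conditions for the transform\<close>

context dressed begin

lemma L'_facts:
  assumes p: "p \<in> topspace X"
  shows "vec.subspace (L' p)" "jmap ` L' p = L' p" "(\<lambda>x. S' p *v x) ` L' p = L' p"
    "x \<in> L' p \<Longrightarrow> PiP (S' p) *v x \<in> L' p"
        "x \<in> L' p \<Longrightarrow> PiM (S' p) *v x \<in> L' p"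
    "PiP (S p) *v x \<in> L p \<Longrightarrow> PiP (S' p) *v (ri p *v x) \<in> L' p"
    "PiM (S p) *v x \<in> L p \<Longrightarrow> PiM (S' p) *v (rz p *v x) \<in> L' p"
    "x \<in> L' p \<Longrightarrow> PiP (S' p) *v x = x \<Longrightarrow> PiP (S p) *v (rii p *v x) \<in> L p"
    "PiP (S p) *v l = l \<Longrightarrow> PiP (S p) *v (rii p *v (PiP (S' p) *v (ri p *v l))) = l"
    "x \<in> L' p \<Longrightarrow> PiP (S' p) *v x = x \<Longrightarrow> \<exists>l\<in>L p. PiP (S p) *v l = l
        \<and> x = PiP (S' p) *v (ri p *v l)"
    "ri p *v (rii p *v x) = x"
proof -
  interpret D: dressing_algebra "S p" "P p" s by (rule da[OF p])
  have inv: "invertible D.R" using da_eqs[OF p] by simp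
  note ctx = inv L_facts(1)[OF p] L_facts(3)[OF p] W_S(3)[OF p]
  note e = da_eqs[OF p]
  show "vec.subspace (L' p)" using D.subspace_Ls[OF ctx] unfolding e .
  show "jmap ` L' p = L' p" using D.jmap_Ls_eq[OF ctx] unfolding e .
  show "(\<lambda>x. S' p *v x) ` L' p = L' p" using D.Ss_Ls_eq[OF ctx] unfolding e .
  show "x \<in> L' p \<Longrightarrow> PiP (S' p) *v x \<in> L' p"
      "x \<in> L' p \<Longrightarrow> PiM (S' p) *v x \<in> L' p"
    using D.Pi_Ls[OF ctx, of x] unfolding e by simp_all
  show "PiP (S p) *v x \<in> L p \<Longrightarrow> PiP (S' p) *v (ri p *v x) \<in> L' p"
    using D.Lp_in_Ls[OF ctx D.Ls_from_Ri[OF ctx]] unfolding e .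
  show "PiM (S p) *v x \<in> L p \<Longrightarrow> PiM (S' p) *v (rz p *v x) \<in> L' p"
    using D.Ls_from_Rz[OF ctx] unfolding e .
  show "PiP (S p) *v l = l \<Longrightarrow> PiP (S p) *v (rii p *v (PiP (S' p) *v (ri p *v l))) = l"
    using D.Lp_inverse[OF ctx] unfolding e .
  have Lp: "x \<in> D.Lp (L p)" if "x \<in> L' p" "PiP (S' p) *v x = x" for x
    using that D.Ls_iff[OF ctx, of x] unfolding e by simp
  show "x \<in> L' p \<Longrightarrow> PiP (S' p) *v x = x \<Longrightarrow> PiP (S p) *v (rii p *v x) \<in> L p"
    using D.Lp_back[OF ctx Lp] unfolding e by blast
  show "x \<in> L' p \<Longrightarrow> PiP (S' p) *v x = x \<Longrightarrow> \<exists>l\<in>L p. PiP (S p) *v l = l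
      \<and> x = PiP (S' p) *v (ri p *v l)"
    using Lp[of x] unfolding D.Lp_def[OF inv] e by blast
  show "ri p *v (rii p *v x) = x" using D.R_inv(3) unfolding e by (simp add: matrix_vector_mul_assoc)
qed

lemma psi_L':
  assumes c: "c \<in> A" "p \<in> dom_ch c"
  shows "x \<in> L' p \<Longrightarrow> psi1 c p v *v x = 0" "x \<in> L' p \<Longrightarrow> psi2 c p v *v x = 0"
    "PiM (S' p) *v (psi1 c p v *v x) \<in> L' p" "PiP (S' p) *v (psi2 c p v *v x) \<in> L' p"
proof -
  note p = in_top[OF c]
  interpret D: dressing_algebra "S p" "P p" s by (rule da[OF p])
  have inv: "invertible D.R" using da_eqs[OF p] by simp
  note ctx = inv L_facts(1)[OF p] L_facts(3)[OF p] W_S(3)[OF p]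
  note e = da_eqs[OF p]
  show "x \<in> L' p \<Longrightarrow> psi1 c p v *v x = 0" using D.Ps1_Ls[OF ctx Phi_L[OF c, of _ v], of x]
      unfolding e by blast
  show "x \<in> L' p \<Longrightarrow> psi2 c p v *v x = 0" using D.Ps_Ls[OF ctx Phi_L[OF c, of _ v], of x]
      unfolding e by blast
  show "PiM (S' p) *v (psi1 c p v *v x) \<in> L' p" using D.Ps1_image[OF ctx Phi_image(1)[OF c, of v], of x]
      unfolding e .
  show "PiP (S' p) *v (psi2 c p v *v x) \<in> L' p" using D.Ps2_image[OF ctx Phi_image(2)[OF c, of v], of x]
      unfolding e .
qed

lemma jmap_L': "p \<in> topspace X \<Longrightarrow> x \<in> L' p \<Longrightarrow> jmap x \<in> L' p"
  using L'_facts(2) by blast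

lemma S'_L': "p \<in> topspace X \<Longrightarrow> x \<in> L' p \<Longrightarrow> S' p *v x \<in> L' p"
  using L'_facts(3) by blast

lemma q'_L':
  assumes c: "c \<in> A" "p \<in> dom_ch c"
  shows "x \<in> L' p \<Longrightarrow> q' c p v *v x = 0" "q' c p v *v x \<in> L' p" "jc (q' c p v) = q' c p v"
proof -
  show "x \<in> L' p \<Longrightarrow> q' c p v *v x = 0"
    by (simp add: q'_def matrix_vector_simps matrix_vector_mul_assoc[symmetric] psi_L'[OF c])
  show "q' c p v *v x \<in> L' p"
    using subspace_alt(2)[OF L'_facts(1)[OF in_top[OF c]] psi_L'(3)[OF c] psi_L'(4)[OF c]]
    by (simp add: q'_def matrix_vector_simps matrix_vector_mul_assoc[symmetric])
  show "jc (q' c p v) = q' c p v"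
    by (simp add: q'_def jc_simps jc_psi[OF c] jc_Pi[OF S'_facts(2)[OF in_top[OF c]]] add.commute)
qed

text \<open>Differentiating \<open>\<Pi>*\<^sub>- r(0) \<Pi>\<^sub>+ = 0\<close> carries the image of the Hopf field A into the transform.\<close>

lemma del_S'_PiP:
  assumes c: "c \<in> A" "p \<in> dom_ch c"
  shows "del c S' p v *v (PiP (S' p) *v y) \<in> L' p"
proof -
  note top = in_top[OF c] and p = insertI1 c(2) c(2)
  note sub = subspace_alt[OF L'_facts(1)[OF top]] and subL = subspace_alt[OF L_facts(1)[OF top]]
  obtain K where K: "del c rz p v ** PiP (S p) = psi1 c p v ** K" using del_rz[OF c] by blast
  note sr = chart_sm[OF sm_all(1) c(1)] and sPP = chart_sm[OF sm_all(7) c(1)] and sQ = chart_sm[OF sm_all(10) c(1)]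
  have "del c (\<lambda>x. PiM (S' x) ** (rz x ** PiP (S x))) p v = del c (\<lambda>x. 0) p v"
    unfolding del_def using dd_cong[OF c(1) chart_facts(1)[OF c(1)] c(2) c(2), of
        "\<lambda>x. PiM (S' x) ** (rz x ** PiP (S x))" "\<lambda>x. 0"]
      Pi_S'_R(1)[OF in_top[OF c(1)]] by simp
  then have d: "((\<i> / 2) *k del c S' p v) ** (rz p ** PiP (S p)) + PiM (S' p) **
      (psi1 c p v ** K + rz p ** ((- \<i> / 2) *k del c S p v)) = 0"
    unfolding del_mult(1)[OF sQ sm_bilinear[OF bb_mm sr sPP] p] del_mult(1)[OF sr sPP p] del_const del_Pi(1)[OF c]
        star.del_Pi(2)[OF c] K .
  \<comment> \<open>\<open>PiP (S' p)\<close> is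
    \<open>rz p ** (PiP (S p) ** matrix_inv (RR p))\<close>, so the relation \<open>d\<close>
    evaluated at z concerns vectors of the \<i>-eigenspace of \<open>S' p\<close>.\<close>
  define z where "z = matrix_inv (RR p) *v y"
  have "((\<i> / 2) *k del c S' p v) *v (PiP (S' p) *v y) =
      - (PiM (S' p) *v (psi1 c p v *v (K *v z)) + PiM (S' p) *v (rz p *v (((- \<i> / 2) *k del c S p v) *v z)))"
  proof -
    have "((\<i> / 2) *k del c S' p v) ** (rz p ** PiP (S p)) = -
        (PiM (S' p) ** (psi1 c p v ** K + rz p ** ((- \<i> / 2) *k del c S p v)))"
      using d by (simp only: eq_neg_iff_add_eq_0)
    from arg_cong[OF this, of "\<lambda>M. M *v z"] show ?thesis
      unfolding Pi_S'_R(3)[OF top] z_def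
      by (simp only: matrix_vector_simps matrix_ring_simps(4) matrix_vector_mul_assoc[symmetric])
  qed
  \<comment> \<open>\<open>PiM S ** del c S\<close> is a combination of A and S A, both with image
    in L; r(0) followed by \<open>PiM (S' p)\<close> carries the S_- part of L into
    \<open>L'\<close>.\<close>
  moreover have "PiM (S' p) *v (rz p *v (((- \<i> / 2) *k del c S p v) *v z)) \<in> L' p"
  proof (rule L'_facts(7)[OF top])
    have "PiM (S p) *v (((- \<i> / 2) *k del c S p v) *v z) = (- \<i> / 2) *s ((PiM (S p) ** del c S p v) *v z)"
      by (simp add: mscale_simps matrix_vector_simps matrix_vector_mul_assoc)
    also have "\<dots> \<in> L p"
    proof -
      define B where "B = S p ** dd c S p v - dd c S p (J c p v)"
      have B: "B *v z \<in> L p" unfolding B_def by (rule Hopf_image[OF c])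
      show ?thesis
        unfolding sphere_identities(5)[OF c] B_def[symmetric] mscale_simps(10) matrix_vector_simps(2)
            matrix_vector_mul_assoc[symmetric]
        by (intro subL(4) subL(3) B W_S(3)[OF top])
    qed
    finally show "PiM (S p) *v (((- \<i> / 2) *k del c S p v) *v z) \<in> L p" .
  qed
  ultimately have "((\<i> / 2) *k del c S' p v) *v (PiP (S' p) *v y) \<in> L' p"
    using sub(5)[OF sub(2)[OF psi_L'(3)[OF c]]] by simp
  then have "(- 2 * \<i>) *s (((\<i> / 2) *k del c S' p v) *v (PiP (S' p) *v y)) \<in> L' p" by (rule sub(4))
  then show ?thesis by (simp add: mscale_simps)
qed

text \<open>On the \<i>-eigenspace of \<open>S'\<close> the Hopf field is a multiple of
  \<open>del c S'\<close>, which \<open>del_S'_PiP\<close> handles; conjugation by j transfers the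
  result to the other eigenspace.\<close>

lemma Hopf_image':
  assumes c: "c \<in> A" "p \<in> dom_ch c"
  shows "(S' p ** dd c S' p v - dd c S' p (J c p v)) *v y \<in> L' p"
proof -
  note top = in_top[OF c]
  note sub = subspace_alt[OF L'_facts(1)[OF top]]
  define B where "B = S' p ** dd c S' p v - dd c S' p (J c p v)"
  have 1: "B *v (PiP (S' p) *v y) \<in> L' p" for y
  proof -
    have "B ** PiP (S' p) = (- 2 * \<i>) *k (del c S' p v ** PiP (S' p))"
      unfolding B_def by (rule star.sphere_identities(3)[OF c])
    then have "B *v (PiP (S' p) *v y) = (- 2 * \<i>) *s (del c S' p v *v (PiP (S' p) *v y))"
      by (simp add: matrix_vector_mul_assoc mscale_simps)
    then show ?thesis unfolding \<open>B *v (PiP (S' p) *v y) = _\<close> by (intro sub(4) del_S'_PiP[OF c])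
  qed
  have jB: "jc B = B" by (simp add: B_def jc_simps jc_dS'[OF c] S'_facts[OF top])
  have "B *v (PiM (S' p) *v y) = jmap (B *v (PiP (S' p) *v (- jmap y)))"
    by (simp add: jmap_mv jB jc_Pi[OF S'_facts(2)[OF top]] jmap_simps)
  then have 2: "B *v (PiM (S' p) *v y) \<in> L' p" using jmap_L'[OF top 1] by simp
  have "B *v y = B *v (PiP (S' p) *v y) + B *v (PiM (S' p) *v y)" by (metis Pi_decomp matrix_vector_simps(4))
  then show ?thesis using sub(2)[OF 1 2] by (simp add: B_def)
qed

text \<open>The Hopf field Q of \<open>S'\<close> is built from \<open>psi1\<close> and
  \<open>psi2\<close>, which vanish on \<open>L'\<close>. On \<open>L'\<close> the other Hopf field
  then equals (1/2) S' dS'; its values lie in \<open>L'\<close>, hence so do those of dS'.\<close>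

lemma Q_L':
  assumes c: "c \<in> A" "p \<in> dom_ch c" and x: "x \<in> L' p"
  shows "S' p *v (dd c S' p v *v x) + dd c S' p (J c p v) *v x = 0" "dd c S' p v *v x \<in> L' p"
proof -
  note top = in_top[OF c]
  note sub = subspace_alt[OF L'_facts(1)[OF top]]
  have "((1/4) *k (S' p ** dd c S' p v + dd c S' p (J c p v))) *v x = 0"
    unfolding Phi_star_eq(1)[OF c] using psi_L'[OF c] x
    by (simp add: matrix_vector_simps matrix_vector_mul_assoc[symmetric])
  then have "(S' p ** dd c S' p v + dd c S' p (J c p v)) *v x = 0" by (simp add: mscale_simps(10))
  then show 1: "S' p *v (dd c S' p v *v x) + dd c S' p (J c p v) *v x = 0"
    by (simp add: matrix_vector_simps matrix_vector_mul_assoc[symmetric])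
  have "(S' p ** dd c S' p v - dd c S' p (J c p v)) *v x = 2 *s (S' p *v (dd c S' p v *v x)) -
      (S' p *v (dd c S' p v *v x) + dd c S' p (J c p v) *v x)"
    by (simp add: matrix_vector_simps matrix_vector_mul_assoc[symmetric]) (simp add: vec_eq_iff)
  then have "2 *s (S' p *v (dd c S' p v *v x)) \<in> L' p" using Hopf_image'[OF c, of v x] unfolding 1 by simp
  then have "(- 1 / 2) *s (S' p *v (2 *s (S' p *v (dd c S' p v *v x)))) \<in> L' p" using sub(4) S'_L'[OF top] by
      blast
  then show "dd c S' p v *v x \<in> L' p"
    by (simp add: matrix_vector_simps matrix_vector_mul_assoc S'_facts[OF top] assoc_rule[OF S'_facts(1)[OF top]])
      (simp add: matrix_ring_simps matrix_vector_simps)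
qed

text \<open>Pull \<sigma> back by r(\<infinity>) to x; its S_+ component l is a section of L_+, so
  \<partial>l \<in> L. The gauge equation of r(\<infinity>) carries this to the \<i>-component of
  \<partial>\<sigma>, and the remaining term is a multiple of \<partial>S' applied to \<sigma>, also
  in \<open>L'\<close>. In the (0,1)-derivative the component for -\<i> is zero because
  \<open>psi2\<close> vanishes on \<open>L'\<close>.\<close>

lemma section_plus:
  assumes \<sigma>: "sm A N \<sigma>" "\<And>x. x \<in> N \<Longrightarrow> \<sigma> x \<in> L' x \<and> PiP (S' x)
      *v \<sigma> x = \<sigma> x" and p: "p \<in> N" "c \<in> A" "p \<in> dom_ch c"
  shows "vdel c \<sigma> p v \<in> L' p" "PiM (S' p) *v vdelb c \<sigma> p v = 0"
    "dd c \<sigma> p (J c p v) + S' p *v dd c \<sigma> p v \<in> L' p"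
proof -
  have N: "openin X N" using sm_open[OF \<sigma>(1)] by blast
  have top': "x \<in> topspace X" if "x \<in> N" for x using openin_subset[OF N] that by blast
  note c = p(2,3) and top = top'[OF p(1)]
  note sub = subspace_alt[OF L'_facts(1)[OF top]]
  have s1: "sm A N f" if "sm A (topspace X) f" for f :: "'m \<Rightarrow> complex^4^4"
    by (rule sm_subset[OF that N]) (use top' in auto)
  define x where "x y = rii y *v \<sigma> y" for y
  define l where "l y = PiP (S y) *v x y" for y
  have sx: "sm A N x" unfolding x_def[abs_def] by (rule sm_bilinear[OF bb_mv s1[OF sm_all(4)] \<sigma>(1)])
  have sl: "sm A N l" unfolding l_def[abs_def] by (rule sm_bilinear[OF bb_mv s1[OF sm_all(7)] sx])
  have l: "l y \<in> L y \<and> PiP (S y) *v l y = l y" if "y \<in> N" for y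
    using L'_facts(8)[OF top'[OF that]] \<sigma>(2)[OF that]
    by (simp add: l_def x_def matrix_vector_mul_assoc Pi_simps[OF SS[OF top'[OF that]]]
        assoc_rule[OF Pi_simps(5)[OF SS[OF top'[OF that]]]])
  have dl: "vdel c l p v \<in> L p" by (rule del_section[OF sl l p])
  note pp = p(2,1,3)
  define F where "F = Phi S q c p v ** PiM (S p)"
  have dl2: "vdel c l p v = ((- \<i> / 2) *k del c S p v) *v x p + PiP (S p) *v vdel c x p v"
    unfolding l_def[abs_def] vdel_mult(1)[OF s1[OF sm_all(7)] sx pp] del_Pi(1)[OF c] ..
  \<comment> \<open>The term of \<partial>l that contains \<partial>S has the S_+ component of
    -\<Phi>' x, by the first sphere identity.\<close>
  have z: "PiP (S p) *v (vdel c x p v - F *v x p) = PiP (S p) *v vdel c l p v"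
  proof -
    have "PiP (S p) *v vdel c l p v = - ((PiP (S p) ** ((\<i> / 2) *k del c S p v)) *v x p) +
        (PiP (S p) ** PiP (S p)) *v vdel c x p v"
      unfolding dl2 by (simp add: matrix_vector_simps mscale_simps matrix_vector_mul_assoc)
    then show ?thesis unfolding sphere_identities(1)[OF c] Pi_simps[OF SS[OF top]] F_def
      by (simp add: matrix_vector_simps matrix_vector_mul_assoc[symmetric])
  qed
  have "vdel c \<sigma> p v = vdel c (\<lambda>y. ri y *v x y) p v"
    unfolding vdel_def
    by (subst (1 2) dd_cong[OF p(2) N p(1,3), of \<sigma> "\<lambda>y. ri y *v x y"])
        (simp_all add: x_def L'_facts(11) top')
  also have "\<dots> = psi1 c p v *v \<sigma> p + ri p *v (vdel c x p v - F *v x p)"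
    unfolding vdel_mult(1)[OF s1[OF sm_all(2)] sx pp] del_ri[OF c] F_def[symmetric]
    using L'_facts(11)[OF top, of "\<sigma> p"]
    by (simp add: matrix_vector_simps matrix_vector_mul_assoc[symmetric] x_def)
  also have "\<dots> = ri p *v (vdel c x p v - F *v x p)" using psi_L'(1)[OF c] \<sigma>(2)[OF p(1)] by simp
  finally have d\<sigma>: "vdel c \<sigma> p v = ri p *v (vdel c x p v - F *v x p)" .
  have plus: "PiP (S' p) *v vdel c \<sigma> p v \<in> L' p"
    unfolding d\<sigma> by (rule L'_facts(6)[OF top]) (unfold z, rule L_facts(5)[OF top dl])
  have d\<sigma>2: "vdel c \<sigma> p v = ((- \<i> / 2) *k del c S' p v) *v \<sigma> p + PiP (S' p) *v vdel c
      \<sigma> p v"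
    "vdelb c \<sigma> p v = ((- \<i> / 2) *k delb c S' p v) *v \<sigma> p + PiP (S' p) *v vdelb c \<sigma> p v"
  proof -
    have e: "vdel c \<sigma> p v = vdel c (\<lambda>y. PiP (S' y) *v \<sigma> y) p v"
        "vdelb c \<sigma> p v = vdelb c (\<lambda>y. PiP (S' y) *v \<sigma> y) p v"
      unfolding vdel_def vdelb_def
      by (subst (1 2) dd_cong[OF p(2) N p(1,3), of \<sigma> "\<lambda>y. PiP (S' y) *v \<sigma> y"]; simp add:
          \<sigma>(2))+
    show "vdel c \<sigma> p v = ((- \<i> / 2) *k del c S' p v) *v \<sigma> p + PiP (S' p) *v vdel c \<sigma> p v"
      "vdelb c \<sigma> p v = ((- \<i> / 2) *k delb c S' p v) *v \<sigma> p + PiP (S' p) *v vdelb c \<sigma> p v"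
      unfolding vdel_mult[OF s1[OF sm_all(9)] \<sigma>(1) pp] star.del_Pi[OF c, symmetric]
      using e vdel_mult[OF s1[OF sm_all(9)] \<sigma>(1) pp, of v] by simp_all
  qed
  have "((- \<i> / 2) *k del c S' p v) *v \<sigma> p \<in> L' p"
    using sub(4)[OF del_S'_PiP[OF c, of v "\<sigma> p"]] \<sigma>(2)[OF p(1)] by (simp only: mscale_simps(10))
  then show dd': "vdel c \<sigma> p v \<in> L' p" using sub(2) plus d\<sigma>2(1) by metis
  \<comment> \<open>The conjugate of \<open>psi1_PiP\<close> by j.\<close>
  have "PiM (S' p) ** psi2 c p v = (- \<i> / 2) *k (delb c S' p v ** PiP (S' p))"
  proof -
    have "jc (del c S' p v) = delb c S' p v" unfolding del_def delb_def
      by (simp add: jc_simps jc_dS'[OF c]) (simp add: vec_eq_iff)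
    then show ?thesis using arg_cong[OF psi1_PiP[OF c, of v], of jc]
      by (simp add: jc_simps jc_psi[OF c] jc_Pi[OF S'_facts(2)[OF top]])
  qed
  from arg_cong[OF this, of "\<lambda>M. M *v \<sigma> p"] have "((- \<i> / 2) *k delb c S' p v) *v \<sigma> p = 0"
    using \<sigma>(2)[OF p(1)] psi_L'(2)[OF c]
    by (simp add: mscale_simps matrix_vector_mul_assoc[symmetric])
  then have b: "vdelb c \<sigma> p v = PiP (S' p) *v vdelb c \<sigma> p v" using d\<sigma>2(2) by simp
  have "PiM (S' p) *v (PiP (S' p) *v y) = 0" for y by (simp add: matrix_vector_mul_assoc
      Pi_simps[OF S'_facts(1)[OF top]])
  then show b0: "PiM (S' p) *v vdelb c \<sigma> p v = 0" using b by metis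
  have "dd c \<sigma> p v = vdel c \<sigma> p v + vdelb c \<sigma> p v"
      "dd c \<sigma> p (J c p v) = \<i> *s (vdel c \<sigma> p v - vdelb c \<sigma> p v)"
    by (simp_all add: vdel_def vdelb_def vec_eq_iff field_simps)
  moreover have "S' p *v vdelb c \<sigma> p v = \<i> *s vdelb c \<sigma> p v"
    using b0 Splus_iff(2)[OF S'_facts(1)[OF top], of "vdelb c \<sigma> p v"] by (simp add: Splus_def)
  ultimately have "dd c \<sigma> p (J c p v) + S' p *v dd c \<sigma> p v = \<i> *s vdel c \<sigma> p v + S' p *v
      vdel c \<sigma> p v"
    by (simp add: matrix_vector_simps vec.scale_right_diff_distrib)
  then show "dd c \<sigma> p (J c p v) + S' p *v dd c \<sigma> p v \<in> L' p"
    using sub(2)[OF sub(4)[OF dd'] S'_L'[OF top dd']] by simp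
qed

text \<open>Write \<sigma> = u - jw with u and w in the \<i>-part of \<open>L'\<close>;
  \<open>section_plus\<close> applies to both, and j-stability of \<open>L'\<close> takes care of
  jw. The vector in the second condition is -dS' \<sigma>, covered by \<open>Q_L'\<close>.\<close>

lemma delta':
  assumes \<sigma>: "sm A N \<sigma>" "\<And>x. x \<in> N \<Longrightarrow> \<sigma> x \<in> L' x" and p:
      "p \<in> N" "c \<in> A" "p \<in> dom_ch c"
  shows "dd c \<sigma> p (J c p v) + S' p *v dd c \<sigma> p v \<in> L' p"
      "S' p *v dd c \<sigma> p v - dd c (\<lambda>x. S' x *v \<sigma> x) p v \<in> L' p"
proof -
  have N: "openin X N" using sm_open[OF \<sigma>(1)] by blast
  have top': "x \<in> topspace X" if "x \<in> N" for x using openin_subset[OF N] that by blast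
  note c = p(2,3) and top = top'[OF p(1)] and pp = p(2,1,3)
  note sub = subspace_alt[OF L'_facts(1)[OF top]]
  have s1: "sm A N f" if "sm A (topspace X) f" for f :: "'m \<Rightarrow> complex^4^4"
    by (rule sm_subset[OF that N]) (use top' in auto)
  define u w where uw: "u x = PiP (S' x) *v \<sigma> x" "w x = jmap (PiM (S' x) *v \<sigma> x)" for x
  have su: "sm A N u" unfolding uw[abs_def] by (rule sm_bilinear[OF bb_mv s1[OF sm_all(9)] \<sigma>(1)])
  have sw: "sm A N w" unfolding uw[abs_def] by
      (rule sm_linear[OF bl_jmap sm_bilinear[OF bb_mv s1[OF sm_all(10)] \<sigma>(1)]])
  have u: "u x \<in> L' x \<and> PiP (S' x) *v u x = u x" and w: "w x \<in> L' x \<and> PiP (S' x) *v w x = w x" if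
      "x \<in> N" for x
  proof -
    note t = top'[OF that]
    show "u x \<in> L' x \<and> PiP (S' x) *v u x = u x"
      using L'_facts(4)[OF t \<sigma>(2)[OF that]] by (simp add: uw matrix_vector_mul_assoc
          Pi_simps[OF S'_facts(1)[OF t]])
    have "PiP (S' x) *v w x = jmap (PiM (S' x) *v (PiM (S' x) *v \<sigma> x))" by
        (simp add: uw jmap_mv jc_Pi[OF S'_facts(2)[OF t]])
    then show "w x \<in> L' x \<and> PiP (S' x) *v w x = w x"
      using jmap_L'[OF t L'_facts(5)[OF t \<sigma>(2)[OF that]]] by (simp add: uw matrix_vector_mul_assoc
          Pi_simps[OF S'_facts(1)[OF t]])
  qed
  have sjw: "sm A N (\<lambda>x. jmap (w x))" by (rule sm_linear[OF bl_jmap sw])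
  have "dd c \<sigma> p v = dd c (\<lambda>x. u x - jmap (w x)) p v" for v
    by (rule dd_cong[OF p(2) N p(1,3)]) (simp add: uw jmap_simps Pi_decomp)
  then have d: "dd c \<sigma> p v = dd c u p v - jmap (dd c w p v)" for v
    unfolding dd_diff[OF su sjw pp] dd_linear[OF bl_jmap sw pp] .
  have Sj: "S' p *v jmap y = jmap (S' p *v y)" for y by (simp add: jmap_mv S'_facts[OF top])
  have "dd c \<sigma> p (J c p v) + S' p *v dd c \<sigma> p v =
     (dd c u p (J c p v) + S' p *v dd c u p v) - jmap (dd c w p (J c p v) + S' p *v dd c w p v)"
    unfolding d by (simp add: matrix_vector_simps Sj jmap_simps)
  then show "dd c \<sigma> p (J c p v) + S' p *v dd c \<sigma> p v \<in> L' p"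
    using sub(3)[OF section_plus(3)[OF su u p] jmap_L'[OF top section_plus(3)[OF sw w p]]] by simp
  show "S' p *v dd c \<sigma> p v - dd c (\<lambda>x. S' x *v \<sigma> x) p v \<in> L' p"
    unfolding dd_bilinear[OF bb_mv s1[OF sm_all(6)] \<sigma>(1) pp]
    using sub(5)[OF Q_L'(2)[OF c \<sigma>(2)[OF p(1)]]] by simp
qed

end

lemma wedge_space_pair:
  assumes "T \<in> wedge_space (vec.span {a, b}) (vec.span {a, b})"
  shows "\<exists>z. T = z *s wedge a b"
  using assms
proof (induction rule: wedge_space_induct)
  case (wedge x y)
  then obtain x1 x2 y1 y2 where "x = x1 *s a + x2 *s b" "y = y1 *s a + y2 *s b" unfolding span_pair by blast
  then have "wedge x y = (x1 * y2 - x2 * y1) *s wedge a b"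
    using wedge_swap[of b a] by (simp add: wedge_simps) (simp add: vec_eq_iff algebra_simps)
  then show ?case by blast
next
  case zero then show ?case by (metis vec.scale_zero_left)
next
  case (add T U) then show ?case by (metis vec.scale_left_distrib)
next
  case (scale z T) then show ?case by (metis vec.scale_scale)
qed

section \<open>Rank, induced complex structure and multiplier of the transform\<close>

context dressed begin

text \<open>The \<i>-part of \<open>L'\<close> is the image of the line L_+ under a linear map, so
  one nonzero vector spans it; j exchanges it with the other part.\<close>

lemma L'_basis:
  assumes p: "p \<in> topspace X" and l: "l \<in> L' p" "PiP (S' p) *v l = l" "l \<noteq> 0"
  shows "L' p = vec.span {l, jmap l}"
proof
  note sub = subspace_alt[OF L'_facts(1)[OF p]]
  show "vec.span {l, jmap l} \<subseteq> L' p"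
    by (rule vec.span_minimal) (use l jmap_L'[OF p] L'_facts(1)[OF p] in auto)
  have plus: "\<exists>z. y = z *s l" if y: "y \<in> L' p" "PiP (S' p) *v y = y" for y
  proof -
    obtain l0 where l0: "l0 \<in> L p" "PiP (S p) *v l0 = l0" "l = PiP (S' p) *v (ri p *v l0)"
      using L'_facts(10)[OF p l(1,2)] by blast
    obtain y0 where y0: "y0 \<in> L p" "PiP (S p) *v y0 = y0" "y = PiP (S' p) *v (ri p *v y0)"
      using L'_facts(10)[OF p y] by blast
    have "l0 \<noteq> 0" using l0 l(3) by auto
    then obtain z where "y0 = z *s l0" using L_basis(3)[OF p l0(1,2) _ y0(1,2)] by blast
    then have "y = z *s l" using y0 l0 by (simp add: matrix_vector_simps)
    then show ?thesis by blast
  qed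
  show "L' p \<subseteq> vec.span {l, jmap l}"
  proof
    fix y assume y: "y \<in> L' p"
    note pi = Pi_simps[OF S'_facts(1)[OF p]]
    obtain z where z: "PiP (S' p) *v y = z *s l"
      using plus[OF L'_facts(4)[OF p y]] by (auto simp: matrix_vector_mul_assoc pi)
    have "PiP (S' p) *v jmap (PiM (S' p) *v y) = jmap (PiM (S' p) *v y)"
      using jmap_mv[of "PiM (S' p)" "PiM (S' p) *v y"] by (simp add: jc_Pi[OF S'_facts(2)[OF p]]
          matrix_vector_mul_assoc pi)
    then obtain w where w: "jmap (PiM (S' p) *v y) = w *s l"
      using plus[OF jmap_L'[OF p L'_facts(5)[OF p y]]] by blast
    have "PiM (S' p) *v y = - jmap (jmap (PiM (S' p) *v y))" by (simp add: jmap_simps)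
    then have "PiM (S' p) *v y = (- cnj w) *s jmap l" unfolding w by (simp add: jmap_simps)
    then have "y = z *s l + (- cnj w) *s jmap l" using Pi_decomp[of "S' p" y] z by simp
    then show "y \<in> vec.span {l, jmap l}" unfolding span_pair by blast
  qed
qed

text \<open>A nowhere-zero section of L_+ is carried along by \<open>ri\<close> and
  \<open>PiP S'\<close>; the left inverse in \<open>L'_facts(9)\<close> excludes zeros.\<close>

lemma frame':
  assumes p: "p \<in> topspace X"
  obtains N l where "sm A N l" "p \<in> N" "\<And>x. x \<in> N \<Longrightarrow> l x \<in> L' x \<and> PiP (S' x)
      *v l x = l x \<and> l x \<noteq> 0"
proof -
  obtain N l where l: "sm A N l" "p \<in> N" "\<And>x. x \<in> N \<Longrightarrow> l x \<in> L x \<and> PiP (S x)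
      *v l x = l x \<and> l x \<noteq> 0"
    using frame[OF p] by blast
  have N: "openin X N" using sm_open[OF l(1)] by blast
  have top: "x \<in> topspace X" if "x \<in> N" for x using openin_subset[OF N] that by blast
  have s1: "sm A N f" if "sm A (topspace X) f" for f :: "'m \<Rightarrow> complex^4^4"
    by (rule sm_subset[OF that N]) (use top in auto)
  show ?thesis
  proof (rule that[of N "\<lambda>x. PiP (S' x) *v (ri x *v l x)"])
    show "sm A N (\<lambda>x. PiP (S' x) *v (ri x *v l x))"
      by (intro sm_bilinear[OF bb_mv] s1 sm_all l(1))
    show "p \<in> N" by (rule l)
    fix x assume x: "x \<in> N"
    note t = top[OF x]
    have "PiP (S' x) *v (ri x *v l x) \<noteq> 0"
    proof
      assume "PiP (S' x) *v (ri x *v l x) = 0"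
      then show False using L'_facts(9)[OF t, of "l x"] l(3)[OF x] by simp
    qed
    moreover have "PiP (S' x) *v (ri x *v l x) \<in> L' x" using L'_facts(6)[OF t, of "l x"] l(3)[OF x] by simp
    moreover have "PiP (S' x) *v (PiP (S' x) *v (ri x *v l x)) = PiP (S' x) *v (ri x *v l x)"
      by (simp only: matrix_vector_mul_assoc Pi_simps[OF S'_facts(1)[OF t]])
        (simp only: matrix_vector_mul_assoc[symmetric] Pi_simps[OF S'_facts(1)[OF t]] matrix_mul_assoc)
    ultimately show "PiP (S' x) *v (ri x *v l x) \<in> L' x \<and> PiP (S' x) *v (PiP (S' x) *v (ri x *v l x)) = PiP (S' x) *v (ri x *v l x)
       \<and> PiP (S' x) *v (ri x *v l x) \<noteq> 0" by blast
  qed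
qed

lemma subbundle_L': "smooth_subbundle X A 2 L'"
  unfolding smooth_subbundle_def
proof
  fix p assume p: "p \<in> topspace X"
  obtain N l where l: "sm A N l" "p \<in> N" "\<And>x. x \<in> N \<Longrightarrow> l x \<in> L' x \<and> PiP (S' x)
      *v l x = l x \<and> l x \<noteq> 0"
    using frame'[OF p] by blast
  have N: "openin X N" using sm_open[OF l(1)] by blast
  define s where "s i x = (if i = (0::nat) then l x else jmap (l x))" for i x
  have sm: "smooth_map A N (s i)" for i
    using l(1) sm_linear[OF bl_jmap l(1)] by (cases "i = 0") (auto simp: s_def[abs_def] sm_def)
  have im: "(\<lambda>i. s i x) ` {..<2} = {l x, jmap (l x)}" for x
    by (auto simp: s_def numeral_2_eq_2 lessThan_Suc)
  have "L' x = vec.span ((\<lambda>i. s i x) ` {..<2}) \<and> vec.dim (L' x) = 2" if x: "x \<in> N" for x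
  proof -
    have t: "x \<in> topspace X" using openin_subset[OF N] x by blast
    note qp = quaternionic_pair[OF S'_facts[OF t], of "l x"]
    have b: "L' x = vec.span {l x, jmap (l x)}" using L'_basis[OF t] l(3)[OF x] by blast
    moreover have "vec.dim {l x, jmap (l x)} = card {l x, jmap (l x)}"
      using qp(4) l(3)[OF x] by (intro vec.dim_eq_card_independent) blast
    ultimately show ?thesis using qp(3) l(3)[OF x] unfolding im by simp
  qed
  then show "\<exists>N s. openin X N \<and> p \<in> N \<and> (\<forall>i<2. smooth_map A N (s i)) \<and>
        (\<forall>x\<in>N. L' x = vec.span ((\<lambda>i::nat. s i x) ` {..<2}) \<and> vec.dim (L' x) = 2)"
    using N l(2) sm by blast
qed

text \<open>A real lift is locally \<open>f (l \<and> jl)\<close> with \<open>\<partial>l\<close> in the bundle, so its \<open>\<partial>\<close>-derivative lies in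
  \<open>l \<and> \<complex>\<^sup>4\<close> and is isotropic.\<close>

lemma conformal_L':
  assumes rl: "real_lift X A L' N \<sigma>" and p: "p \<in> N" "c \<in> A" "p \<in> dom_ch c"
  shows "metric2 \<kappa> (dd c \<sigma> p (J c p v)) (dd c \<sigma> p (J c p w)) = metric2 \<kappa>
      (dd c \<sigma> p v) (dd c \<sigma> p w)"
proof -
  note c = p(2,3) and top = in_top[OF p(2,3)]
  have N: "openin X N" and s\<sigma>: "sm A N \<sigma>" and \<sigma>:
      "\<And>x. x \<in> N \<Longrightarrow> \<sigma> x \<in> wedge_space (L' x) (L' x) \<and> conj2 (\<sigma> x) =
      \<sigma> x"
    using rl unfolding real_lift_def local_sec_def sm_def by auto
  obtain N0 l where l: "sm A N0 l" "p \<in> N0" "\<And>x. x \<in> N0 \<Longrightarrow> l x \<in> L' x \<and> PiP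
      (S' x) *v l x = l x \<and> l x \<noteq> 0"
    using frame'[OF top] by blast
  define \<eta> where "\<eta> x = wedge (l x) (jmap (l x))" for x
  have sj: "sm A N0 (\<lambda>x. jmap (l x))" by (rule sm_linear[OF bl_jmap l(1)])
  have s\<eta>: "sm A N0 \<eta>" unfolding \<eta>_def[abs_def] by (rule sm_bilinear[OF bb_wedge l(1) sj])
  have "\<eta> p \<noteq> 0"
  proof
    assume "\<eta> p = 0"
    have "l p $ i * jmap (l p) $ j - jmap (l p) $ i * l p $ j = \<eta> p $ (i, j)" for i j by
        (simp add: \<eta>_def wedge_def)
    then have ij: "l p $ i * jmap (l p) $ j = jmap (l p) $ i * l p $ j" for i j using \<open>\<eta> p = 0\<close>
        by simp
    obtain i where i: "l p $ i \<noteq> 0" using l(3)[OF l(2)] by (auto simp: vec_eq_iff)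
    have "(- jmap (l p) $ i) *s l p + l p $ i *s jmap (l p) = 0" using ij by (simp add: vec_eq_iff mult.commute)
    then show False using quaternionic_pair(2)[OF S'_facts[OF top], of "l p"] l(3)[OF l(2)] i by blast
  qed
  then obtain k where k: "\<eta> p $ k \<noteq> 0" by (metis vec_eq_iff zero_index)
  define M where "M = {x \<in> N0. \<eta> x $ k \<noteq> 0} \<inter> N"
  have M: "openin X M" "p \<in> M" using openin_Int[OF sm_nonzero_open[OF sm_nth[OF s\<eta>]] N, of k] k l(2) p(1)
      by (auto simp: M_def)
  \<comment> \<open>Dividing by a coordinate of \<eta> that does not vanish exhibits the factor
    between \<sigma> and \<eta> as a smooth function.\<close>
  define f where "f x = \<sigma> x $ k * inverse (\<eta> x $ k)" for x
  have s\<eta>M: "sm A M \<eta>" and s\<sigma>M: "sm A M \<sigma>" and slM: "sm A M l"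
    by (rule sm_subset[OF s\<eta> M(1)] sm_subset[OF s\<sigma> M(1)] sm_subset[OF l(1) M(1)]; auto simp: M_def)+
  have sjM: "sm A M (\<lambda>x. jmap (l x))" by (rule sm_linear[OF bl_jmap slM])
  have sf: "sm A M f" unfolding f_def[abs_def]
    by (intro sm_mult sm_inverse sm_nth s\<sigma>M s\<eta>M) (auto simp: M_def)
  have eq: "\<sigma> x = f x *s \<eta> x" if x: "x \<in> M" for x
  proof -
    have t: "x \<in> topspace X" using openin_subset[OF M(1)] x by blast
    have "L' x = vec.span {l x, jmap (l x)}" using L'_basis[OF t] l(3)[of x] x by (auto simp: M_def)
    then obtain z where z: "\<sigma> x = z *s \<eta> x" using \<sigma>[of x] wedge_space_pair x unfolding
        \<eta>_def by (metis (no_types, lifting) M_def IntD2)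
    then show ?thesis using x by (simp add: f_def M_def)
  qed
  note pp = p(2) M(2) p(3)
  have d\<eta>: "dd c \<eta> p v = wedge (l p) (jmap (dd c l p v)) + wedge (dd c l p v) (jmap (l p))" for v
    unfolding \<eta>_def[abs_def] dd_bilinear[OF bb_wedge slM sjM pp] dd_linear[OF bl_jmap slM pp] ..
  have d\<sigma>: "dd c \<sigma> p v = f p *s dd c \<eta> p v + dd c f p v *s \<eta> p" for v
  proof -
    have "dd c \<sigma> p v = dd c (\<lambda>x. f x *s \<eta> x) p v" by (rule dd_cong[OF p(2) M p(3)]) (rule eq)
    then show ?thesis unfolding dd_bilinear[OF bb_vs sf s\<eta>M pp] .
  qed
  have mem: "dd c \<sigma> p v \<in> Wedge2" for v
    unfolding d\<sigma> d\<eta> \<eta>_def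
    by (intro vec.subspace_add[OF subspace_Wedge2] vec.subspace_scale[OF subspace_Wedge2] wedge_Wedge2)
  have iso: "\<exists>u. dd c \<sigma> p v - \<i> *s dd c \<sigma> p (J c p v) = wedge (l p) u" for v
  proof -
    have "vdel c l p v \<in> L' p" by (rule section_plus(1)[OF slM _ M(2) c])
        (use l(3) in \<open>auto simp: M_def\<close>)
    then obtain x y where xy: "vdel c l p v = x *s l p + y *s jmap (l p)"
      using L'_basis[OF top] l(3)[OF l(2)] span_pair by blast
    have "wedge (vdel c l p v) (jmap (l p)) = wedge (l p) (x *s jmap (l p))"
      unfolding xy by (simp add: wedge_simps)
    moreover have "dd c \<eta> p v - \<i> *s dd c \<eta> p (J c p v) =
       wedge (l p) (jmap (dd c l p v + \<i> *s dd c l p (J c p v))) + 2 *s wedge (vdel c l p v) (jmap (l p))"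
      unfolding d\<eta> vdel_def by (simp add: wedge_simps jmap_simps)
    ultimately have "dd c \<sigma> p v - \<i> *s dd c \<sigma> p (J c p v) = wedge (l p)
        (f p *s (jmap (dd c l p v + \<i> *s dd c l p (J c p v)) + 2 *s (x *s jmap (l p))) + (dd c f p v - \<i> * dd c f p (J c p v)) *s jmap (l p))"
      unfolding d\<sigma> by (simp add: wedge_simps \<eta>_def) (simp add: vec_eq_iff algebra_simps)
    then show ?thesis by blast
  qed
  have real: "conj2 (dd c \<sigma> p v) = dd c \<sigma> p v" for v
  proof -
    have "dd c (\<lambda>x. conj2 (\<sigma> x)) p v = dd c \<sigma> p v" by (rule dd_cong[OF p(2) N p(1,3)])
        (use \<sigma> in blast)
    then show ?thesis unfolding dd_linear[OF bl_conj2 s\<sigma> p(2,1,3)] .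
  qed
  have 1: "metric2 \<kappa> (dd c \<sigma> p v - \<i> *s dd c \<sigma> p (J c p v)) (dd c \<sigma> p v - \<i> *s dd
      c \<sigma> p (J c p v)) = 0" for v
    using iso[of v] by (auto simp: metric2_wedge vol_alternating)
  \<comment> \<open>\<sigma> is real, so conjugation maps the decomposable (1,0)-derivative to the
    (0,1)-derivative, which is therefore decomposable and isotropic too.\<close>
  have 2: "metric2 \<kappa> (dd c \<sigma> p v + \<i> *s dd c \<sigma> p (J c p v)) (dd c \<sigma> p v + \<i> *s dd
      c \<sigma> p (J c p v)) = 0" for v
  proof -
    obtain u where u: "dd c \<sigma> p v - \<i> *s dd c \<sigma> p (J c p v) = wedge (l p) u" using iso by blast
    have "conj2 (dd c \<sigma> p v + (- \<i>) *s dd c \<sigma> p (J c p v)) = dd c \<sigma> p v + \<i> *s dd c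
        \<sigma> p (J c p v)"
      unfolding conj2_simps real by simp
    then have "dd c \<sigma> p v + \<i> *s dd c \<sigma> p (J c p v) = wedge (jmap (l p)) (jmap u)"
      using u by (simp add: conj2_wedge)
    then show ?thesis by (simp add: metric2_wedge vol_alternating)
  qed
  have lin: "linear (dd c \<sigma> p)" by (rule dd_lin[OF s\<sigma> p(2,1,3)])
  have lin2: "linear (\<lambda>v. dd c \<sigma> p (J c p v))"
    using linear_compose[OF J_facts(1)[OF c] lin] by (simp add: comp_def)
  show ?thesis
    by (rule conformal_from_isotropic[OF lin lin2 mem mem 1 2])
qed

lemma one_form_q': "one_form A q'"
  unfolding one_form_def
proof (intro conjI ballI allI)
  fix c assume c: "c \<in> A"
  show "linear (q' c p)" if "p \<in> dom_ch c" for p by (rule smooth_formD(2)[OF form_q'[OF c] that])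
  show "smooth_on (coord c ` dom_ch c) (in_chart c (\<lambda>p. q' c p v))" for v
    using smooth_formD(1)[OF form_q'[OF c], of v] by (simp add: sm_def smooth_map_def)
  fix c' p v assume c': "c' \<in> A" and p: "p \<in> dom_ch c \<inter> dom_ch c'"
  define w where "w = dd c (coord c') p v"
  have ch: "dd c S p v = dd c' S p (dd c (coord c') p v)" for v
    by (rule dd_chain[OF sS c c' in_top[OF c]]) (use p in auto)
  have qq: "q c p v = q c' p w"
    using conjunct2[OF W_parts(4)[unfolded one_form_def]] c c' p unfolding w_def by blast
  have Jw: "dd c (coord c') p (J c p v) = J c' p w" unfolding w_def by (rule J_change[OF c c']) (use p in auto)
  have "Phi S q c p v = Phi S q c' p w"
    unfolding Phi_def NS_def ch[of v] ch[of "J c p v"] Jw qq w_def ..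
  then show "q' c p v = q' c' p (dd c (coord c') p v)"
    by (simp add: q'_def psi1_def psi2_def w_def)
qed

text \<open>The complex structure J is kept: by \<open>conformal_L'\<close> the transform induces
  the same conformal structure as L.\<close>

theorem dressed_Willmore:
  assumes im: "immerses X A L'"
  shows "q_constrained_Willmore \<kappa> X A J S' q' L'"
  unfolding q_constrained_Willmore_def
proof (intro conjI)
  show "surface_S4 X A L'" unfolding surface_S4_def using subbundle_L' L'_facts(2) im by blast
  show "induced_complex_structure \<kappa> X A L' J"
    unfolding induced_complex_structure_def using cs conformal_L' by blast
  show "one_form A q'" by (rule one_form_q')
  show "mean_curvature_sphere X A J L' S'"
    unfolding mean_curvature_sphere_def
  proof (intro conjI)
    show "smooth_map A (topspace X) S'" using sm_all(6) by (simp add: sm_def)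
    show "\<forall>p\<in>topspace X. j_commuting (S' p) \<and> S' p ** S' p = - mat 1 \<and>
        (\<lambda>x. S' p *v x) ` L' p = L' p"
      using S'_facts L'_facts(3) by (simp add: j_commuting_iff)
    show "\<forall>c\<in>A. \<forall>p\<in>dom_ch c. \<forall>v. \<forall>x\<in>L' p. dd c S' p v *v x \<in> L' p"
        using Q_L'(2) by blast
    show "\<forall>c\<in>A. \<forall>p\<in>dom_ch c. \<forall>v. \<forall>x\<in>L' p. S' p *v (dd c S' p v *v x) +
        dd c S' p (J c p v) *v x = 0"
      using Q_L'(1) by blast
    show "\<forall>N s. local_sec X A L' N s \<longrightarrow> (\<forall>p\<in>N. \<forall>c\<in>A. p \<in> dom_ch c \<longrightarrow>
        (\<forall>v. - dd c s p (J c p v) - S' p *v dd c s p v \<in> L' p \<and> S' p *v dd c s p v - dd c (\<lambda>x. S' x *v s x) p v \<in> L' p))"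
    proof (intro allI impI ballI)
      fix N \<sigma> p c v assume h: "local_sec X A L' N \<sigma>" "p \<in> N" "c \<in> A" "p \<in> dom_ch c"
      have s: "sm A N \<sigma>" "\<And>x. x \<in> N \<Longrightarrow> \<sigma> x \<in> L' x" using h(1) unfolding
          local_sec_def sm_def by auto
      have "- (dd c \<sigma> p (J c p v) + S' p *v dd c \<sigma> p v) \<in> L' p"
        by (rule subspace_alt(5)[OF L'_facts(1)[OF in_top[OF h(3,4)]] delta'(1)[OF s h(2-4)]])
      then show "- dd c \<sigma> p (J c p v) - S' p *v dd c \<sigma> p v \<in> L' p \<and> S' p *v dd c \<sigma> p
          v - dd c (\<lambda>x. S' x *v \<sigma> x) p v \<in> L' p"
        using delta'(2)[OF s h(2-4)] by simp
    qed
  qed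
  show "\<forall>c\<in>A. \<forall>p\<in>dom_ch c. \<forall>v. j_commuting (q' c p v) \<and> (\<forall>x\<in>L' p. q' c p v *v x = 0) \<and> (\<forall>x. q' c p v *v x \<in> L' p) \<and>
        S' p ** q' c p v = star J q' c p v \<and> star J q' c p v = q' c p v ** S' p"
    using q'_L' star.qS star.qJ by (simp add: j_commuting_iff star_def)
  show "\<forall>c\<in>A. \<forall>p\<in>dom_ch c. \<forall>v w. ext_deriv (NS S') q' c p v w = 0 \<and>
        ext_deriv (NS S') (star J (NS S')) c p v w = 2 *\<^sub>R bracket_wedge q' (star J (NS S')) c p v w"
    using star_equations by blast
qed

end

section \<open>The parallel bundle and its projection\<close>

lemma independent_pairD:
  fixes e1 e2 :: "complex^'n"
  assumes "vec.dim (vec.span {e1, e2}) = 2" "z1 *s e1 + z2 *s e2 = 0"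
  shows "z1 = 0 \<and> z2 = 0"
proof -
  have c: "card {e1, e2} \<le> 2" by (simp add: card_insert_if)
  have ind: "vec.independent {e1, e2}"
    by (rule vec.card_le_dim_spanning[of _ "vec.span {e1, e2}"])
        (use assms(1) c in \<open>auto intro: vec.span_base\<close>)
  have "e1 \<noteq> e2"
  proof
    assume "e1 = e2"
    then have "vec.dim (vec.span {e1, e2}) \<le> 1" using vec.dim_le_card[of "{e2}" "{e2}"] by
        (simp add: vec.span_superset)
    then show False using assms(1) by simp
  qed
  then have 1: "e1 \<notin> vec.span {e2}" and 2: "e2 \<noteq> 0" using ind by (auto simp: vec.independent_insert)
  have "z1 = 0"
  proof (rule ccontr)
    assume z: "z1 \<noteq> 0"
    have "z1 *s e1 = (- z2) *s e2" using assms(2) by (simp add: eq_neg_iff_add_eq_0)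
    then have "inverse z1 *s (z1 *s e1) = inverse z1 *s ((- z2) *s e2)" by simp
    then have "e1 = (inverse z1 * (- z2)) *s e2" using z by (simp only: vec.scale_scale left_inverse[OF z]
        vec.scale_one)
    then show False using 1 by (metis vec.span_base vec.span_scale singletonI)
  qed
  then show ?thesis using assms(2) 2 by simp
qed

lemma vol_nonzero:
  assumes "\<kappa> \<noteq> 0" "invertible (transpose (rows4 a b c d))"
  shows "vol \<kappa> a b c d \<noteq> 0"
  using assms unfolding vol_rows4 by (simp add: invertible_det_nz det_transpose)

text \<open>A derivation of \<open>\<Lambda>\<^sup>2W\<close> into itself comes from one of W.\<close>

lemma wedge_parallel:
  fixes \<kappa> :: complex
  assumes \<kappa>: "\<kappa> \<noteq> 0" and K: "invertible (transpose (rows4 w1 w2 v1 v2))"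
    and h: "wedge y1 w2 + wedge w1 y2 = z *s wedge w1 w2"
  shows "y1 \<in> vec.span {w1, w2}" "y2 \<in> vec.span {w1, w2}"
proof -
  have nz: "vol \<kappa> w1 w2 v1 v2 \<noteq> 0" by (rule vol_nonzero[OF \<kappa> K])
  have ex: "\<exists>x::complex^4. y = x $ 1 *s w1 + x $ 2 *s w2 + x $ 3 *s v1 + x $ 4 *s v2" for y
  proof -
    have "y = transpose (rows4 w1 w2 v1 v2) *v (matrix_inv (transpose (rows4 w1 w2 v1 v2)) *v y)"
      using K by (simp add: matrix_vector_mul_assoc matrix_inv_cancel)
    then show ?thesis unfolding cols4_mult by blast
  qed
  have perm: "vol \<kappa> v1 w2 w1 v2 = - vol \<kappa> w1 w2 v1 v2"
      "vol \<kappa> v2 w2 w1 v1 = vol \<kappa> w1 w2 v1 v2"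
     "vol \<kappa> w1 v1 w2 v2 = - vol \<kappa> w1 w2 v1 v2" "vol \<kappa> w1 v2 w2 v1 = vol \<kappa> w1 w2 v1 v2"
  proof -
    show 3: "vol \<kappa> w1 v1 w2 v2 = - vol \<kappa> w1 w2 v1 v2" by (rule vol_swap(3))
    have "vol \<kappa> w1 v2 w2 v1 = - vol \<kappa> w1 w2 v2 v1" by (rule vol_swap(3))
    also have "vol \<kappa> w1 w2 v2 v1 = - vol \<kappa> w1 w2 v1 v2" by (rule vol_swap(2))
    finally show 4: "vol \<kappa> w1 v2 w2 v1 = vol \<kappa> w1 w2 v1 v2" by simp
    have g: "vol \<kappa> v w2 w1 u = vol \<kappa> w1 v w2 u" for v u
    proof -
      have "vol \<kappa> v w2 w1 u = - vol \<kappa> v w1 w2 u" by (rule vol_swap(3))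
      also have "vol \<kappa> v w1 w2 u = - vol \<kappa> w1 v w2 u" by (rule vol_swap(1))
      finally show ?thesis by simp
    qed
    show "vol \<kappa> v1 w2 w1 v2 = - vol \<kappa> w1 w2 v1 v2"
        "vol \<kappa> v2 w2 w1 v1 = vol \<kappa> w1 w2 v1 v2"
      unfolding g 3 4 by simp_all
  qed
  \<comment> \<open>Pairing \<open>h\<close> with e1 \<and> e2 turns it into an equation of
    determinants. For a suitable choice of e1, e2 among the basis vectors, a single coefficient of
    y1 or y2 outside the span of w1, w2 survives.\<close>
  have m: "vol \<kappa> y1 w2 e1 e2 + vol \<kappa> w1 y2 e1 e2 = z * vol \<kappa> w1 w2 e1 e2" for e1 e2
    using arg_cong[OF h, of "\<lambda>T. metric2 \<kappa> T (wedge e1 e2)"] by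
        (simp add: metric2_simps metric2_wedge)
  obtain x :: "complex^4" where x: "y1 = x $ 1 *s w1 + x $ 2 *s w2 + x $ 3 *s v1 + x $ 4 *s v2" using ex by blast
  have "x $ 3 = 0" using m[of w1 v2] perm nz unfolding x by (simp add: vol_add vol_scale vol_alternating)
  moreover have "x $ 4 = 0" using m[of w1 v1] perm nz unfolding x by (simp add: vol_add vol_scale vol_alternating)
  ultimately show "y1 \<in> vec.span {w1, w2}" unfolding span_pair x by auto
  obtain x :: "complex^4" where x: "y2 = x $ 1 *s w1 + x $ 2 *s w2 + x $ 3 *s v1 + x $ 4 *s v2" using ex by blast
  have "x $ 3 = 0" using m[of w2 v2] perm nz unfolding x by (simp add: vol_add vol_scale vol_alternating)
  moreover have "x $ 4 = 0" using m[of w2 v1] perm nz unfolding x by (simp add: vol_add vol_scale vol_alternating)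
  ultimately show "y2 \<in> vec.span {w1, w2}" unfolding span_pair x by auto
qed

locale backlund = willmore X A \<kappa> J S q L for X :: "'m topology" and A :: "'m chart set" and \<kappa> ::
    complex
    and J :: "('m, real^2) form" and S :: "'m \<Rightarrow> complex^4^4" and q :: "('m, complex^4^4) form"
    and L :: "'m \<Rightarrow> (complex^4) set" +
  fixes \<alpha> s :: complex and L\<alpha> :: "'m \<Rightarrow> tensor2 set" and W ::
      "'m \<Rightarrow> (complex^4) set"
  assumes \<kappa>: "\<kappa> \<noteq> 0" and BT: "untwisted_BT_parameters \<kappa> X A J S q \<alpha> L\<alpha> W
      s"
begin

lemmas BT' = BT[unfolded untwisted_BT_parameters_def]

lemma BT_parts:
  shows "\<alpha> \<noteq> 0" "cmod \<alpha> \<noteq> 1"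
      "p \<in> topspace X \<Longrightarrow> L\<alpha> p \<subseteq> Wedge2"
    "p \<in> topspace X \<Longrightarrow> conj2 ` (tau (S p) \<alpha> ` L\<alpha> p) \<noteq> tau (S p) \<alpha> `
        L\<alpha> p"
    "smooth_subbundle X A 2 W" "p \<in> topspace X \<Longrightarrow> wedge_space (W p) (W p) = tau (S p) \<alpha> `
        L\<alpha> p"
    "s^2 = r_fun \<alpha> 0"
    "p \<in> topspace X \<Longrightarrow> complementary (BT_Splus s (W p) (S p)) (BT_Sminus s (W p) (S p))"
  using BT' by simp_all

lemma BT_parallel:
  assumes "local_sec X A L\<alpha> N \<sigma>" "p \<in> N" "c \<in> A" "p \<in> dom_ch c"
  shows "dVlq J S q \<alpha> c \<sigma> p v \<in> L\<alpha> p"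
  using BT'[THEN conjunct2, THEN conjunct2, THEN conjunct2, THEN conjunct2, THEN conjunct1] assms by simp

lemma frame_W:
  assumes p: "p \<in> topspace X"
  obtains N w1 w2 where "p \<in> N" "sm A N w1" "sm A N w2"
      "\<And>x. x \<in> N \<Longrightarrow> W x = vec.span {w1 x, w2 x}"
    "\<And>x. x \<in> N \<Longrightarrow> \<forall>z1 z2. z1 *s w1 x + z2 *s w2 x = 0 \<longrightarrow> z1 = 0
        \<and> z2 = 0"
proof -
  obtain N w where N: "p \<in> N" "openin X N" and w: "\<And>i. i < 2 \<Longrightarrow> sm A N (w i)"
    "\<And>x. x \<in> N \<Longrightarrow> W x = vec.span ((\<lambda>i::nat. w i x) ` {..<2})"
        "\<And>x. x \<in> N \<Longrightarrow> vec.dim (W x) = 2"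
    using BT_parts(5) p by (rule subbundle_frame) blast
  have im: "(\<lambda>i::nat. w i x) ` {..<2} = {w 0 x, w 1 x}" for x by (auto simp: numeral_2_eq_2 lessThan_Suc)
  show ?thesis
  proof (rule that[of N "w 0" "w 1"])
    show "p \<in> N" by (rule N)
    show "sm A N (w 0)" "sm A N (w 1)" using w(1) by simp_all
    show sp: "W x = vec.span {w 0 x, w 1 x}" if "x \<in> N" for x using w(2)[OF that] unfolding im .
    show "\<forall>z1 z2. z1 *s w 0 x + z2 *s w 1 x = 0 \<longrightarrow> z1 = 0 \<and> z2 = 0" if "x \<in> N" for
        x
      using w(3)[OF that(1)] independent_pairD unfolding sp[OF that(1)] by blast
  qed
qed

lemma subspace_W: "p \<in> topspace X \<Longrightarrow> vec.subspace (W p)"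
  by (rule frame_W) (auto simp: vec.subspace_span)

text \<open>If W contains both x \<noteq> 0 and jx, these two span W, so W is j-stable and
  \<Lambda>^2 W is real, which is excluded for \<tau>(\<alpha>) L^\<alpha>.\<close>

lemma W_jW:
  assumes p: "p \<in> topspace X" and x: "x \<in> W p" "jmap x \<in> W p"
  shows "x = 0"
proof (rule ccontr)
  assume nz: "x \<noteq> 0"
  obtain N w1 w2 where w0: "p \<in> N" "sm A N w1" "sm A N w2"
      "\<And>x. x \<in> N \<Longrightarrow> W x = vec.span {w1 x, w2 x}"
    "\<And>x. x \<in> N \<Longrightarrow> \<forall>z1 z2. z1 *s w1 x + z2 *s w2 x = 0 \<longrightarrow> z1 = 0
        \<and> z2 = 0" by (rule frame_W[OF p]) blast
  note w = w0(1) w0(4)[OF w0(1)] w0(5)[OF w0(1)]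
  note sub = subspace_alt[OF subspace_W[OF p]]
  have ind: "z1 = 0 \<and> z2 = 0" if "z1 *s x + z2 *s jmap x = 0" for z1 z2
    by (rule quaternionic_independence[of "{0}"])
        (use nz that in \<open>auto simp: vec.subspace_def jmap_simps\<close>)
  obtain a b where ab: "x = a *s w1 p + b *s w2 p" using x(1) unfolding w(2) span_pair by blast
  obtain c d where cd: "jmap x = c *s w1 p + d *s w2 p" using x(2) unfolding w(2) span_pair by blast
  have det: "a * d - b * c \<noteq> 0"
  proof
    assume 0: "a * d - b * c = 0"
    have "d *s x + (- b) *s jmap x = (a * d - b * c) *s w1 p"
        "c *s x + (- a) *s jmap x = - (a * d - b * c) *s w2 p"
      unfolding cd by (simp_all add: ab) (simp_all add: vec_eq_iff algebra_simps)
    then have "d = 0 \<and> - b = 0" "c = 0 \<and> - a = 0" using ind 0 by (metis vec.scale_zero_left minus_zero)+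
    then show False using ab nz by simp
  qed
  have span: "y \<in> vec.span {x, jmap x}" if yW: "y \<in> W p" for y
  proof -
    obtain e f where ef: "y = e *s w1 p + f *s w2 p" using yW unfolding w(2) span_pair by blast
    have "y = ((e * d - f * c) / (a * d - b * c)) *s x + ((f * a - e * b) / (a * d - b * c)) *s jmap x"
      unfolding cd unfolding ab ef using det
      by (simp add: vec_eq_iff divide_simps) (simp add: algebra_simps)
    then show ?thesis unfolding span_pair by blast
  qed
  have jW: "jmap y \<in> W p" if y: "y \<in> W p" for y
  proof -
    obtain e f where "y = e *s x + f *s jmap x" using span[OF y] unfolding span_pair by blast
    then have "jmap y = cnj e *s jmap x + (- cnj f) *s x" by (simp add: jmap_simps)
    then show ?thesis using x by (simp only:) (intro sub(2) sub(4))
  qed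
  have c: "conj2 T \<in> wedge_space (W p) (W p)" "conj2 (conj2 T) = T" if "T \<in> wedge_space (W p) (W p)" for T
    using that by (induction rule: wedge_space_induct)
      (simp_all add: conj2_simps conj2_wedge jmap_simps wedge_simps wedge_in_space jW
        vec.subspace_0[OF subspace_wedge_space] vec.subspace_add[OF subspace_wedge_space]
            vec.subspace_scale[OF subspace_wedge_space])
  have "conj2 ` wedge_space (W p) (W p) = wedge_space (W p) (W p)"
  proof (intro set_eqI iffI)
    fix T assume "T \<in> wedge_space (W p) (W p)"
    then show "T \<in> conj2 ` wedge_space (W p) (W p)" using c by (metis image_eqI)
  qed (use c in auto)
  then show False using BT_parts(4)[OF p] BT_parts(6)[OF p] by simp
qed

section \<open>The projection onto W along jW and its smoothness\<close>

definition P :: "'m \<Rightarrow> complex^4^4" where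
  "P p = matrix (proj_along (W p) (jmap ` W p))"

text \<open>In the frame w1, w2, jw1, jw2 the projection P becomes this constant matrix, which gives
  its smoothness.\<close>

definition E12 :: "complex^4^4" where
  "E12 = (\<chi> i j. if i = j \<and> (i = 1 \<or> i = 2) then 1 else 0)"

lemma E12_mult: "(E12 *v x) $ 1 = x $ 1" "(E12 *v x) $ 2 = x $ 2" "(E12 *v x) $ 3 = 0" "(E12 *v x) $ 4 = 0"
  by (simp_all add: E12_def matrix_vector_mult_def sum_4)

lemma W_unique:
  assumes p: "p \<in> topspace X" and "u \<in> W p" "v \<in> W p" "u' \<in> W p" "v' \<in> W p"
      "u + jmap v = u' + jmap v'"
  shows "u = u'" "v = v'"
proof -
  note sub = subspace_alt[OF subspace_W[OF p]]
  have e: "u - u' = jmap (v' - v)" using assms(6) by (simp add: jmap_simps diff_eq_eq add_diff_eq eq_diff_eq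
      add.commute)
  then have "jmap (v' - v) \<in> W p" using sub(3)[OF assms(2,4)] by simp
  then have "v' - v = 0" by (rule W_jW[OF p sub(3)[OF assms(5,3)]])
  then show "v = v'" "u = u'" using e by (simp_all add: jmap_simps)
qed

lemma proj_W:
  assumes p: "p \<in> topspace X" and uv: "u \<in> W p" "v \<in> W p"
  shows "proj_along (W p) (jmap ` W p) (u + jmap v) = u" "proj_along (jmap ` W p) (W p) (u + jmap v) = jmap v"
proof -
  show "proj_along (W p) (jmap ` W p) (u + jmap v) = u"
  proof (rule proj_along_eq)
    fix a b a' b' assume h: "a \<in> W p" "b \<in> jmap ` W p" "a' \<in> W p" "b' \<in> jmap ` W p"
        "a + b = a' + b'"
    then obtain x x' where "b = jmap x" "b' = jmap x'" "x \<in> W p" "x' \<in> W p" by blast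
    then show "a = a'" using W_unique(1)[OF p h(1) _ h(3), of x x'] h(5) by simp
  qed (use uv in auto)
  have "proj_along (jmap ` W p) (W p) (jmap v + u) = jmap v"
  proof (rule proj_along_eq)
    fix a b a' b' assume h: "a \<in> jmap ` W p" "b \<in> W p" "a' \<in> jmap ` W p" "b' \<in> W p"
        "a + b = a' + b'"
    then obtain x x' where "a = jmap x" "a' = jmap x'" "x \<in> W p" "x' \<in> W p" by blast
    then show "a = a'" using W_unique(2)[OF p h(2) _ h(4), of x x'] h(5) by (simp add: add.commute)
  qed (use uv in auto)
  then show "proj_along (jmap ` W p) (W p) (u + jmap v) = jmap v" by (simp add: add.commute)
qed

lemma invertible_W:
  assumes p: "p \<in> topspace X" and w: "W p = vec.span {w1, w2}"
      "\<forall>z1 z2. z1 *s w1 + z2 *s w2 = 0 \<longrightarrow> z1 = 0 \<and> z2 = 0"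
  shows "invertible (transpose (rows4 w1 w2 (jmap w1) (jmap w2)))"
proof (rule invertible_cols4)
  fix z1 z2 z3 z4 assume h: "z1 *s w1 + z2 *s w2 + z3 *s jmap w1 + z4 *s jmap w2 = 0"
  have "z1 *s w1 + z2 *s w2 + jmap (cnj z3 *s w1 + cnj z4 *s w2) = 0 + jmap 0"
    using h by (simp add: jmap_simps add.assoc)
  moreover have "0 \<in> W p" by (rule subspace_alt(1)[OF subspace_W[OF p]])
  moreover have "x *s w1 + y *s w2 \<in> W p" for x y unfolding w(1) span_pair by blast
  ultimately have "z1 *s w1 + z2 *s w2 = 0" "cnj z3 *s w1 + cnj z4 *s w2 = 0"
    using W_unique[OF p, of "z1 *s w1 + z2 *s w2" "cnj z3 *s w1 + cnj z4 *s w2" 0 0] by blast+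
  then show "z1 = 0 \<and> z2 = 0 \<and> z3 = 0 \<and> z4 = 0" using w(2)[rule_format, of z1 z2]
      w(2)[rule_format, of "cnj z3" "cnj z4"] by simp
qed

lemma decomp_W:
  assumes p: "p \<in> topspace X"
  shows "\<exists>u\<in>W p. \<exists>v\<in>W p. y = u + jmap v"
proof -
  obtain N w1 w2 where w0: "p \<in> N" "sm A N w1" "sm A N w2"
      "\<And>x. x \<in> N \<Longrightarrow> W x = vec.span {w1 x, w2 x}"
    "\<And>x. x \<in> N \<Longrightarrow> \<forall>z1 z2. z1 *s w1 x + z2 *s w2 x = 0 \<longrightarrow> z1 = 0
        \<and> z2 = 0" by (rule frame_W[OF p]) blast
  note w = w0(1) w0(4)[OF w0(1)] w0(5)[OF w0(1)]
  define K where "K = transpose (rows4 (w1 p) (w2 p) (jmap (w1 p)) (jmap (w2 p)))"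
  have "y = K *v (matrix_inv K *v y)"
    using invertible_W[OF p w(2,3)] by (simp add: K_def matrix_vector_mul_assoc matrix_inv_cancel)
  then obtain x :: "complex^4" where "y = x $ 1 *s w1 p + x $ 2 *s w2 p + x $ 3 *s jmap (w1 p) + x $ 4 *s jmap
      (w2 p)"
    unfolding K_def cols4_mult by blast
  then have "y = (x $ 1 *s w1 p + x $ 2 *s w2 p) + jmap (cnj (x $ 3) *s w1 p + cnj (x $ 4) *s w2 p)"
    by (simp add: jmap_simps)
  moreover have "x *s w1 p + y *s w2 p \<in> W p" for x y unfolding w(2) span_pair by blast
  ultimately show ?thesis by blast
qed

lemma P_apply:
  assumes p: "p \<in> topspace X" shows "P p *v y = proj_along (W p) (jmap ` W p) y"
proof -
  have lin: "Vector_Spaces.linear (*s) (*s) (proj_along (W p) (jmap ` W p))"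
  proof (intro Vector_Spaces.linear.intro vec.vector_space_axioms module_hom.intro vec.module_axioms
      module_hom_axioms.intro)
    note sub = subspace_alt[OF subspace_W[OF p]]
    fix x y z
    obtain u v where x: "u \<in> W p" "v \<in> W p" "x = u + jmap v" using decomp_W[OF p] by blast
    obtain u' v' where y: "u' \<in> W p" "v' \<in> W p" "y = u' + jmap v'" using decomp_W[OF p] by blast
    have px: "proj_along (W p) (jmap ` W p) x = u" unfolding x(3) by (rule proj_W(1)[OF p x(1,2)])
    have py: "proj_along (W p) (jmap ` W p) y = u'" unfolding y(3) by (rule proj_W(1)[OF p y(1,2)])
    have e: "x + y = (u + u') + jmap (v + v')" by (simp add: x y jmap_simps)
    show "proj_along (W p) (jmap ` W p) (x + y) = proj_along (W p) (jmap ` W p) x + proj_along (W p) (jmap ` W p)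
        y"
      unfolding px py unfolding e by (rule proj_W(1)[OF p sub(2)[OF x(1) y(1)] sub(2)[OF x(2) y(2)]])
    have e: "z *s x = z *s u + jmap (cnj z *s v)" by (simp add: x jmap_simps vec.scale_right_distrib)
    show "proj_along (W p) (jmap ` W p) (z *s x) = z *s proj_along (W p) (jmap ` W p) x"
      unfolding px unfolding e by (rule proj_W(1)[OF p sub(4)[OF x(1)] sub(4)[OF x(2)]])
  qed
  show ?thesis unfolding P_def by (rule matrix_works[OF lin])
qed

lemma P_W:
  assumes p: "p \<in> topspace X"
  shows "u \<in> W p \<Longrightarrow> v \<in> W p \<Longrightarrow> P p *v (u + jmap v) = u" "P p *v y \<in> W p"
      "u \<in> W p \<Longrightarrow> P p *v u = u"
    "P p ** P p = P p" "jc (P p) = mat 1 - P p" "proj_along (jmap ` W p) (W p) y = (mat 1 - P p) *v y"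
proof -
  show a: "P p *v (u + jmap v) = u" if "u \<in> W p" "v \<in> W p" for u v using proj_W(1)[OF p that] by
      (simp add: P_apply[OF p])
  show i: "P p *v y \<in> W p" for y using decomp_W[OF p, of y] a by auto
  have 0: "0 \<in> W p" by (rule subspace_alt(1)[OF subspace_W[OF p]])
  show f: "P p *v u = u" if "u \<in> W p" for u using a[OF that 0] by (simp add: jmap_simps)
  show "P p ** P p = P p" unfolding matrix_eq by (simp add: matrix_vector_mul_assoc[symmetric] f i)
  show "jc (P p) = mat 1 - P p"
  proof (rule jc_eqI)
    fix x
    obtain u v where x: "u \<in> W p" "v \<in> W p" "x = u + jmap v" using decomp_W[OF p] by blast
    have "- v \<in> W p" by (rule subspace_alt(5)[OF subspace_W[OF p] x(2)])
    moreover have jx: "jmap x = - v + jmap u" by (simp add: x jmap_simps)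
    ultimately have "P p *v jmap x = - v" using x(1) unfolding jx by (intro a)
    moreover have "P p *v x = u" unfolding x(3) by (rule a[OF x(1,2)])
    ultimately show "jmap (P p *v x) = (mat 1 - P p) *v jmap x"
      by (simp add: matrix_vector_simps(2)) (simp add: jx)
  qed
  obtain u v where y: "u \<in> W p" "v \<in> W p" "y = u + jmap v" using decomp_W[OF p] by blast
  show "proj_along (jmap ` W p) (W p) y = (mat 1 - P p) *v y"
    using proj_W(2)[OF p y(1,2)] a[OF y(1,2)] by (simp add: y matrix_vector_simps(2))
qed

lemma sm_P: "sm A (topspace X) P"
proof (rule sm_local)
  fix p assume p: "p \<in> topspace X"
  obtain N w1 w2 where w: "p \<in> N" "sm A N w1" "sm A N w2"
      "\<And>x. x \<in> N \<Longrightarrow> W x = vec.span {w1 x, w2 x}"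
    "\<And>x. x \<in> N \<Longrightarrow> \<forall>z1 z2. z1 *s w1 x + z2 *s w2 x = 0 \<longrightarrow> z1 = 0
        \<and> z2 = 0" by (rule frame_W[OF p]) blast
  have N: "openin X N" using sm_open[OF w(2)] by blast
  have top: "x \<in> topspace X" if "x \<in> N" for x using openin_subset[OF N] that by blast
  define K where "K x = transpose (rows4 (w1 x) (w2 x) (jmap (w1 x)) (jmap (w2 x)))" for x
  have sK: "sm A N K"
  proof -
    have "sm A N (\<lambda>x. rows4 (w1 x) (w2 x) (jmap (w1 x)) (jmap (w2 x)) $ j $ i)" for i j
      by (cases j rule: exhaust_4[THEN disjE]; (elim disjE)?; simp add: sm_nth w(2,3)
          sm_nth[OF sm_linear[OF bl_jmap w(2)]] sm_nth[OF sm_linear[OF bl_jmap w(3)]])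
    then show ?thesis unfolding K_def[abs_def] transpose_def by (intro sm_vec)
  qed
  have inv: "invertible (K x)" if "x \<in> N" for x unfolding K_def by
      (rule invertible_W[OF top[OF that] w(4)[OF that] w(5)[OF that]])
  have "K x ** E12 ** matrix_inv (K x) = P x" if x: "x \<in> N" for x
  proof -
    have "P x ** K x = K x ** E12" unfolding matrix_eq
    proof
      fix y
      have m: "x1 *s w1 x + x2 *s w2 x \<in> W x" for x1 x2 unfolding w(4)[OF x] span_pair by blast
      have "K x *v y = (y $ 1 *s w1 x + y $ 2 *s w2 x) + jmap (cnj (y $ 3) *s w1 x + cnj (y $ 4) *s w2 x)"
        unfolding K_def cols4_mult by (simp add: jmap_simps)
      then have "P x *v (K x *v y) = y $ 1 *s w1 x + y $ 2 *s w2 x" using P_W(1)[OF top[OF x] m m] by simp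
      also have "\<dots> = K x *v (E12 *v y)" unfolding K_def cols4_mult E12_mult by simp
      finally show "(P x ** K x) *v y = (K x ** E12) *v y" by (simp add: matrix_vector_mul_assoc)
    qed
    then show ?thesis using matrix_inv_cancel[OF inv[OF x]] by (metis matrix_mul_assoc matrix_mul_rid)
  qed
  moreover have "sm A N (\<lambda>x. K x ** E12 ** matrix_inv (K x))"
    by (intro sm_bilinear[OF bb_mm] sK sm_const N order_refl sm_matrix_inv inv)
  ultimately have "sm A N P" by (rule sm_cong)
  then show "\<exists>U. p \<in> U \<and> sm A U P" using w(1) by blast
qed auto

text \<open>The lift of \<tau>(\<alpha>) to \<open>complex^4\<close> turns a frame of W into a
  section of L^\<alpha>. Its parallelism says that d + B maps \<Lambda>^2 W into itself, so by
  \<open>wedge_parallel\<close> it preserves W; differentiating P w = w expresses this through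
  dP.\<close>

lemma parallel_W:
  assumes c: "c \<in> A" "p \<in> dom_ch c"
    and Bdef: "B = (inverse (\<alpha>^2) - 1) *k (Phi S q c p v ** PiM (S p)) + (\<alpha>^2 - 1) *k
        (Phi S q c p v ** PiP (S p))"
  shows "dd c P p v ** P p = - ((mat 1 - P p) ** B ** P p)"
proof -
  note top = in_top[OF c]
  obtain N w1 w2 where w: "p \<in> N" "sm A N w1" "sm A N w2"
      "\<And>x. x \<in> N \<Longrightarrow> W x = vec.span {w1 x, w2 x}"
    "\<And>x. x \<in> N \<Longrightarrow> \<forall>z1 z2. z1 *s w1 x + z2 *s w2 x = 0 \<longrightarrow> z1 = 0
        \<and> z2 = 0" by (rule frame_W[OF top]) blast
  have N: "openin X N" using sm_open[OF w(2)] by blast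
  have topN: "x \<in> topspace X" if "x \<in> N" for x using openin_subset[OF N] that by blast
  \<comment> \<open>Either square root of \<alpha> would do, because \<open>tens\<close> is even in
    the matrix.\<close>
  define e where "e = csqrt \<alpha>"
  have e: "e^2 = \<alpha>" "e \<noteq> 0" using BT_parts(1) by (auto simp: e_def)
  define T where "T x = inverse e *k PiP (S x) + e *k PiM (S x)" for x
  define U where "U x = e *k PiP (S x) + inverse e *k PiM (S x)" for x
  have TU: "T x ** U x = mat 1" "U x ** T x = mat 1" if "x \<in> topspace X" for x
    using e(2) Pi_sum[of "S x"] unfolding T_def U_def by (simp_all add: mat_alg Pi_simps[OF SS[OF that]])
  have sS1: "sm A N S" by (rule sm_subset[OF sS N]) (use topN in auto)
  have sPi: "sm A N (\<lambda>x. PiP (S x))" "sm A N (\<lambda>x. PiM (S x))"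
    unfolding PiP_def PiM_def by (intro sm_linear[OF bl_mscale] sm_diff sm_add sm_const sS1 N order_refl)+
  have sU: "sm A N U" unfolding U_def[abs_def] by (intro sm_add sm_linear[OF bl_mscale] sPi)
  note pp = c(1) w(1) c(2)
  have dU: "dd c U p v = ((e - inverse e) * (- \<i> / 2)) *k dd c S p v"
  proof -
    have "U = (\<lambda>x. ((e - inverse e) * (- \<i> / 2)) *k S x + ((e + inverse e) / 2) *k mat 1)"
      by (simp add: U_def PiP_def PiM_def fun_eq_iff vec_eq_iff algebra_simps add_divide_distrib
          diff_divide_distrib)
    moreover have "sm A N (\<lambda>x. ((e + inverse e) / 2) *k mat 1 :: complex^4^4)" by
        (rule sm_const[OF N order_refl])
    ultimately show ?thesis
      using dd_add[OF sm_linear[OF bl_mscale sS1] _ pp] dd_linear[OF bl_mscale sS1 pp] dd_const by simp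
  qed
  define M where "M = conn_matrix \<alpha> (NS S c p v) (NS S c p (J c p v)) (q c p v) (q c p (J c p v))"
  have B: "T p ** (dd c U p v + M ** U p) = B"
    using untwist[OF SS[OF top] NS_facts(1)[OF c, of v] NS_facts(1)[OF c, of "J c p v"] NS_facts(2)[OF c, of v]
        qS[OF c, of v] qJ[OF c, of v] e(2)]
    unfolding e(1) T_def U_def[of p] dU M_def Bdef Phi_def .
  define u1 where "u1 x = U x *v w1 x" for x
  define u2 where "u2 x = U x *v w2 x" for x
  have su: "sm A N u1" "sm A N u2" unfolding u1_def[abs_def] u2_def[abs_def] by (intro sm_bilinear[OF bb_mv] sU w)+
  have tT: "tau (S x) \<alpha> \<tau> = tens (T x) \<tau>" if "x \<in> topspace X" "\<tau> \<in> Wedge2" for x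
      \<tau>
    using tau_tens[OF SS[OF that(1)] that(2) e(2)] unfolding e(1) T_def .
  have tUT: "tens (U x) (tens (T x) \<tau>) = \<tau>" if "x \<in> topspace X" "\<tau> \<in> Wedge2" for x \<tau>
    using that(2) by (induction rule: Wedge2_induct) (simp_all add: tens_wedge tens_simps matrix_vector_mul_assoc
        TU[OF that(1)])
  have mem: "wedge (u1 x) (u2 x) \<in> L\<alpha> x" if x: "x \<in> N" for x
  proof -
    note t = topN[OF x]
    have "wedge (w1 x) (w2 x) \<in> wedge_space (W x) (W x)"
      unfolding w(4)[OF x] by (intro wedge_in_space vec.span_base) auto
    then obtain \<tau> where \<tau>: "\<tau> \<in> L\<alpha> x" "wedge (w1 x) (w2 x) = tau (S x) \<alpha> \<tau>"
        unfolding BT_parts(6)[OF t] by blast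
    then have \<tau>2: "\<tau> \<in> Wedge2" using BT_parts(3)[OF t] by blast
    have "wedge (u1 x) (u2 x) = tens (U x) (wedge (w1 x) (w2 x))" by (simp add: tens_wedge u1_def u2_def)
    also have "\<dots> = \<tau>" unfolding \<tau>(2) tT[OF t \<tau>2] by (rule tUT[OF t \<tau>2])
    finally show ?thesis using \<tau>(1) by simp
  qed
  have ls: "local_sec X A L\<alpha> N (\<lambda>x. wedge (u1 x) (u2 x))"
    unfolding local_sec_def using mem sm_bilinear[OF bb_wedge su] by (auto simp: sm_def)
  define y1 where "y1 = T p *v (dd c u1 p v + M *v u1 p)"
  define y2 where "y2 = T p *v (dd c u2 p v + M *v u2 p)"
  have dV: "dVlq J S q \<alpha> c (\<lambda>x. wedge (u1 x) (u2 x)) p v = wedge (dd c u1 p v + M *v u1 p) (u2 p) +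
      wedge (u1 p) (dd c u2 p v + M *v u2 p)"
    by (rule dVlq_wedge[OF sS1 _ su pp]) (simp_all add: SS topN M_def)
  have Tu: "T p *v u1 p = w1 p" "T p *v u2 p = w2 p" by (simp_all add: u1_def u2_def matrix_vector_mul_assoc
      TU[OF top])
  have "tens (T p) (dVlq J S q \<alpha> c (\<lambda>x. wedge (u1 x) (u2 x)) p v) \<in> wedge_space (W p) (W p)"
  proof -
    have h: "dVlq J S q \<alpha> c (\<lambda>x. wedge (u1 x) (u2 x)) p v \<in> L\<alpha> p" by
        (rule BT_parallel[OF ls w(1) c])
    then have "dVlq J S q \<alpha> c (\<lambda>x. wedge (u1 x) (u2 x)) p v \<in> Wedge2" using BT_parts(3)[OF top]
        by blast
    from tT[OF top this] show ?thesis unfolding BT_parts(6)[OF top] using h by (intro image_eqI[OF sym])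
  qed
  then have "wedge y1 (w2 p) + wedge (w1 p) y2 \<in> wedge_space (vec.span {w1 p, w2 p}) (vec.span {w1 p, w2 p})"
    unfolding dV tens_simps tens_wedge Tu y1_def[symmetric] y2_def[symmetric] w(4)[OF w(1)] .
  then obtain z where z: "wedge y1 (w2 p) + wedge (w1 p) y2 = z *s wedge (w1 p) (w2 p)" using wedge_space_pair by
      blast
  have y: "y1 \<in> W p" "y2 \<in> W p"
    unfolding w(4)[OF w(1)] using wedge_parallel[OF \<kappa> invertible_W[OF top w(4)[OF w(1)] w(5)[OF w(1)]] z] by
        auto
  \<comment> \<open>T (d + M) U w0 equals dw0 + B w0. If this lies in W, then P fixes it; compare
    with the derivative of P w0 = w0.\<close>
  have key: "(dd c P p v + (mat 1 - P p) ** B) *v w0 p = 0"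
    if sw: "sm A N w0" and wW: "\<And>x. x \<in> N \<Longrightarrow> w0 x \<in> W x" and yW:
        "T p *v (dd c (\<lambda>x. U x *v w0 x) p v + M *v (U p *v w0 p)) \<in> W p" for w0
  proof -
    have "T p *v (dd c (\<lambda>x. U x *v w0 x) p v + M *v (U p *v w0 p)) = (T p ** U p) *v dd c w0 p v +
        (T p ** (dd c U p v + M ** U p)) *v w0 p"
      unfolding dd_bilinear[OF bb_mv sU sw pp]
      by (simp add: matrix_vector_simps matrix_ring_simps matrix_vector_mul_assoc[symmetric])
    then have in_W: "dd c w0 p v + B *v w0 p \<in> W p" using yW unfolding TU(1)[OF top] B by simp
    have sP1: "sm A N P" by (rule sm_subset[OF sm_P N]) (use topN in auto)
    have "dd c w0 p v = dd c (\<lambda>x. P x *v w0 x) p v"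
      by (rule dd_cong[OF c(1) N w(1) c(2)]) (use wW P_W(3) topN in auto)
    then have "dd c w0 p v = P p *v dd c w0 p v + dd c P p v *v w0 p" unfolding dd_bilinear[OF bb_mv sP1 sw pp] .
    then have 1: "dd c P p v *v w0 p = dd c w0 p v - P p *v dd c w0 p v" by (simp add: eq_diff_eq add.commute)
    have "P p *v (dd c w0 p v + B *v w0 p) = dd c w0 p v + B *v w0 p" by (rule P_W(3)[OF top in_W])
    then have 2: "P p *v (B *v w0 p) = dd c w0 p v + B *v w0 p - P p *v dd c w0 p v"
      unfolding matrix_vector_simps(4) by (simp add: eq_diff_eq add.commute)
    show ?thesis
      unfolding matrix_vector_simps(1) matrix_ring_simps(1) matrix_mul_lid matrix_vector_simps(2)
          matrix_vector_mul_assoc[symmetric] 1 2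
      by simp
  qed
  have wW: "w1 x \<in> W x" "w2 x \<in> W x" if "x \<in> N" for x unfolding w(4)[OF that] by
      (auto intro: vec.span_base)
  have k1: "(dd c P p v + (mat 1 - P p) ** B) *v w1 p = 0" by (rule key[OF w(2) wW(1)])
      (use y(1) in \<open>simp_all add: y1_def u1_def[abs_def]\<close>)
  have k2: "(dd c P p v + (mat 1 - P p) ** B) *v w2 p = 0" by (rule key[OF w(3) wW(2)])
      (use y(2) in \<open>simp_all add: y2_def u2_def[abs_def]\<close>)
  have "(dd c P p v + (mat 1 - P p) ** B) *v (P p *v x) = 0" for x
  proof -
    obtain z1 z2 where "P p *v x = z1 *s w1 p + z2 *s w2 p" using P_W(2)[OF top, of x] unfolding w(4)[OF w(1)]
        span_pair by blast
    then show ?thesis using k1 k2 by (simp only: matrix_vector_simps(4,7) vec.scale_zero_right add_0)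
  qed
  then have "(dd c P p v + (mat 1 - P p) ** B) ** P p = 0" unfolding matrix_eq by
      (simp add: matrix_vector_mul_assoc[symmetric])
  then show ?thesis by (simp add: matrix_ring_simps(3) add_eq_0_iff)
qed

end

context backlund begin

text \<open>|\<alpha>| \<noteq> 1 keeps the zero and the pole of r_\<alpha> off the unit circle, so
  r_\<alpha> is finite and nonzero at -1 and its normalisation at 1 makes sense.\<close>

lemma multiplier_nz:
  shows "\<alpha>\<^sup>2 \<noteq> 0" "inverse ((cnj \<alpha>)\<^sup>2) \<noteq> 0" "\<alpha>\<^sup>2 \<noteq> 1"
      "inverse ((cnj \<alpha>)\<^sup>2) \<noteq> 1"
    "inverse ((cnj \<alpha>)\<^sup>2) \<noteq> -1" "\<alpha>\<^sup>2 \<noteq> -1" "s \<noteq> 0"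
proof -
  have n: "cmod (\<alpha>^2) \<noteq> 1"
  proof
    assume "cmod (\<alpha>^2) = 1"
    then have "cmod \<alpha> = 1 \<or> cmod \<alpha> = -1" by (simp add: norm_power power2_eq_1_iff)
    then show False using BT_parts(2) norm_ge_zero[of \<alpha>] by linarith
  qed
  have m: "cmod (inverse ((cnj \<alpha>)\<^sup>2)) = inverse (cmod (\<alpha>^2))" by
      (simp add: norm_inverse norm_power)
  have n': "cmod (inverse ((cnj \<alpha>)\<^sup>2)) \<noteq> 1"
  proof
    assume "cmod (inverse ((cnj \<alpha>)\<^sup>2)) = 1"
    then show False using n by (simp only: m inverse_eq_1_iff)
  qed
  show 1: "\<alpha>\<^sup>2 \<noteq> 1" "\<alpha>\<^sup>2 \<noteq> -1"
  proof (rule notI)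
    assume "\<alpha>\<^sup>2 = 1" then show False using n by (metis norm_one)
  next
    show "\<alpha>\<^sup>2 \<noteq> -1"
    proof
      assume "\<alpha>\<^sup>2 = -1" then show False using n by (metis norm_one norm_minus_cancel)
    qed
  qed
  show 2: "inverse ((cnj \<alpha>)\<^sup>2) \<noteq> 1" 
  proof
    assume "inverse ((cnj \<alpha>)\<^sup>2) = 1" then show False using n' by (metis norm_one)
  qed
  show "inverse ((cnj \<alpha>)\<^sup>2) \<noteq> -1"
  proof
    assume "inverse ((cnj \<alpha>)\<^sup>2) = -1" then show False using n' by (metis norm_one norm_minus_cancel)
  qed
  show 3: "\<alpha>\<^sup>2 \<noteq> 0" "inverse ((cnj \<alpha>)\<^sup>2) \<noteq> 0" using BT_parts(1) by simp_all
  have "r_fun \<alpha> 0 \<noteq> 0" unfolding r_fun_def using 1 2 3 by simp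
  then show "s \<noteq> 0" using BT_parts(7) by auto
qed

text \<open>The second value is the conjugate of the first and equals 1 / r_\<alpha>(\<infinity>),
  since zero and pole are exchanged by reflection in the unit circle.\<close>

lemma multiplier_values:
  "s * s = (1 - inverse ((cnj \<alpha>)\<^sup>2)) * \<alpha>\<^sup>2 / ((1 - \<alpha>\<^sup>2) * inverse
      ((cnj \<alpha>)\<^sup>2))"
  "cnj s * cnj s = (1 - \<alpha>\<^sup>2) / (1 - inverse ((cnj \<alpha>)\<^sup>2))"
proof -
  show s: "s * s = (1 - inverse ((cnj \<alpha>)\<^sup>2)) * \<alpha>\<^sup>2 / ((1 - \<alpha>\<^sup>2) * inverse
      ((cnj \<alpha>)\<^sup>2))"
    using BT_parts(7) multiplier_nz(1,2) by (simp add: r_fun_def power2_eq_square)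
  define c where "c = (cnj \<alpha>)\<^sup>2"
  have c: "cnj (\<alpha>\<^sup>2) = c" "cnj c = \<alpha>\<^sup>2" "c \<noteq> 0" "c \<noteq> 1"
      "\<alpha>\<^sup>2 \<noteq> 0" "\<alpha>\<^sup>2 \<noteq> 1"
    using multiplier_nz by (auto simp: c_def)
  have "cnj s * cnj s = cnj (s * s)" by simp
  also have "\<dots> = (1 - inverse (\<alpha>\<^sup>2)) * c / ((1 - c) * inverse (\<alpha>\<^sup>2))"
    unfolding s c_def[symmetric] by (simp add: c complex_cnj_inverse del: complex_cnj_power)
  also have "\<dots> = (1 - \<alpha>\<^sup>2) / (1 - inverse c)"
    using c(3-6) by (simp add: divide_simps) (simp add: algebra_simps)
  finally show "cnj s * cnj s = (1 - \<alpha>\<^sup>2) / (1 - inverse ((cnj \<alpha>)\<^sup>2))" by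
      (simp add: c_def)
qed

text \<open>\<open>parallel_W\<close> gives dP on W. Conjugation by j replaces P by 1 - P and
  exchanges the two parts of \<Phi>; the conjugated coefficients are those of the parameter \<beta>,
  which gives dP on jW.\<close>

lemma dd_projection:
  assumes c: "c \<in> A" "p \<in> dom_ch c"
  defines "\<beta> \<equiv> inverse ((cnj \<alpha>)\<^sup>2)"
  shows "dd c P p v = P p ** ((inverse \<beta> - 1) *k (Phi S q c p v ** PiM (S p)) + (\<beta> - 1) *k (Phi S q c p v ** PiP (S p))) ** (mat 1 - P p)
     - (mat 1 - P p) ** ((inverse (\<alpha>\<^sup>2) - 1) *k (Phi S q c p v ** PiM (S p)) + (\<alpha>\<^sup>2 - 1) *k (Phi S q c p v ** PiP (S p))) ** P p"
proof -
  note top = in_top[OF c] and pp = insertI1 c(2) c(2)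
  define B where "B = (inverse (\<alpha>\<^sup>2) - 1) *k (Phi S q c p v ** PiM (S p)) + (\<alpha>\<^sup>2 - 1) *k
      (Phi S q c p v ** PiP (S p))"
  have 1: "dd c P p v ** P p = - ((mat 1 - P p) ** B ** P p)" by (rule parallel_W[OF c B_def])
  have sP: "sm {c} (dom_ch c) P" by (rule sm_subset[OF sm_P]) (use c(1) chart_facts(1)[OF c(1)] in_top[OF c(1)] in
      auto)
  have k: "sm {c} (dom_ch c) (\<lambda>x. mat 1 :: complex^4^4)" using c chart_facts(1)[OF c(1)] by
      (simp add: sm_const)
  have "dd c (\<lambda>x. jc (P x)) p v = dd c (\<lambda>x. mat 1 - P x) p v"
    by (rule dd_cong[OF c(1) chart_facts(1)[OF c(1)] c(2) c(2)]) (use P_W(5) in_top[OF c(1)] in auto)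
  then have j: "jc (dd c P p v) = - dd c P p v"
    unfolding dd_linear[OF bl_jc sP pp] dd_diff[OF k sP pp] dd_const by simp
  have jB: "jc B = (inverse \<beta> - 1) *k (Phi S q c p v ** PiM (S p)) + (\<beta> - 1) *k
      (Phi S q c p v ** PiP (S p))"
    unfolding B_def \<beta>_def by (simp add: jc_simps jc_Phi[OF c] jc_Pi[OF jS[OF top]] complex_cnj_inverse
        add.commute)
  have "jc (dd c P p v ** P p) = jc (- ((mat 1 - P p) ** B ** P p))" using 1 by simp
  then have 2: "dd c P p v ** (mat 1 - P p) = P p ** jc B ** (mat 1 - P p)"
    by (simp only: jc_simps j P_W(5)[OF top] matrix_ring_simps(5) neg_equal_iff_equal) (simp add: matrix_mul_assoc)
  have "dd c P p v = dd c P p v ** (mat 1 - P p) + dd c P p v ** P p" by (simp add: matrix_ring_simps)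
  then show ?thesis unfolding 1 2 B_def[symmetric] jB[symmetric] by simp
qed

lemma r_apply:
  assumes p: "p \<in> topspace X"
  shows "r_zero s (W p) x = dress s (inverse s) (P p) *v x"
      "r_infty s (W p) x = dress (inverse (cnj s)) (cnj s) (P p) *v x"
  by (simp_all add: r_zero_def r_infty_def two_scale_def dress_def P_apply[OF p, symmetric] P_W(6)[OF p]
      mscale_simps(10) matrix_vector_simps(1))

lemma dressing: "p \<in> topspace X \<Longrightarrow> dressing_algebra (S p) (P p) s"
  using SS jS P_W(4,5) multiplier_nz(7) by unfold_locales auto

lemma BT_spheres:
  assumes p: "p \<in> topspace X"
  shows "BT_Splus s (W p) (S p) = (\<lambda>x. dress s (inverse s) (P p) *v x) ` Splus (S p)"
    "BT_Sminus s (W p) (S p) = (\<lambda>x. dress (inverse (cnj s)) (cnj s) (P p) *v x) ` Sminus (S p)"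
proof -
  interpret D: dressing_algebra "S p" "P p" s by (rule dressing[OF p])
  have r: "r_zero s (W p) = (\<lambda>x. dress s (inverse s) (P p) *v x)" using r_apply(1)[OF p] by blast
  show 1: "BT_Splus s (W p) (S p) = (\<lambda>x. dress s (inverse s) (P p) *v x) ` Splus (S p)" by
      (simp add: BT_Splus_def r)
  show "BT_Sminus s (W p) (S p) = (\<lambda>x. dress (inverse (cnj s)) (cnj s) (P p) *v x) ` Sminus (S p)"
    using D.jc_R(1) unfolding BT_Sminus_def 1 jmap_Splus[OF jS[OF p], symmetric] image_image D.Rz_def D.Ri_def
        jmap_mv by simp
qed

text \<open>If \<open>?R\<close> annihilates y, then r(0) applied to the S_+ component is minus
  r(\<infinity>) applied to the S_- component, a common vector of the two new eigenspaces.
  Complementarity makes it zero, and r(0) and r(\<infinity>) are injective.\<close>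

lemma invertible_RR:
  assumes p: "p \<in> topspace X"
  shows "invertible (dress s (inverse s) (P p) ** PiP (S p) + dress (inverse (cnj s)) (cnj s) (P p) ** PiM (S p))"
      (is "invertible ?R")
proof -
  interpret D: dressing_algebra "S p" "P p" s by (rule dressing[OF p])
  have int: "BT_Splus s (W p) (S p) \<inter> BT_Sminus s (W p) (S p) = {0}" using BT_parts(8)[OF p] by
      (simp add: complementary_def)
  have inj0: "y = 0" if "?R *v y = 0" for y
  proof -
    define u where "u = D.Rz *v (PiP (S p) *v y)"
    have "?R *v y = u + D.Ri *v (PiM (S p) *v y)"
      by (simp add: u_def D.Rz_def D.Ri_def matrix_vector_simps(1) matrix_vector_mul_assoc)
    then have "u = D.Ri *v (PiM (S p) *v (- y))" using that by (simp add: matrix_vector_simps(6)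
        eq_neg_iff_add_eq_0)
    then have "u \<in> BT_Sminus s (W p) (S p)"
      unfolding BT_spheres(2)[OF p] D.Ri_def using Pi_mem(2)[OF SS[OF p]] by blast
    moreover have "u \<in> BT_Splus s (W p) (S p)"
      unfolding BT_spheres(1)[OF p] u_def D.Rz_def using Pi_mem(1)[OF SS[OF p]] by blast
    ultimately have u0: "u = 0" using int by blast
    then have "D.Ri *v (PiM (S p) *v y) = 0" using \<open>?R *v y = u + _\<close> that by simp
    then have "D.Rii *v (D.Ri *v (PiM (S p) *v y)) = 0" "D.Rzi *v (D.Rz *v (PiP (S p) *v y)) = 0"
      using u0 unfolding u_def by simp_all
    then have "PiM (S p) *v y = 0" "PiP (S p) *v y = 0" using D.R_inv by (simp_all add: matrix_vector_mul_assoc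
        matrix_mul_assoc)
    then show "y = 0" using Pi_decomp[of "S p" y] by simp
  qed
  have "x = y" if "?R *v x = ?R *v y" for x y
    using inj0[of "x - y"] that by (simp add: matrix_vector_simps(5))
  then have "inj ((*v) ?R)" by (intro injI) blast
  then show ?thesis using matrix_left_invertible_injective invertible_left_inverse by blast
qed

text \<open>On the two new eigenspaces \<open>PiP D.Ss\<close> acts as 1 and 0, so it coincides with
  the projection \<open>proj_along\<close> in the definition of the transform.\<close>

lemma untwisted_BT_Ls:
  assumes p: "p \<in> topspace X"
  shows "dressing_algebra.Ls (S p) (P p) s (L p) = untwisted_BT s W S L p"
proof -
  interpret D: dressing_algebra "S p" "P p" s by (rule dressing[OF p])
  have inv: "invertible D.R" using invertible_RR[OF p] by (simp add: D.R_def D.Rz_def D.Ri_def)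
  note SS' = D.Ss_props(1)[OF inv] and PR = D.Pi_Ss_R[OF inv]
  have plus: "PiP D.Ss *v y = y" if y: "y \<in> BT_Splus s (W p) (S p)" for y
  proof -
    obtain x where x: "x \<in> Splus (S p)" "y = D.Rz *v x" using y unfolding BT_spheres(1)[OF p] D.Rz_def by blast
    then have "y = (D.Rz ** PiP (S p)) *v x" using Splus_iff(1)[OF SS[OF p], of x] by
        (simp add: matrix_vector_mul_assoc[symmetric])
    then show ?thesis using PR(1) by (simp add: matrix_vector_mul_assoc)
  qed
  have minus: "PiP D.Ss *v y = 0" if y: "y \<in> BT_Sminus s (W p) (S p)" for y
  proof -
    obtain x where x: "x \<in> Sminus (S p)" "y = D.Ri *v x" using y unfolding BT_spheres(2)[OF p] D.Ri_def by
        blast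
    then have "y = (D.Ri ** PiM (S p)) *v x" using Splus_iff(3)[OF SS[OF p], of x] by
        (simp add: matrix_vector_mul_assoc[symmetric])
    then show ?thesis using PR(3) by (simp add: matrix_vector_mul_assoc)
  qed
  have mem: "PiP D.Ss *v y \<in> BT_Splus s (W p) (S p)" "PiM D.Ss *v y \<in> BT_Sminus s (W p) (S p)" for y
    unfolding PR(5,6) BT_spheres[OF p] D.Rz_def[symmetric] D.Ri_def[symmetric] matrix_vector_mul_assoc[symmetric]
    using Pi_mem[OF SS[OF p]] by blast+
  have proj: "proj_along (BT_Splus s (W p) (S p)) (BT_Sminus s (W p) (S p)) y = PiP D.Ss *v y" for y
  proof -
    have "proj_along (BT_Splus s (W p) (S p)) (BT_Sminus s (W p) (S p)) (PiP D.Ss *v y + PiM D.Ss *v y) = PiP D.Ss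
        *v y"
    proof (rule proj_along_eq[OF mem])
      fix a b a' b' assume h: "a \<in> BT_Splus s (W p) (S p)" "b \<in> BT_Sminus s (W p) (S p)"
          "a' \<in> BT_Splus s (W p) (S p)"
        "b' \<in> BT_Sminus s (W p) (S p)" "a + b = a' + b'"
      have "PiP D.Ss *v (a + b) = PiP D.Ss *v (a' + b')" using h(5) by simp
      then show "a = a'" using plus[OF h(1)] plus[OF h(3)] minus[OF h(2)] minus[OF h(4)] by
          (simp add: matrix_vector_simps(4))
    qed
    then show ?thesis by (simp add: Pi_decomp)
  qed
  have "D.Lp (L p) = BT_Lplus s (W p) (S p) (L p)"
    unfolding D.Lp_def[OF inv] BT_Lplus_def proj r_apply(2)[OF p] D.Ri_def
    using Splus_iff(1)[OF SS[OF p]] by blast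
  then show ?thesis unfolding D.Ls_def[OF inv] untwisted_BT_def by simp
qed

lemma dressed: "dressed X A \<kappa> J S q L P s (\<alpha>\<^sup>2) (inverse ((cnj \<alpha>)\<^sup>2))
    (untwisted_BT s W S L)"
proof
  fix p assume p: "p \<in> topspace X"
  show "P p ** P p = P p" "jc (P p) = mat 1 - P p" using P_W(4,5)[OF p] .
  show "invertible (dress s (inverse s) (P p) ** PiP (S p) + dress (inverse (cnj s)) (cnj s) (P p) ** PiM (S p))"
    by (rule invertible_RR[OF p])
  show "dressing_algebra.Ls (S p) (P p) s (L p) = untwisted_BT s W S L p" by (rule untwisted_BT_Ls[OF p])
qed (rule sm_P multiplier_nz multiplier_values dd_projection; assumption)+

end

theorem theorem9p19:
  fixes X :: "'m topology" and A :: "'m chart set" and \<kappa> :: complex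
    and J :: "('m, real^2) form" and S :: "'m \<Rightarrow> complex^4^4" and q :: "('m, complex^4^4) form"
    and L W :: "'m \<Rightarrow> (complex^4) set" and L\<alpha> :: "'m \<Rightarrow> tensor2 set" and \<alpha> s :: complex
  assumes "oriented_surface X A"
    and "admissible \<kappa>"
    and "\<not> in_proper_subsphere \<kappa> X L"
    and "q_constrained_Willmore \<kappa> X A J S q L"
    and "untwisted_BT_parameters \<kappa> X A J S q \<alpha> L\<alpha> W s"
    and "immerses X A (untwisted_BT s W S L)"
  shows "constrained_Willmore \<kappa> X A (untwisted_BT s W S L)"
proof -
  interpret backlund X A \<kappa> J S q L \<alpha> s L\<alpha> W
    using assms by unfold_locales (simp_all add: admissible_def)
  interpret D: dressed X A \<kappa> J S q L P s "\<alpha>\<^sup>2" "inverse ((cnj \<alpha>)\<^sup>2)" "untwisted_BT s W S L"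
    by (rule dressed)
  show ?thesis
    unfolding constrained_Willmore_def using D.dressed_Willmore[OF assms(6)] by blast
qed

end
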